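(* Fix $H=\frac{1}{\sqrt{2\,\omega(H_\omega)}}\,H_\omega$. Then $$p^{-\omega}(n)=-\big(p^{H}(n)\big)^2-\frac14\sum_{\alpha\in\Sigma_{1/2}}p^{\omega-\alpha}(n)\,p^{\alpha-\omega}(n).$$
   Context: $\mathfrak g$ is a real split simple Lie algebra of real rank greater than one, $\mathfrak a$ its (split) Cartan subspace, $\Sigma$ the restricted roots (each root space $\mathfrak g_\alpha$ is one-dimensional and the centralizer $\mathfrak m$ of $\mathfrak a$ in the maximal compact subalgebra is $0$), $\Sigma_+$ a positive system, $\omega$ the highest root, $B$ the Killing form, $H_\alpha\in\mathfrak a$ the element with $\alpha(H)=B(H,H_\alpha)$ for all $H\in\mathfrak a$, $(\alpha,\beta)=B(H_\alpha,H_\beta)$. Put $\Sigma_0=\{\beta\in\Sigma_+:(\omega,\beta)=0\}$ and $\Sigma_{1/2}=\{\beta\in\Sigma_+:(\omega,\beta)=\frac12(\omega,\omega)\}$; then $\Sigma_+=\Sigma_0\cup\Sigma_{1/2}\cup\{\omega\}$ and $\alpha\in\Sigma_{1/2}$ implies $\omega-\alpha\in\Sigma_{1/2}$. Fix root vectors $X_\alpha\in\mathfrak g_\alpha$ ($\alpha\in\Sigma$) with $B(X_\alpha,X_{-\alpha})=1$. Write $Z=X_\omega$ and $Y_\alpha=X_\alpha$ for $\alpha\in\Sigma_{1/2}$. $G=\mathrm{Int}(\mathfrak g)$, $N=\exp\mathfrak n$ with $\mathfrak n=\bigoplus_{\alpha\in\Sigma_+}\mathfrak g_\alpha$, $P=MA\overline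 N$ the minimal parabolic subgroup with Lie algebra $\mathfrak a\oplus\bigoplus_{\alpha\in\Sigma_+}\mathfrak g_{-\alpha}$. $N$ carries coordinates $n=\exp(zZ)\exp(\sum_{\alpha\in\Sigma_{1/2}}y_\alpha Y_\alpha)\exp(\sum_{\beta\in\Sigma_0}x_\beta X_\beta)$. For $X\in\mathfrak g$, $\tau(X)$ is the vector field on $N$ with $\tau(X)f(n)=\frac{d}{dt}f([\exp(tX)n])|_{t=0}$, where $[\exp(tX)n]\in N$ is determined for small $t$ by $\exp(tX)n\in[\exp(tX)n]P$. Expanding $\tau(X)$ in the basis of left-invariant vector fields on $N$ determined by $Z$, the $Y_\alpha$ and the $X_\beta$, the function multiplying $Z$ is a polynomial; it is denoted $p^\alpha$ when $X=X_\alpha$ ($\alpha\in\Sigma$) and $p^H$ when $X=H\in\mathfrak a$. *)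

theory Defs
  imports "HOL-Analysis.Analysis"
begin

section \<open>Real Lie algebras and the Killing form\<close>

text \<open>
  A finite-dimensional real Lie algebra is a bracket \<open>br\<close> on a type of class \<open>euclidean_space\<close>.
  The inner product of that class plays no role: it only fixes the (canonical) vector space
  topology, and \<open>endo_trace\<close> does not depend on the choice of basis.
\<close>

definition lie_algebra :: "('g::euclidean_space \<Rightarrow> 'g \<Rightarrow> 'g) \<Rightarrow> bool" where
  "lie_algebra br \<longleftrightarrow> bilinear br \<and> (\<forall>x. br x x = 0) \<and>
     (\<forall>x y z. br x (br y z) + br y (br z x) + br z (br x y) = 0)"

definition lie_ideal :: "('g::euclidean_space \<Rightarrow> 'g \<Rightarrow> 'g) \<Rightarrow> 'g set \<Rightarrow> bool" where
  "lie_ideal br I \<longleftrightarrow> subspace I \<and> (\<forall>x. \<forall>y\<in>I. br x y \<in> I)"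

definition simple_lie_algebra :: "('g::euclidean_space \<Rightarrow> 'g \<Rightarrow> 'g) \<Rightarrow> bool" where
  "simple_lie_algebra br \<longleftrightarrow> lie_algebra br \<and> (\<exists>x y. br x y \<noteq> 0) \<and>
     (\<forall>I. lie_ideal br I \<longrightarrow> I = {0} \<or> I = UNIV)"

definition endo_trace :: "('g::euclidean_space \<Rightarrow> 'g) \<Rightarrow> real" where
  "endo_trace f = (\<Sum>b\<in>Basis. f b \<bullet> b)"

definition killing :: "('g::euclidean_space \<Rightarrow> 'g \<Rightarrow> 'g) \<Rightarrow> 'g \<Rightarrow> 'g \<Rightarrow> real" where
  "killing br x y = endo_trace (\<lambda>z. br x (br y z))"


section \<open>Cartan involution, Cartan subspace, restricted roots\<close>

definition cartan_involution ::
    "('g::euclidean_space \<Rightarrow> 'g \<Rightarrow> 'g) \<Rightarrow> ('g \<Rightarrow> 'g) \<Rightarrow> bool" where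
  "cartan_involution br \<theta> \<longleftrightarrow> linear \<theta> \<and> (\<forall>x y. \<theta> (br x y) = br (\<theta> x) (\<theta> y)) \<and>
     (\<forall>x. \<theta> (\<theta> x) = x) \<and> (\<forall>x. x \<noteq> 0 \<longrightarrow> - killing br x (\<theta> x) > 0)"

definition k_part :: "('g::euclidean_space \<Rightarrow> 'g) \<Rightarrow> 'g set" where
  "k_part \<theta> = {x. \<theta> x = x}"

definition p_part :: "('g::euclidean_space \<Rightarrow> 'g) \<Rightarrow> 'g set" where
  "p_part \<theta> = {x. \<theta> x = - x}"

definition abelian_on :: "('g::euclidean_space \<Rightarrow> 'g \<Rightarrow> 'g) \<Rightarrow> 'g set \<Rightarrow> bool" where
  "abelian_on br U \<longleftrightarrow> (\<forall>x\<in>U. \<forall>y\<in>U. br x y = 0)"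

definition cartan_subspace ::
    "('g::euclidean_space \<Rightarrow> 'g \<Rightarrow> 'g) \<Rightarrow> ('g \<Rightarrow> 'g) \<Rightarrow> 'g set \<Rightarrow> bool" where
  "cartan_subspace br \<theta> \<aa> \<longleftrightarrow> subspace \<aa> \<and> \<aa> \<subseteq> p_part \<theta> \<and> abelian_on br \<aa> \<and>
     (\<forall>U. subspace U \<and> U \<subseteq> p_part \<theta> \<and> abelian_on br U \<and> \<aa> \<subseteq> U \<longrightarrow> U = \<aa>)"

definition root_space ::
    "('g::euclidean_space \<Rightarrow> 'g \<Rightarrow> 'g) \<Rightarrow> 'g set \<Rightarrow> ('g \<Rightarrow> real) \<Rightarrow> 'g set" where
  "root_space br \<aa> \<alpha> = {x. \<forall>H\<in>\<aa>. br H x = \<alpha> H *\<^sub>R x}"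

text \<open>
  A root is a functional on \<open>\<aa>\<close>, represented by its extension by \<open>0\<close> outside \<open>\<aa>\<close>.  So equality
  of representing functions is equality on \<open>\<aa>\<close>, and the pointwise \<open>- \<alpha>\<close> and \<open>\<alpha> - \<beta>\<close> again
  represent functionals on \<open>\<aa>\<close>.  Linearity on \<open>\<aa>\<close> is forced by the root space being nonzero.
\<close>

definition roots :: "('g::euclidean_space \<Rightarrow> 'g \<Rightarrow> 'g) \<Rightarrow> 'g set \<Rightarrow> ('g \<Rightarrow> real) set" where
  "roots br \<aa> = {\<alpha>. (\<forall>H. H \<notin> \<aa> \<longrightarrow> \<alpha> H = 0) \<and> (\<exists>H\<in>\<aa>. \<alpha> H \<noteq> 0) \<and> root_space br \<aa> \<alpha> \<noteq> {0}}"

definition split_cartan ::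
    "('g::euclidean_space \<Rightarrow> 'g \<Rightarrow> 'g) \<Rightarrow> ('g \<Rightarrow> 'g) \<Rightarrow> 'g set \<Rightarrow> bool" where
  "split_cartan br \<theta> \<aa> \<longleftrightarrow> {x \<in> k_part \<theta>. \<forall>H\<in>\<aa>. br H x = 0} = {0} \<and>
     (\<forall>\<alpha>\<in>roots br \<aa>. dim (root_space br \<aa> \<alpha>) = 1)"

text \<open>The positive system of a Weyl chamber.\<close>

definition positive_system ::
    "('g::euclidean_space \<Rightarrow> 'g \<Rightarrow> 'g) \<Rightarrow> 'g set \<Rightarrow> ('g \<Rightarrow> real) set \<Rightarrow> bool" where
  "positive_system br \<aa> \<Sigma>p \<longleftrightarrow>
     (\<exists>H\<in>\<aa>. (\<forall>\<alpha>\<in>roots br \<aa>. \<alpha> H \<noteq> 0) \<and> \<Sigma>p = {\<alpha> \<in> roots br \<aa>. \<alpha> H > 0})"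

text \<open>
  Highest means \<open>\<alpha> \<le> \<omega>\<close> for all roots \<open>\<alpha>\<close>, i.e. \<open>\<omega> - \<alpha>\<close> is a sum of positive roots (with
  multiplicities, possibly empty).
\<close>

definition highest_root ::
    "('g::euclidean_space \<Rightarrow> 'g \<Rightarrow> 'g) \<Rightarrow> 'g set \<Rightarrow> ('g \<Rightarrow> real) set \<Rightarrow> ('g \<Rightarrow> real) \<Rightarrow> bool" where
  "highest_root br \<aa> \<Sigma>p \<omega> \<longleftrightarrow> \<omega> \<in> roots br \<aa> \<and>
     (\<forall>\<alpha>\<in>roots br \<aa>. \<exists>m :: ('g \<Rightarrow> real) \<Rightarrow> nat.
        \<forall>H\<in>\<aa>. \<omega> H - \<alpha> H = (\<Sum>\<beta>\<in>\<Sigma>p. real (m \<beta>) * \<beta> H))"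

definition coroot_vec ::
    "('g::euclidean_space \<Rightarrow> 'g \<Rightarrow> 'g) \<Rightarrow> 'g set \<Rightarrow> ('g \<Rightarrow> real) \<Rightarrow> 'g" where
  "coroot_vec br \<aa> \<alpha> = (THE K. K \<in> \<aa> \<and> (\<forall>H\<in>\<aa>. \<alpha> H = killing br H K))"

definition root_inner ::
    "('g::euclidean_space \<Rightarrow> 'g \<Rightarrow> 'g) \<Rightarrow> 'g set \<Rightarrow> ('g \<Rightarrow> real) \<Rightarrow> ('g \<Rightarrow> real) \<Rightarrow> real" where
  "root_inner br \<aa> \<alpha> \<beta> = killing br (coroot_vec br \<aa> \<alpha>) (coroot_vec br \<aa> \<beta>)"

definition roots_half ::
    "('g::euclidean_space \<Rightarrow> 'g \<Rightarrow> 'g) \<Rightarrow> 'g set \<Rightarrow> ('g \<Rightarrow> real) set \<Rightarrow> ('g \<Rightarrow> real)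
      \<Rightarrow> ('g \<Rightarrow> real) set" where
  "roots_half br \<aa> \<Sigma>p \<omega> =
     {\<beta> \<in> \<Sigma>p. root_inner br \<aa> \<omega> \<beta> = 1/2 * root_inner br \<aa> \<omega> \<omega>}"

definition root_vectors ::
    "('g::euclidean_space \<Rightarrow> 'g \<Rightarrow> 'g) \<Rightarrow> 'g set \<Rightarrow> (('g \<Rightarrow> real) \<Rightarrow> 'g) \<Rightarrow> bool" where
  "root_vectors br \<aa> X \<longleftrightarrow>
     (\<forall>\<alpha>\<in>roots br \<aa>. X \<alpha> \<in> root_space br \<aa> \<alpha> \<and> killing br (X \<alpha>) (X (- \<alpha>)) = 1)"


section \<open>The adjoint group and its subgroups\<close>

text \<open>
  All groups are groups of endomorphisms of \<open>'g\<close>, so \<open>exp\<close> on the Lie algebra is the exponential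
  series of \<open>ad X\<close> in \<open>'g \<Rightarrow>\<^sub>L 'g\<close>.
\<close>

definition ad :: "('g::euclidean_space \<Rightarrow> 'g \<Rightarrow> 'g) \<Rightarrow> 'g \<Rightarrow> ('g \<Rightarrow>\<^sub>L 'g)" where
  "ad br x = Blinfun (br x)"

definition Exp :: "('g::euclidean_space \<Rightarrow> 'g \<Rightarrow> 'g) \<Rightarrow> 'g \<Rightarrow> ('g \<Rightarrow>\<^sub>L 'g)" where
  "Exp br x = (\<Sum>k. (((o\<^sub>L) (ad br x)) ^^ k) id_blinfun /\<^sub>R fact k)"

text \<open>The set of exponentials is closed under inverses, hence the products below form a group.\<close>

inductive_set Int_group :: "('g::euclidean_space \<Rightarrow> 'g \<Rightarrow> 'g) \<Rightarrow> ('g \<Rightarrow>\<^sub>L 'g) set"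
  for br :: "'g::euclidean_space \<Rightarrow> 'g \<Rightarrow> 'g" where
  one: "id_blinfun \<in> Int_group br"
| step: "g \<in> Int_group br \<Longrightarrow> Exp br x o\<^sub>L g \<in> Int_group br"

text \<open>The global Cartan involution on \<open>Int_group br\<close> is conjugation by \<open>\<theta>\<close>.\<close>

definition K_group ::
    "('g::euclidean_space \<Rightarrow> 'g \<Rightarrow> 'g) \<Rightarrow> ('g \<Rightarrow> 'g) \<Rightarrow> ('g \<Rightarrow>\<^sub>L 'g) set" where
  "K_group br \<theta> = {g \<in> Int_group br. \<forall>x. \<theta> (blinfun_apply g x) = blinfun_apply g (\<theta> x)}"

definition M_group ::
    "('g::euclidean_space \<Rightarrow> 'g \<Rightarrow> 'g) \<Rightarrow> ('g \<Rightarrow> 'g) \<Rightarrow> 'g set \<Rightarrow> ('g \<Rightarrow>\<^sub>L 'g) set" where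
  "M_group br \<theta> \<aa> = {g \<in> K_group br \<theta>. \<forall>H\<in>\<aa>. blinfun_apply g H = H}"

definition n_alg ::
    "('g::euclidean_space \<Rightarrow> 'g \<Rightarrow> 'g) \<Rightarrow> 'g set \<Rightarrow> ('g \<Rightarrow> real) set \<Rightarrow> 'g set" where
  "n_alg br \<aa> \<Sigma>p = span (\<Union>\<alpha>\<in>\<Sigma>p. root_space br \<aa> \<alpha>)"

definition nbar_alg ::
    "('g::euclidean_space \<Rightarrow> 'g \<Rightarrow> 'g) \<Rightarrow> 'g set \<Rightarrow> ('g \<Rightarrow> real) set \<Rightarrow> 'g set" where
  "nbar_alg br \<aa> \<Sigma>p = span (\<Union>\<alpha>\<in>\<Sigma>p. root_space br \<aa> (- \<alpha>))"

definition N_group ::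
    "('g::euclidean_space \<Rightarrow> 'g \<Rightarrow> 'g) \<Rightarrow> 'g set \<Rightarrow> ('g \<Rightarrow> real) set \<Rightarrow> ('g \<Rightarrow>\<^sub>L 'g) set" where
  "N_group br \<aa> \<Sigma>p = Exp br ` n_alg br \<aa> \<Sigma>p"

definition P_group ::
    "('g::euclidean_space \<Rightarrow> 'g \<Rightarrow> 'g) \<Rightarrow> ('g \<Rightarrow> 'g) \<Rightarrow> 'g set \<Rightarrow> ('g \<Rightarrow> real) set
      \<Rightarrow> ('g \<Rightarrow>\<^sub>L 'g) set" where
  "P_group br \<theta> \<aa> \<Sigma>p =
     {m o\<^sub>L Exp br H o\<^sub>L Exp br V | m H V.
        m \<in> M_group br \<theta> \<aa> \<and> H \<in> \<aa> \<and> V \<in> nbar_alg br \<aa> \<Sigma>p}"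


section \<open>Vector fields on \<open>N\<close>\<close>

text \<open>
  A function on a finite-dimensional space is smooth iff it is differentiable and all its
  directional derivatives are again smooth.
\<close>

coinductive smooth_fun :: "('v::real_normed_vector \<Rightarrow> real) \<Rightarrow> bool" where
  "(\<And>x. (f has_derivative f' x) (at x)) \<Longrightarrow> (\<And>v. smooth_fun (\<lambda>x. f' x v)) \<Longrightarrow> smooth_fun f"

text \<open>
  \<open>N\<close> is a closed embedded submanifold of the space of endomorphisms, so its smooth functions are
  the restrictions of smooth functions on that space.
\<close>

definition smooth_on_N ::
    "('g::euclidean_space \<Rightarrow> 'g \<Rightarrow> 'g) \<Rightarrow> 'g set \<Rightarrow> ('g \<Rightarrow> real) set
      \<Rightarrow> (('g \<Rightarrow>\<^sub>L 'g) \<Rightarrow> real) \<Rightarrow> bool" where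
  "smooth_on_N br \<aa> \<Sigma>p f \<longleftrightarrow> (\<exists>F. smooth_fun F \<and> (\<forall>n\<in>N_group br \<aa> \<Sigma>p. f n = F n))"

text \<open>\<open>N_comp\<close> is the component \<open>[g] \<in> N\<close> of \<open>g\<close> with \<open>g \<in> [g] P\<close>, defined for \<open>g \<in> N P\<close>.\<close>

definition N_comp ::
    "('g::euclidean_space \<Rightarrow> 'g \<Rightarrow> 'g) \<Rightarrow> ('g \<Rightarrow> 'g) \<Rightarrow> 'g set \<Rightarrow> ('g \<Rightarrow> real) set
      \<Rightarrow> ('g \<Rightarrow>\<^sub>L 'g) \<Rightarrow> ('g \<Rightarrow>\<^sub>L 'g)" where
  "N_comp br \<theta> \<aa> \<Sigma>p g =
     (THE n. n \<in> N_group br \<aa> \<Sigma>p \<and> (\<exists>p\<in>P_group br \<theta> \<aa> \<Sigma>p. g = n o\<^sub>L p))"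

definition tau ::
    "('g::euclidean_space \<Rightarrow> 'g \<Rightarrow> 'g) \<Rightarrow> ('g \<Rightarrow> 'g) \<Rightarrow> 'g set \<Rightarrow> ('g \<Rightarrow> real) set
      \<Rightarrow> 'g \<Rightarrow> (('g \<Rightarrow>\<^sub>L 'g) \<Rightarrow> real) \<Rightarrow> ('g \<Rightarrow>\<^sub>L 'g) \<Rightarrow> real" where
  "tau br \<theta> \<aa> \<Sigma>p U f n =
     deriv (\<lambda>t. f (N_comp br \<theta> \<aa> \<Sigma>p (Exp br (t *\<^sub>R U) o\<^sub>L n))) 0"

definition left_inv ::
    "('g::euclidean_space \<Rightarrow> 'g \<Rightarrow> 'g) \<Rightarrow> 'g \<Rightarrow> (('g \<Rightarrow>\<^sub>L 'g) \<Rightarrow> real) \<Rightarrow> ('g \<Rightarrow>\<^sub>L 'g) \<Rightarrow> real" where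
  "left_inv br U f n = deriv (\<lambda>t. f (n o\<^sub>L Exp br (t *\<^sub>R U))) 0"

text \<open>
  The coefficients at \<open>n\<close> of \<open>\<tau>(U)\<close> in the frame of left-invariant vector fields determined by
  the \<open>X \<beta>\<close>, \<open>\<beta> \<in> \<Sigma>p\<close>.
\<close>

definition frame_coeffs ::
    "('g::euclidean_space \<Rightarrow> 'g \<Rightarrow> 'g) \<Rightarrow> ('g \<Rightarrow> 'g) \<Rightarrow> 'g set \<Rightarrow> ('g \<Rightarrow> real) set
      \<Rightarrow> (('g \<Rightarrow> real) \<Rightarrow> 'g) \<Rightarrow> 'g \<Rightarrow> ('g \<Rightarrow>\<^sub>L 'g) \<Rightarrow> ('g \<Rightarrow> real) \<Rightarrow> real" where
  "frame_coeffs br \<theta> \<aa> \<Sigma>p X U n =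
     (THE c. (\<forall>\<beta>. \<beta> \<notin> \<Sigma>p \<longrightarrow> c \<beta> = 0) \<and>
        (\<forall>f. smooth_on_N br \<aa> \<Sigma>p f \<longrightarrow>
           tau br \<theta> \<aa> \<Sigma>p U f n = (\<Sum>\<beta>\<in>\<Sigma>p. c \<beta> * left_inv br (X \<beta>) f n)))"

definition Z_coeff ::
    "('g::euclidean_space \<Rightarrow> 'g \<Rightarrow> 'g) \<Rightarrow> ('g \<Rightarrow> 'g) \<Rightarrow> 'g set \<Rightarrow> ('g \<Rightarrow> real) set
      \<Rightarrow> ('g \<Rightarrow> real) \<Rightarrow> (('g \<Rightarrow> real) \<Rightarrow> 'g) \<Rightarrow> 'g \<Rightarrow> ('g \<Rightarrow>\<^sub>L 'g) \<Rightarrow> real" where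
  "Z_coeff br \<theta> \<aa> \<Sigma>p \<omega> X U n = frame_coeffs br \<theta> \<aa> \<Sigma>p X U n \<omega>"

end

theory Submission
  imports Defs
begin

text \<open>
  Write \<open>exp(t U) n = n exp(t n\<^sup>-\<^sup>1 U)\<close> and split \<open>n\<^sup>-\<^sup>1 U\<close> along \<open>\<nn> + (\<aa> + \<nn>\<^sup>-)\<close>: the value of
  \<open>\<tau>(U)\<close> at \<open>n\<close> is the left-invariant field of the \<open>\<nn>\<close>-part, so its \<open>X\<^bsub>\<omega>\<^esub>\<close>-coefficient is
  \<open>B(n\<^sup>-\<^sup>1 U, X\<^bsub>-\<omega>\<^esub>) = B(U, W)\<close> with \<open>W = n X\<^bsub>-\<omega>\<^esub>\<close>.  The claim thus is a quadratic relation
  between the coordinates of a point \<open>W\<close> of the orbit of the lowest root vector, and follows from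
  \<open>(ad W)\<^sup>2 Y = - (\<omega>, \<omega>) B(W, Y) W\<close>.

  That \<open>[exp(t U) n]\<close> exists for small \<open>t\<close>, and that \<open>N\<close> is a group, is proved without the
  structure theory of Lie groups by following the orbit of a regular element \<open>H\<^sub>0\<close>: one has
  \<open>N H\<^sub>0 = H\<^sub>0 + \<nn>\<close>, an automorphism near the identity lies in \<open>P\<close> as soon as it maps \<open>H\<^sub>0\<close> into
  \<open>H\<^sub>0 + \<nn>\<^sup>-\<close>, and \<open>(x, y) \<mapsto> exp(x) (H\<^sub>0 + y)\<close> is a local chart of \<open>\<gg>\<close> at \<open>H\<^sub>0\<close>.
\<close>

section \<open>Trace and Killing form\<close>

text \<open>The number B([W, X_-\<omega>], [W, X_\<omega>]) is computed in two ways. Moving W across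
  the form and using (ad W)^2 gives a multiple of B(W, X_-\<omega>); moving X_-\<omega> gives B(W, T
  W) for T Y = [X_-\<omega>, [Y, X_\<omega>]], and among the root vectors T is nonzero only on
  X_-\<omega> and on X_-\<alpha> with \<alpha> in the half set. Since B(W, X_\<omega>) = 1 on N, the
  coordinate B(W, X_-\<omega>) enters linearly, once on each side with coefficient (\<omega>,
  \<omega>). This is the origin of the 2 in the normalization of H and of the 1/4. The analytic
  obstacle is that [g] and the frame coefficients are definite descriptions, so both existence and
  uniqueness are owed. In the local factorization the chart only brings H0 to H0 + h + z with h in
  the Cartan subspace; h vanishes because conjugation preserves the discrete spectrum of ad H0. An
  automorphism fixing H0 is then diagonal, possibly with negative entries; closeness to the identity
  makes them positive, and only then does a logarithm exist.\<close>

lemma endo_trace_eq_sum_Basis2: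
  fixes f g :: "'g::euclidean_space \<Rightarrow> 'g"
  assumes "linear f"
  shows "endo_trace (\<lambda>x. f (g x)) = (\<Sum>b\<in>Basis. \<Sum>c\<in>Basis. (g b \<bullet> c) * (f c \<bullet> b))"
proof -
  have "f (g b) \<bullet> b = (\<Sum>c\<in>Basis. (g b \<bullet> c) * (f c \<bullet> b))" for b
  proof -
    have "f (g b) = f (\<Sum>c\<in>Basis. (g b \<bullet> c) *\<^sub>R c)"
      by (simp add: euclidean_representation)
    also have "\<dots> = (\<Sum>c\<in>Basis. (g b \<bullet> c) *\<^sub>R f c)"
      using assms by (simp add: linear_sum linear_scale)
    finally show ?thesis by (simp add: inner_sum_left)
  qed
  then show ?thesis by (simp add: endo_trace_def)
qed

lemma endo_trace_commute:
  fixes f g :: "'g::euclidean_space \<Rightarrow> 'g"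
  assumes "linear f" "linear g"
  shows "endo_trace (\<lambda>x. f (g x)) = endo_trace (\<lambda>x. g (f x))"
  unfolding endo_trace_eq_sum_Basis2[OF assms(1)] endo_trace_eq_sum_Basis2[OF assms(2)]
  by (subst sum.swap) (simp add: mult.commute)

lemma endo_trace_add: "endo_trace (\<lambda>x. f x + g x) = endo_trace f + endo_trace g"
  by (simp add: endo_trace_def inner_add_left sum.distrib)

lemma endo_trace_diff: "endo_trace (\<lambda>x. f x - g x) = endo_trace f - endo_trace g"
  by (simp add: endo_trace_def inner_diff_left sum_subtractf)

lemma endo_trace_scaleR: "endo_trace (\<lambda>x. r *\<^sub>R f x) = r * endo_trace f"
  by (simp add: endo_trace_def sum_distrib_left)

locale lie_alg =
  fixes br :: "'g::euclidean_space \<Rightarrow> 'g \<Rightarrow> 'g"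
  assumes lie_algebra: "lie_algebra br"
begin

abbreviation kill where "kill \<equiv> killing br"

lemma bilinear_br: "bilinear br"
  using lie_algebra by (simp add: lie_algebra_def)

sublocale br: bounded_bilinear br
  using bilinear_br by (simp add: bilinear_conv_bounded_bilinear)

lemma linear_br: "linear (br x)"
  using bilinear_br by (simp add: bilinear_def)

lemma br_self [simp]: "br x x = 0"
  using lie_algebra by (simp add: lie_algebra_def)

lemma br_skew: "br x y = - br y x"
proof -
  have "br (x + y) (x + y) = 0" by simp
  then have "br x y + br y x = 0"
    unfolding br.add_left br.add_right by (simp add: add.commute)
  then show ?thesis by (rule iffD2[OF eq_neg_iff_add_eq_0])
qed

lemma jacobi: "br x (br y z) = br (br x y) z + br y (br x z)"
proof -
  have "br x (br y z) + br y (br z x) + br z (br x y) = 0"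
    using lie_algebra by (simp add: lie_algebra_def)
  moreover have "br y (br z x) = - br y (br x z)"
    by (metis br_skew br.minus_right)
  moreover have "br z (br x y) = - br (br x y) z"
    by (rule br_skew)
  ultimately show ?thesis by (simp add: algebra_simps)
qed

lemma ad_commutator: "br (br x y) z = br x (br y z) - br y (br x z)"
  using jacobi[of x y z] by simp

lemma linear_br_br: "linear (\<lambda>z. br x (br y z))"
  using linear_compose[OF linear_br linear_br] by (simp add: o_def)

lemma kill_commute: "kill x y = kill y x"
  unfolding killing_def by (rule endo_trace_commute) (rule linear_br)+

lemma linear_kill_right: "linear (kill x)"
  unfolding killing_def
  by (rule linearI)
    (simp_all add: br.add_left br.add_right br.scaleR_left br.scaleR_right
      endo_trace_add endo_trace_scaleR)

lemma bilinear_kill: "bilinear kill"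
proof -
  have "(\<lambda>x. kill x y) = kill y" for y
    by (simp add: fun_eq_iff kill_commute)
  then show ?thesis by (simp add: bilinear_def linear_kill_right)
qed

sublocale kill: bounded_bilinear kill
  using bilinear_kill by (simp add: bilinear_conv_bounded_bilinear)

text \<open>Expanding both commutators leaves one common triple trace; the two remaining ones agree
  by cyclicity of the trace.\<close>

lemma kill_br_left: "kill (br x y) z = kill x (br y z)"
proof -
  have 1: "kill (br x y) z = endo_trace (\<lambda>v. br x (br y (br z v))) - endo_trace (\<lambda>v. br y (br x (br z v)))"
    unfolding killing_def by (simp add: ad_commutator endo_trace_diff)
  have 2: "kill x (br y z) = endo_trace (\<lambda>v. br x (br y (br z v))) - endo_trace (\<lambda>v. br x (br z (br y v)))"
    unfolding killing_def
    by (simp add: ad_commutator br.diff_right endo_trace_diff)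
  have "endo_trace (\<lambda>v. br y (br x (br z v))) = endo_trace (\<lambda>v. br x (br z (br y v)))"
    by (rule endo_trace_commute[OF linear_br linear_br_br])
  with 1 2 show ?thesis by simp
qed

lemma kill_br_right: "kill x (br y z) = - kill (br y x) z"
  by (simp add: kill_br_left br_skew[of y x] kill.minus_left)

text \<open>\<open>ad (g x) = g (ad x) g\<^sup>-\<^sup>1\<close>, and the trace is invariant under conjugation.\<close>

lemma kill_aut:
  assumes "linear g" "linear h" "\<And>x. h (g x) = x" "\<And>x. g (h x) = x"
    and "\<And>x y. g (br x y) = br (g x) (g y)"
  shows "kill (g x) (g y) = kill x y"
proof -
  have "kill (g x) (g y) = endo_trace (\<lambda>z. g (br x (br y (h z))))"
    unfolding killing_def by (simp add: assms(4,5))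
  also have "\<dots> = endo_trace (\<lambda>z. br x (br y (h (g z))))"
    by (rule endo_trace_commute[OF assms(1), of "\<lambda>z. br x (br y (h z))"])
      (use linear_compose[OF assms(2) linear_br_br] in \<open>simp add: o_def\<close>)
  finally show ?thesis using assms(3) by (simp add: killing_def)
qed

end

section \<open>Nondegenerate Killing form: representing functionals and derivations\<close>

locale killing_nondegenerate = lie_alg +
  assumes kill_nondegenerate: "(\<And>y. kill x y = 0) \<Longrightarrow> x = 0"
begin

lemma center_trivial: "(\<And>y. br x y = 0) \<Longrightarrow> x = 0"
  by (rule kill_nondegenerate) (simp add: killing_def endo_trace_def)

lemma kill_representation:
  assumes "linear \<phi>"
  obtains d where "\<And>x. kill d x = \<phi> x"
proof -
  \<comment> \<open>The coordinates of \<open>j x\<close> are the values of the functional B(x, .)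
    on the basis, so injectivity of \<open>j\<close> is nondegeneracy, and surjectivity follows by
    dimension.\<close>
  define j where "j x = (\<Sum>b\<in>Basis. kill x b *\<^sub>R b)" for x
  have "linear j"
    unfolding j_def
    by (rule linearI) (simp_all add: kill.add_left kill.scaleR_left algebra_simps sum.distrib scaleR_sum_right)
  moreover have "x = 0" if "j x = 0" for x
  proof (rule kill_nondegenerate)
    have "kill x b = 0" if "b \<in> Basis" for b
      using arg_cong[OF \<open>j x = 0\<close>, of "\<lambda>v. v \<bullet> b"] that
      by (simp add: j_def)
    then have "kill x (\<Sum>b\<in>Basis. (y \<bullet> b) *\<^sub>R b) = 0" for y
      by (simp add: kill.sum_right kill.scaleR_right)
    then show "kill x y = 0" for y
      by (simp add: euclidean_representation)
  qed
  ultimately have "surj j"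
    by (simp add: linear_injective_0 linear_injective_imp_surjective)
  then obtain d where d: "j d = (\<Sum>b\<in>Basis. \<phi> b *\<^sub>R b)"
    by (metis surjD)
  have "kill d b = \<phi> b" if "b \<in> Basis" for b
    using arg_cong[OF d, of "\<lambda>v. v \<bullet> b"] that by (simp add: j_def)
  then have "kill d x = \<phi> x" for x
    using linear_eq_stdbasis[OF linear_kill_right assms] by metis
  then show ?thesis by (rule that)
qed

text \<open>Choose d representing x -> tr(D ad x). Then E = D - ad d is a derivation with tr(E ad x)
  = 0 for all x. As ad(E x) is the commutator of E and ad x, cyclicity gives B(E x, y) = tr(E ad
  [x, y]) = 0, hence E = 0.\<close>

lemma derivation_inner:
  assumes "linear D" and D: "\<And>x y. D (br x y) = br (D x) y + br x (D y)"
  obtains d where "\<And>x. D x = br d x"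
proof -
  have lin: "linear (\<lambda>x. endo_trace (\<lambda>z. D (br x z)))"
    by (rule linearI)
      (simp_all add: br.add_left br.scaleR_left linear_add[OF assms(1)] linear_scale[OF assms(1)]
        endo_trace_add endo_trace_scaleR)
  obtain d where d: "\<And>x. kill d x = endo_trace (\<lambda>z. D (br x z))"
    using kill_representation[OF lin] by blast
  define E where "E x = D x - br d x" for x
  have linE: "linear E"
    unfolding E_def by (intro linear_compose_sub assms linear_br)
  have E: "E (br x y) = br (E x) y + br x (E y)" for x y
    unfolding E_def D jacobi[of d x y] by (simp add: algebra_simps br.diff_left br.diff_right)
  have tr0: "endo_trace (\<lambda>z. E (br x z)) = 0" for x
    using d[of x] by (simp add: E_def endo_trace_diff killing_def)
  have "kill (E x) y = 0" for x y
  proof -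
    have lxE: "linear (\<lambda>z. br x (E z))"
      using linear_compose[OF linE linear_br] by (simp add: o_def)
    have "kill (E x) y = endo_trace (\<lambda>z. E (br x (br y z)) - br x (E (br y z)))"
      unfolding killing_def by (simp add: E)
    also have "\<dots> = endo_trace (\<lambda>z. E (br x (br y z))) - endo_trace (\<lambda>z. br x (E (br y z)))"
      by (rule endo_trace_diff)
    also have "endo_trace (\<lambda>z. br x (E (br y z))) = endo_trace (\<lambda>z. E (br y (br x z)))"
      by (rule endo_trace_commute[OF linear_br, of "\<lambda>z. E (br y z)"])
        (use linear_compose[OF linear_br linE] in \<open>simp add: o_def\<close>)
    also have "endo_trace (\<lambda>z. E (br x (br y z))) - \<dots> = endo_trace (\<lambda>z. E (br (br x y) z))"
      by (simp add: ad_commutator linear_diff[OF linE] endo_trace_diff)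
    finally show ?thesis by (simp add: tr0)
  qed
  then have "E x = 0" for x by (rule kill_nondegenerate)
  then show ?thesis using that[of d] by (simp add: E_def)
qed

end

section \<open>Exponentials of inner derivations\<close>

text \<open>
  A copy of the type of endomorphisms that carries the class structure of a Banach algebra, so that
  the exponential function of the library becomes available.
\<close>

typedef (overloaded) 'a endo = "UNIV :: ('a::euclidean_space \<Rightarrow>\<^sub>L 'a) set"
  morphisms blin Endo by auto

setup_lifting type_definition_endo

instantiation endo :: (euclidean_space) real_normed_algebra_1
begin

lift_definition zero_endo :: "'a endo" is 0 .
lift_definition one_endo :: "'a endo" is id_blinfun .
lift_definition plus_endo :: "'a endo \<Rightarrow> 'a endo \<Rightarrow> 'a endo" is "(+)" .
lift_definition minus_endo :: "'a endo \<Rightarrow> 'a endo \<Rightarrow> 'a endo" is "(-)" .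
lift_definition uminus_endo :: "'a endo \<Rightarrow> 'a endo" is uminus .
lift_definition times_endo :: "'a endo \<Rightarrow> 'a endo \<Rightarrow> 'a endo" is "(o\<^sub>L)" .
lift_definition scaleR_endo :: "real \<Rightarrow> 'a endo \<Rightarrow> 'a endo" is "(*\<^sub>R)" .
lift_definition norm_endo :: "'a endo \<Rightarrow> real" is norm .
definition dist_endo :: "'a endo \<Rightarrow> 'a endo \<Rightarrow> real" where "dist_endo a b = norm (a - b)"
definition sgn_endo :: "'a endo \<Rightarrow> 'a endo" where "sgn_endo a = scaleR (inverse (norm a)) a"
definition uniformity_endo :: "('a endo \<times> 'a endo) filter" where
  "uniformity_endo = (INF e\<in>{0 <..}. principal {(x, y). dist x y < e})"
definition open_endo :: "'a endo set \<Rightarrow> bool" where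
  "open_endo S = (\<forall>x\<in>S. \<forall>\<^sub>F (x', y) in uniformity. x' = x \<longrightarrow> y \<in> S)"

instance
proof
  fix a b c :: "'a endo" and r s :: real
  show "dist a b = norm (a - b)" by (rule dist_endo_def)
  show "sgn a = inverse (norm a) *\<^sub>R a" by (rule sgn_endo_def)
  show "uniformity = (INF e\<in>{0 <..}. principal {(x, y :: 'a endo). dist x y < e})"
    by (rule uniformity_endo_def)
  show "open U = (\<forall>x\<in>U. \<forall>\<^sub>F (x', y) in uniformity. x' = x \<longrightarrow> y \<in> U)" for U :: "'a endo set"
    by (rule open_endo_def)
  show "(0 :: 'a endo) \<noteq> 1"
  proof (transfer, rule notI)
    assume "0 = (id_blinfun :: 'a \<Rightarrow>\<^sub>L 'a)"
    then have "blinfun_apply 0 x = blinfun_apply id_blinfun x" for x :: 'a by simp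
    then show False using nonzero_Basis SOME_Basis by (simp, blast)
  qed
  show "norm (a * b) \<le> norm a * norm b" by transfer (rule norm_blinfun_compose)
  show "norm (1 :: 'a endo) = 1" by transfer simp
  show "norm (a + b) \<le> norm a + norm b" by transfer (rule norm_triangle_ineq)
  show "norm (r *\<^sub>R a) = \<bar>r\<bar> * norm a" by transfer simp
  show "norm a = 0 \<longleftrightarrow> a = 0" by transfer simp
  show "a * b * c = a * (b * c)" by transfer (rule blinfun_eqI, simp)
  show "(a + b) * c = a * c + b * c"
    by transfer (rule bounded_bilinear.add_left[OF bounded_bilinear_blinfun_compose])
  show "a * (b + c) = a * b + a * c"
    by transfer (rule bounded_bilinear.add_right[OF bounded_bilinear_blinfun_compose])
  show "r *\<^sub>R a * b = r *\<^sub>R (a * b)"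
    by transfer (rule bounded_bilinear.scaleR_left[OF bounded_bilinear_blinfun_compose])
  show "a * r *\<^sub>R b = r *\<^sub>R (a * b)"
    by transfer (rule bounded_bilinear.scaleR_right[OF bounded_bilinear_blinfun_compose])
  show "1 * a = a" by transfer (rule blinfun_eqI, simp)
  show "a * 1 = a" by transfer (rule blinfun_eqI, simp)
  show "r *\<^sub>R (a + b) = r *\<^sub>R a + r *\<^sub>R b" by transfer (rule scaleR_add_right)
  show "(r + s) *\<^sub>R a = r *\<^sub>R a + s *\<^sub>R a" by transfer (rule scaleR_add_left)
  show "r *\<^sub>R s *\<^sub>R a = (r * s) *\<^sub>R a" by transfer simp
  show "1 *\<^sub>R a = a" by transfer simp
  show "a + b + c = a + (b + c)" by transfer (rule add.assoc)
  show "a + b = b + a" by transfer (rule add.commute)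
  show "0 + a = a" by transfer (rule add_0_left)
  show "- a + a = 0" by transfer (rule left_minus)
  show "a - b = a + - b" by transfer (rule diff_conv_add_uminus)
qed

end

lemma bounded_linear_blin: "bounded_linear blin"
  by (rule bounded_linear_intro[where K = 1])
    (simp_all add: plus_endo.rep_eq scaleR_endo.rep_eq norm_endo.rep_eq)

lemma bounded_linear_Endo: "bounded_linear Endo"
  by (rule bounded_linear_intro[where K = 1])
    (simp_all add: plus_endo.abs_eq scaleR_endo.abs_eq norm_endo.abs_eq)

instance endo :: (euclidean_space) banach
proof
  fix a :: "nat \<Rightarrow> 'a endo"
  assume "Cauchy a"
  then have "Cauchy (\<lambda>k. blin (a k))"
    by (rule bounded_linear.Cauchy[OF bounded_linear_blin])
  then obtain l where "(\<lambda>k. blin (a k)) \<longlonglongrightarrow> l"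
    unfolding Cauchy_convergent_iff convergent_def by blast
  then have "(\<lambda>k. Endo (blin (a k))) \<longlonglongrightarrow> Endo l"
    by (rule bounded_linear.tendsto[OF bounded_linear_Endo])
  then have "a \<longlonglongrightarrow> Endo l" by (simp only: blin_inverse)
  then show "convergent a" by (rule convergentI)
qed

lemma blin_power: "blin (a ^ k) = (((o\<^sub>L) (blin a)) ^^ k) id_blinfun"
  by (induction k) (simp_all add: one_endo.rep_eq times_endo.rep_eq)

lemma norm_exp_minus_linear_le:
  fixes a :: "'a::{real_normed_algebra_1,banach}"
  shows "norm (exp a - 1 - a) \<le> exp (norm a) - 1 - norm a"
proof -
  let ?f = "\<lambda>n. inverse (fact (n + 2)) * norm a ^ (n + 2)"
  have le: "norm (inverse (fact (n + 2)) *\<^sub>R a ^ (n + 2)) \<le> ?f n" for n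
    using mult_left_mono[OF norm_power_ineq[of a "n + 2"], of "inverse (fact (n + 2))"] by simp
  have "summable ?f"
    by (rule summable_exp [THEN summable_ignore_initial_segment])
  then have "norm (\<Sum>n. inverse (fact (n + 2)) *\<^sub>R a ^ (n + 2)) \<le> (\<Sum>n. ?f n)"
    using le by (intro norm_suminf_le)
  then show ?thesis
    using exp_first_two_terms[of a] exp_first_two_terms[of "norm a"] by simp
qed

lemma has_derivative_exp_at_0:
  "((exp :: 'a::{real_normed_algebra_1,banach} \<Rightarrow> 'a) has_derivative (\<lambda>h. h)) (at 0)"
proof (rule has_derivativeI_sandwich[where e = 1 and H = norm])
  fix a :: 'a
  assume "a \<noteq> 0" "dist a 0 < 1"
  \<comment> \<open>The radius 1 of the sandwich enters here: \<open>exp_bound\<close> gives exp r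
    \<le> 1 + r + r^2 for r in [0, 1].\<close>
  then have "norm (exp a - 1 - a) \<le> (norm a)\<^sup>2"
    using norm_exp_minus_linear_le[of a] exp_bound[of "norm a"] by simp
  then show "norm (exp a - exp 0 - (a - 0)) / norm (a - 0) \<le> norm a"
    using \<open>a \<noteq> 0\<close> by (simp add: field_simps power2_eq_square)
next
  show "(norm \<longlongrightarrow> 0) (at (0 :: 'a))"
    using tendsto_norm[OF tendsto_ident_at, of "0 :: 'a" UNIV] by simp
qed (simp_all add: bounded_linear_ident)

text \<open>On each ball the exponential is a uniform limit of its partial sums, which are
  polynomials.\<close>

lemma continuous_exp_banach_algebra:
  "continuous_on UNIV (exp :: 'a::{real_normed_algebra_1,banach} \<Rightarrow> 'a)"
proof -
  have "continuous_on (ball 0 r) (exp :: 'a \<Rightarrow> 'a)" for r :: real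
  proof (rule uniform_limit_theorem[OF _ _ trivial_limit_sequentially])
    have "continuous_on (ball 0 r) (\<lambda>a :: 'a. \<Sum>n<k. a ^ n /\<^sub>R fact n)" for k
      by (rule continuous_on_sum)
        (rule continuous_on_scaleR[OF continuous_on_const continuous_on_power[OF continuous_on_id]])
    then show "\<forall>\<^sub>F k in sequentially. continuous_on (ball 0 r) (\<lambda>a :: 'a. \<Sum>n<k. a ^ n /\<^sub>R fact n)"
      by simp
    show "uniform_limit (ball 0 r) (\<lambda>k (a :: 'a). \<Sum>n<k. a ^ n /\<^sub>R fact n) exp sequentially"
      unfolding exp_def
    proof (rule Weierstrass_m_test)
      show "summable (\<lambda>n. norm (r ^ n /\<^sub>R fact n))" by (rule summable_norm_exp)
      show "norm (a ^ n /\<^sub>R fact n) \<le> norm (r ^ n /\<^sub>R fact n)" if "a \<in> ball 0 r" for a :: 'a and n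
      proof -
        have "norm (a ^ n) \<le> norm a ^ n" by (rule norm_power_ineq)
        also have "\<dots> \<le> \<bar>r\<bar> ^ n" using that by (intro power_mono) auto
        finally show ?thesis
          using mult_left_mono[of "norm (a ^ n)" "\<bar>r\<bar> ^ n" "inverse (fact n)"]
          by (simp add: abs_mult power_abs)
      qed
    qed
  qed
  then have "isCont (exp :: 'a \<Rightarrow> 'a) a" for a
    by (rule continuous_on_interior[where S = "ball 0 (norm a + 1)"]) (simp add: interior_open)
  then show ?thesis by (simp add: continuous_on_eq_continuous_at)
qed

context lie_alg
begin

lemma ad_apply [simp]: "blinfun_apply (ad br x) y = br x y"
  unfolding ad_def by (simp add: bounded_linear_Blinfun_apply br.bounded_linear_right)

lemma ad_add: "ad br (x + y) = ad br x + ad br y"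
  by (rule blinfun_eqI) (simp add: blinfun.add_left br.add_left)

lemma ad_scaleR: "ad br (r *\<^sub>R x) = r *\<^sub>R ad br x"
  by (rule blinfun_eqI) (simp add: blinfun.scaleR_left br.scaleR_left)

lemma bounded_linear_ad: "bounded_linear (ad br)"
  by (simp add: ad_add ad_scaleR linear_conv_bounded_linear[symmetric] linearI)

lemma bounded_linear_Endo_ad: "bounded_linear (\<lambda>x. Endo (ad br x))"
  by (rule bounded_linear_compose[OF bounded_linear_Endo bounded_linear_ad])

lemma Exp_eq_exp: "Exp br x = blin (exp (Endo (ad br x)))"
proof -
  have "blin (\<Sum>k. Endo (ad br x) ^ k /\<^sub>R fact k) = (\<Sum>k. blin (Endo (ad br x) ^ k /\<^sub>R fact k))"
    by (rule bounded_linear.suminf[OF bounded_linear_blin summable_exp_generic])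
  then show ?thesis
    unfolding Exp_def exp_def by (simp only: scaleR_endo.rep_eq blin_power Endo_inverse[OF UNIV_I])
qed

lemma Exp_0 [simp]: "Exp br 0 = id_blinfun"
proof -
  have "Endo (ad br 0) = 0"
    by (rule linear_0) (rule bounded_linear.linear[OF bounded_linear_Endo_ad])
  then show ?thesis by (simp add: Exp_eq_exp one_endo.rep_eq)
qed

lemma continuous_on_Exp: "continuous_on UNIV (Exp br)"
proof -
  have "continuous_on UNIV (\<lambda>x. exp (Endo (ad br x)))"
    by (rule continuous_on_compose2[OF continuous_exp_banach_algebra
          linear_continuous_on[OF bounded_linear_Endo_ad] subset_UNIV])
  from bounded_linear.continuous_on[OF bounded_linear_blin this]
  show ?thesis by (simp only: Exp_eq_exp[abs_def])
qed

lemma has_derivative_Exp_0: "(Exp br has_derivative ad br) (at 0)"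
proof -
  have "((\<lambda>x. Endo (ad br x)) has_derivative (\<lambda>x. Endo (ad br x))) (at 0)"
    by (rule bounded_linear_imp_has_derivative[OF bounded_linear_Endo_ad])
  moreover have "Endo (ad br 0) = 0"
    by (rule linear_0) (rule bounded_linear.linear[OF bounded_linear_Endo_ad])
  ultimately have "((\<lambda>x. exp (Endo (ad br x))) has_derivative (\<lambda>x. Endo (ad br x))) (at 0)"
    using has_derivative_compose[of "\<lambda>x. Endo (ad br x)" _ 0 UNIV exp "\<lambda>h. h"] has_derivative_exp_at_0
    by simp
  from bounded_linear.has_derivative[OF bounded_linear_blin this]
  have "((\<lambda>x. blin (exp (Endo (ad br x)))) has_derivative (\<lambda>x. ad br x)) (at 0)"
    by (simp add: Endo_inverse)
  then show ?thesis
    by (simp only: Exp_eq_exp[abs_def])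
qed

lemma Exp_scaleR_has_vector_derivative:
  "((\<lambda>t. Exp br (t *\<^sub>R x)) has_vector_derivative (ad br x o\<^sub>L Exp br (t *\<^sub>R x))) (at t)"
proof -
  have "((\<lambda>t. blin (exp (t *\<^sub>R Endo (ad br x)))) has_vector_derivative
      blin (Endo (ad br x) * exp (t *\<^sub>R Endo (ad br x)))) (at t)"
    by (rule bounded_linear.has_vector_derivative[OF bounded_linear_blin
          exp_scaleR_has_vector_derivative_left])
  moreover have "t *\<^sub>R Endo (ad br x) = Endo (ad br (t *\<^sub>R x))" for t
    by (rule linear_scale[OF bounded_linear.linear[OF bounded_linear_Endo_ad], symmetric])
  ultimately show ?thesis
    by (simp add: Exp_eq_exp times_endo.rep_eq Endo_inverse)
qed

lemma Exp_sums: "(\<lambda>k. (br x ^^ k) y /\<^sub>R fact k) sums Exp br x y"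
proof -
  have "(\<lambda>k. Endo (ad br x) ^ k /\<^sub>R fact k) sums exp (Endo (ad br x))"
    by (rule exp_converges)
  then have "(\<lambda>k. blinfun_apply (blin (Endo (ad br x) ^ k /\<^sub>R fact k)) y)
      sums blinfun_apply (blin (exp (Endo (ad br x)))) y"
    by (intro bounded_linear.sums[OF bounded_linear_blin]
        bounded_linear.sums[OF blinfun.bounded_linear_left])
  moreover have "blinfun_apply (blin (Endo (ad br x) ^ k)) y = (br x ^^ k) y" for k
    by (induction k)
      (simp_all add: one_endo.rep_eq times_endo.rep_eq Endo_inverse[OF UNIV_I])
  ultimately show ?thesis
    by (simp add: Exp_eq_exp scaleR_endo.rep_eq blinfun.scaleR_left)
qed

lemma Exp_inverse: "Exp br x o\<^sub>L Exp br (- x) = id_blinfun" "Exp br (- x) o\<^sub>L Exp br x = id_blinfun"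
proof -
  have "Exp br x o\<^sub>L Exp br (- x) = id_blinfun" for x
  proof -
    have "Endo (ad br (- x)) = - Endo (ad br x)"
      by (rule linear_neg) (rule bounded_linear.linear[OF bounded_linear_Endo_ad])
    then show ?thesis
      using exp_minus_inverse[of "Endo (ad br x)"]
      by (simp add: Exp_eq_exp times_endo.rep_eq[symmetric] one_endo.rep_eq[symmetric])
  qed
  from this[of x] this[of "- x"]
  show "Exp br x o\<^sub>L Exp br (- x) = id_blinfun" "Exp br (- x) o\<^sub>L Exp br x = id_blinfun"
    by simp_all
qed

lemma Exp_inverse_apply [simp]:
  "Exp br x (Exp br (- x) y) = y" "Exp br (- x) (Exp br x y) = y"
  using Exp_inverse[of x] by (metis blinfun_apply_blinfun_compose blinfun_apply_id_blinfun id_apply)+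

text \<open>The derivative of \<open>t \<mapsto> exp(- t x) [exp(t x) y, exp(t x) z]\<close> vanishes.\<close>

lemma Exp_br: "Exp br x (br y z) = br (Exp br x y) (Exp br x z)"
proof -
  define \<phi> where
    "\<phi> t = Exp br (t *\<^sub>R (- x)) (br (Exp br (t *\<^sub>R x) y) (Exp br (t *\<^sub>R x) z))" for t
  have ev: "((\<lambda>t. Exp br (t *\<^sub>R x) v) has_vector_derivative br x (Exp br (t *\<^sub>R x) v)) (at t)" for x v t
    using bounded_linear.has_vector_derivative[OF blinfun.bounded_linear_left[of v]
        Exp_scaleR_has_vector_derivative[of x t]] by simp
  have "(\<phi> has_vector_derivative 0) (at t)" for t
  proof -
    let ?b = "\<lambda>t. br (Exp br (t *\<^sub>R x) y) (Exp br (t *\<^sub>R x) z)"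
    have b: "(?b has_vector_derivative br x (?b t)) (at t)"
      using br.has_vector_derivative[OF ev[of x y t] ev[of x z t]]
      by (simp add: jacobi[of x "Exp br (t *\<^sub>R x) y"] add.commute)
    have "(\<phi> has_vector_derivative Exp br (t *\<^sub>R (- x)) (br x (?b t)) +
        (ad br (- x) o\<^sub>L Exp br (t *\<^sub>R (- x))) (?b t)) (at t)"
      unfolding \<phi>_def
      by (rule blinfun.has_vector_derivative[OF Exp_scaleR_has_vector_derivative b])
    \<comment> \<open>ad x commutes with the powers of ad (- t x), so the two series agree term by
      term; this cancels the two summands of the product rule.\<close>
    moreover have "br (- x) (Exp br (t *\<^sub>R (- x)) u) = - Exp br (t *\<^sub>R (- x)) (br x u)" for u
    proof -
      have "(\<lambda>k. br (- x) ((br (t *\<^sub>R (- x)) ^^ k) u /\<^sub>R fact k))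
          sums br (- x) (Exp br (t *\<^sub>R (- x)) u)"
        by (rule bounded_linear.sums[OF br.bounded_linear_right Exp_sums])
      moreover have "(\<lambda>k. - ((br (t *\<^sub>R (- x)) ^^ k) (br x u) /\<^sub>R fact k))
          sums - Exp br (t *\<^sub>R (- x)) (br x u)"
        by (rule sums_minus[OF Exp_sums])
      moreover have "br (- x) ((br (t *\<^sub>R (- x)) ^^ k) u) = - (br (t *\<^sub>R (- x)) ^^ k) (br x u)" for k
        by (induction k arbitrary: u)
          (simp_all add: br.minus_left br.minus_right br.scaleR_left br.scaleR_right)
      ultimately show ?thesis
        by (simp add: br.scaleR_right sums_unique2)
    qed
    ultimately show ?thesis by simp
  qed
  then have "\<phi> 1 = \<phi> 0"
    using has_vector_derivative_zero_constant[of UNIV \<phi>] by (metis UNIV_I convex_UNIV)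
  then have "Exp br (- x) (br (Exp br x y) (Exp br x z)) = br y z"
    by (simp add: \<phi>_def)
  then show ?thesis by (metis Exp_inverse_apply(1))
qed

end

text \<open>Finite-dimensional subspaces are closed. Every statement on the degrees of an
  exponential is proved for the powers of \<open>br x\<close> and carried over by this
  lemma.\<close>

lemma sums_in_subspace:
  fixes f :: "nat \<Rightarrow> 'a::euclidean_space"
  assumes "subspace S" "\<And>k. f k \<in> S" "f sums l"
  shows "l \<in> S"
proof (rule closed_sequentially[OF closed_subspace[OF assms(1)]])
  show "(\<lambda>n. \<Sum>k<n. f k) \<longlonglongrightarrow> l" using assms(3) by (simp add: sums_def)
  show "(\<Sum>k<n. f k) \<in> S" for n by (intro subspace_sum assms)
qed

context lie_alg
begin

section \<open>Automorphisms\<close>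

definition aut :: "('g \<Rightarrow>\<^sub>L 'g) \<Rightarrow> bool" where
  "aut g \<longleftrightarrow> (\<exists>h. g o\<^sub>L h = id_blinfun \<and> h o\<^sub>L g = id_blinfun) \<and> (\<forall>x y. g (br x y) = br (g x) (g y))"

lemma aut_br: "aut g \<Longrightarrow> g (br x y) = br (g x) (g y)"
  by (simp add: aut_def)

lemma aut_inverse:
  assumes "aut g"
  obtains h where "aut h" "\<And>x. g (h x) = x" "\<And>x. h (g x) = x"
proof -
  obtain h where h: "g o\<^sub>L h = id_blinfun" "h o\<^sub>L g = id_blinfun"
    using assms aut_def by blast
  have gh: "g (h x) = x" "h (g x) = x" for x
    using arg_cong[OF h(1), of "\<lambda>f. blinfun_apply f x"] arg_cong[OF h(2), of "\<lambda>f. blinfun_apply f x"]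
    by simp_all
  have "h (br x y) = br (h x) (h y)" for x y
    using gh(2)[of "br (h x) (h y)"] by (simp only: aut_br[OF assms] gh(1))
  then have "aut h" using h by (auto simp: aut_def)
  then show ?thesis using gh that by blast
qed

lemma aut_id [simp]: "aut id_blinfun"
proof -
  have "id_blinfun o\<^sub>L id_blinfun = (id_blinfun :: 'g \<Rightarrow>\<^sub>L 'g)"
    by (rule blinfun_eqI) simp
  then show ?thesis unfolding aut_def by (intro conjI exI[of _ id_blinfun]) simp_all
qed

lemma aut_compose: "aut g \<Longrightarrow> aut h \<Longrightarrow> aut (g o\<^sub>L h)"
proof -
  assume g: "aut g" and h: "aut h"
  obtain g' where "aut g'" "\<And>x. g (g' x) = x" "\<And>x. g' (g x) = x"
    using aut_inverse[OF g] by blast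
  moreover obtain h' where "aut h'" "\<And>x. h (h' x) = x" "\<And>x. h' (h x) = x"
    using aut_inverse[OF h] by blast
  ultimately show ?thesis
    unfolding aut_def
    by (intro conjI exI[of _ "h' o\<^sub>L g'"]) (auto intro!: blinfun_eqI simp: aut_br[OF g] aut_br[OF h])
qed

lemma aut_Exp [simp]: "aut (Exp br x)"
  unfolding aut_def using Exp_inverse Exp_br by blast

lemma kill_aut_apply: "aut g \<Longrightarrow> kill (g x) (g y) = kill x y"
proof -
  assume g: "aut g"
  obtain h where "aut h" "\<And>x. g (h x) = x" "\<And>x. h (g x) = x"
    using aut_inverse[OF g] by blast
  then show ?thesis
    by (intro kill_aut[of g h]) (auto simp: aut_br[OF g] bounded_linear.linear[OF blinfun.bounded_linear_right])
qed

text \<open>Lets an exponential be moved past an automorphism, as in exp(t U) n = n exp(t V) with n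
  V = U.\<close>

lemma aut_Exp_conj: "aut g \<Longrightarrow> g (Exp br x y) = Exp br (g x) (g y)"
proof -
  assume g: "aut g"
  have "g ((br x ^^ k) y) = (br (g x) ^^ k) (g y)" for k
    by (induction k) (simp_all add: aut_br[OF g])
  moreover have "(\<lambda>k. g ((br x ^^ k) y /\<^sub>R fact k)) sums g (Exp br x y)"
    by (rule bounded_linear.sums[OF blinfun.bounded_linear_right Exp_sums])
  ultimately have "(\<lambda>k. (br (g x) ^^ k) (g y) /\<^sub>R fact k) sums g (Exp br x y)"
    by (simp add: blinfun.scaleR_right)
  then show ?thesis by (rule sums_unique2[OF _ Exp_sums])
qed

lemma Int_group_aut: "g \<in> Int_group br \<Longrightarrow> aut g"
  by (induction rule: Int_group.induct) (simp_all add: aut_compose)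

lemma Exp_eigenvector:
  assumes "br x y = c *\<^sub>R y"
  shows "Exp br x y = exp c *\<^sub>R y"
proof -
  have "(br x ^^ k) y = c ^ k *\<^sub>R y" for k
    by (induction k) (simp_all add: br.scaleR_right assms)
  then have "(\<lambda>k. (c ^ k /\<^sub>R fact k) *\<^sub>R y) sums Exp br x y"
    using Exp_sums[of x y] by (simp add: mult.commute)
  moreover have "(\<lambda>k. (c ^ k /\<^sub>R fact k) *\<^sub>R y) sums (exp c *\<^sub>R y)"
    by (rule bounded_linear.sums[OF bounded_linear_scaleR_left exp_converges])
  ultimately show ?thesis by (rule sums_unique2)
qed

end

section \<open>Commuting symmetric operators\<close>

text \<open>A maximum v of the Rayleigh quotient on \<open>W\<close> is an eigenvector: with \<mu>
  the maximal value, the form \<open>P\<close> is positive semidefinite on \<open>W\<close> and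
  vanishes at v, so v lies in its radical. The Euclidean sphere only supplies compactness, as the
  quotient is invariant under scaling.\<close>

lemma symmetric_eigenvector:
  fixes q :: "'a::euclidean_space \<Rightarrow> 'a \<Rightarrow> real" and A :: "'a \<Rightarrow> 'a"
  assumes bil: "bilinear q" and sym: "\<And>x y. q x y = q y x" and pos: "\<And>x. x \<noteq> 0 \<Longrightarrow> q x x > 0"
    and A: "linear A" "\<And>x y. q (A x) y = q x (A y)"
    and W: "subspace W" "W \<noteq> {0}" "\<And>x. x \<in> W \<Longrightarrow> A x \<in> W"
  shows "\<exists>v\<in>W. v \<noteq> 0 \<and> (\<exists>c. A v = c *\<^sub>R v)"
proof -
  interpret q: bounded_bilinear q
    using bil by (simp add: bilinear_conv_bounded_bilinear)
  let ?S = "W \<inter> sphere 0 1"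
  obtain w where w: "w \<in> W" "w \<noteq> 0"
    using W(1,2) subspace_0 by blast
  have scaled: "x /\<^sub>R norm x \<in> ?S" if "x \<in> W" "x \<noteq> 0" for x
    using that subspace_scale[OF W(1)] by simp
  have "compact ?S" "?S \<noteq> {}"
    using scaled[OF w] closed_subspace[OF W(1)] by (auto intro: closed_Int_compact)
  moreover have "continuous_on ?S (\<lambda>x. q (A x) x / q x x)"
  proof (intro continuous_on_divide q.continuous_on continuous_on_id)
    show "continuous_on ?S A"
      using A(1) by (simp add: linear_continuous_on linear_conv_bounded_linear)
    have "q x x \<noteq> 0" if "x \<in> ?S" for x
      using that pos[of x] by (cases "x = 0") auto
    then show "\<forall>x\<in>?S. q x x \<noteq> 0" by blast
  qed
  ultimately obtain v where v: "v \<in> ?S"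
    and max: "\<And>x. x \<in> ?S \<Longrightarrow> q (A x) x / q x x \<le> q (A v) v / q v v"
    using continuous_attains_sup[of ?S "\<lambda>x. q (A x) x / q x x"] by blast
  define \<mu> where "\<mu> = q (A v) v / q v v"
  have v': "v \<in> W" "v \<noteq> 0" using v by auto
  define P where "P x y = \<mu> * q x y - q (A x) y" for x y
  have P_nonneg: "P x x \<ge> 0" if "x \<in> W" for x
  proof (cases "x = 0")
    case False
    let ?y = "x /\<^sub>R norm x"
    have "q (A ?y) ?y / q ?y ?y \<le> \<mu>"
      unfolding \<mu>_def using that False by (intro max scaled)
    moreover have "q (A ?y) ?y / q ?y ?y = q (A x) x / q x x"
      using False by (simp add: linear_scale[OF A(1)] q.scaleR_left q.scaleR_right)
    ultimately show ?thesis
      using pos[OF False] by (simp add: P_def divide_le_eq)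
  qed (simp add: P_def q.zero_right)
  have Pvv: "P v v = 0"
    using pos[OF v'(2)] by (simp add: P_def \<mu>_def)
  have "P v y = 0" if "y \<in> W" for y
  proof -
    have quad: "0 \<le> 2 * t * P v y + t\<^sup>2 * P y y" for t
    proof -
      have "0 \<le> P (v + t *\<^sub>R y) (v + t *\<^sub>R y)"
        using v' that by (intro P_nonneg subspace_add subspace_scale W)
      also have "\<dots> = P v v + 2 * t * P v y + t\<^sup>2 * P y y"
        using sym[of y v] sym[of "A v" y] A(2)[of y v]
        by (simp add: P_def linear_add[OF A(1)] linear_scale[OF A(1)] q.add_left q.add_right
            q.scaleR_left q.scaleR_right algebra_simps power2_eq_square)
      finally show ?thesis using Pvv by simp
    qed
    have Py: "P y y \<ge> 0" by (rule P_nonneg[OF that])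
    show ?thesis
    proof (cases "P y y = 0")
      case True
      then show ?thesis using quad[of 1] quad[of "- 1"] by simp
    next
      case False
      \<comment> \<open>The chosen t is the minimizer of the quadratic polynomial in
        \<open>quad\<close>.\<close>
      have "2 * (- P v y / P y y) * P v y + (- P v y / P y y)\<^sup>2 * P y y = - (P v y)\<^sup>2 / P y y"
        using False by (simp add: field_simps power2_eq_square)
      then have "(P v y)\<^sup>2 / P y y \<le> 0"
        using quad[of "- P v y / P y y"] by simp
      then show ?thesis using False Py by (simp add: divide_le_0_iff)
    qed
  qed
  moreover have "P v y = q (\<mu> *\<^sub>R v - A v) y" for y
    by (simp add: P_def q.diff_left q.scaleR_left)
  moreover have "\<mu> *\<^sub>R v - A v \<in> W"
    using v' by (intro subspace_diff subspace_scale W)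
  ultimately have "q (\<mu> *\<^sub>R v - A v) (\<mu> *\<^sub>R v - A v) = 0"
    by metis
  then have "A v = \<mu> *\<^sub>R v"
    using pos[of "\<mu> *\<^sub>R v - A v"] by force
  with v' show ?thesis by blast
qed

text \<open>Induction on the dimension: if some operator is not scalar on \<open>W\<close>, one of
  its eigenspaces in \<open>W\<close> is nonzero and proper, and it is stable under all the others
  because they commute with it.\<close>

lemma commuting_symmetric_eigenvector:
  fixes q :: "'a::euclidean_space \<Rightarrow> 'a \<Rightarrow> real" and \<A> :: "('a \<Rightarrow> 'a) set"
  assumes bil: "bilinear q" and sym: "\<And>x y. q x y = q y x" and pos: "\<And>x. x \<noteq> 0 \<Longrightarrow> q x x > 0"
    and A: "\<And>A. A \<in> \<A> \<Longrightarrow> linear A" "\<And>A x y. A \<in> \<A> \<Longrightarrow> q (A x) y = q x (A y)"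
    and comm: "\<And>A B x. A \<in> \<A> \<Longrightarrow> B \<in> \<A> \<Longrightarrow> A (B x) = B (A x)"
    and W: "subspace W" "W \<noteq> {0}" "\<And>A x. A \<in> \<A> \<Longrightarrow> x \<in> W \<Longrightarrow> A x \<in> W"
  shows "\<exists>v\<in>W. v \<noteq> 0 \<and> (\<forall>A\<in>\<A>. \<exists>c. A v = c *\<^sub>R v)"
  using W
proof (induction "dim W" arbitrary: W rule: less_induct)
  case less
  show ?case
  proof (cases "\<forall>A\<in>\<A>. \<exists>c. \<forall>x\<in>W. A x = c *\<^sub>R x")
    case True
    moreover obtain w where "w \<in> W" "w \<noteq> 0"
      using less.prems subspace_0 by blast
    ultimately show ?thesis by blast
  next
    case False
    then obtain A where A1: "A \<in> \<A>" and nonscalar: "\<And>c. \<exists>x\<in>W. A x \<noteq> c *\<^sub>R x"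
      by blast
    have "\<exists>v\<in>W. v \<noteq> 0 \<and> (\<exists>c. A v = c *\<^sub>R v)"
      by (rule symmetric_eigenvector[of q, OF bil sym pos A(1)[OF A1] _ less.prems(1,2)])
        (simp_all add: A(2)[OF A1] less.prems(3)[OF A1])
    then obtain v c where v: "v \<in> W" "v \<noteq> 0" "A v = c *\<^sub>R v" by blast
    let ?V = "{x \<in> W. A x = c *\<^sub>R x}"
    have V: "subspace ?V"
      using less.prems(1) linear_0[OF A(1)[OF A1]] linear_add[OF A(1)[OF A1]] linear_scale[OF A(1)[OF A1]]
      by (auto simp: subspace_def scaleR_add_right)
    obtain x where "x \<in> W" "A x \<noteq> c *\<^sub>R x" using nonscalar by blast
    then have "?V \<subset> W" by blast
    then have "dim ?V < dim W"
      by (metis V dim_psubset less.prems(1) span_eq_iff)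
    moreover have "?V \<noteq> {0}" using v by blast
    moreover have "B x \<in> ?V" if "B \<in> \<A>" "x \<in> ?V" for B x
      using that less.prems(3)[OF that(1)] comm[OF A1 that(1), of x] linear_scale[OF A(1)[OF that(1)]] by auto
    ultimately have "\<exists>v\<in>?V. v \<noteq> 0 \<and> (\<forall>A\<in>\<A>. \<exists>c. A v = c *\<^sub>R v)"
      by (intro less.hyps[OF _ V]) auto
    then show ?thesis by blast
  qed
qed


section \<open>The root space decomposition\<close>

locale split_pair = lie_alg br for br :: "'g::euclidean_space \<Rightarrow> 'g \<Rightarrow> 'g" +
  fixes \<theta> :: "'g \<Rightarrow> 'g" and \<aa> :: "'g set"
  assumes cartan_involution: "cartan_involution br \<theta>"
    and cartan_subspace: "cartan_subspace br \<theta> \<aa>"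
    and split_cartan: "split_cartan br \<theta> \<aa>"
begin

lemma theta_linear: "linear \<theta>" and theta_br: "\<theta> (br x y) = br (\<theta> x) (\<theta> y)"
  and theta_theta [simp]: "\<theta> (\<theta> x) = x"
  and kill_theta_pos: "x \<noteq> 0 \<Longrightarrow> - kill x (\<theta> x) > 0"
  using cartan_involution by (simp_all add: cartan_involution_def)

lemma subspace_a: "subspace \<aa>" and a_abelian: "x \<in> \<aa> \<Longrightarrow> y \<in> \<aa> \<Longrightarrow> br x y = 0"
  and theta_a: "x \<in> \<aa> \<Longrightarrow> \<theta> x = - x"
  using cartan_subspace by (auto simp: cartan_subspace_def abelian_on_def p_part_def)

sublocale killing_nondegenerate br
proof
  show "x = 0" if "\<And>y. kill x y = 0" for x
    using kill_theta_pos[of x] that[of "\<theta> x"] by force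
qed

lemma kill_theta: "kill (\<theta> x) (\<theta> y) = kill x y"
  by (rule kill_aut[OF theta_linear theta_linear]) (simp_all add: theta_br)

lemma kill_a_pos: "x \<in> \<aa> \<Longrightarrow> x \<noteq> 0 \<Longrightarrow> kill x x > 0"
  using kill_theta_pos[of x] theta_a[of x] by (simp add: kill.minus_right)

lemma theta_br_a: "H \<in> \<aa> \<Longrightarrow> \<theta> (br H x) = - br H (\<theta> x)"
  by (simp add: theta_br theta_a br.minus_left)

text \<open>
  Twice the \<open>\<kk>\<close>-part of an element centralizing \<open>\<aa>\<close> vanishes since the
  decomposition is split; then maximality of \<open>\<aa>\<close> applies.
\<close>

lemma centralizer_a:
  assumes "\<And>H. H \<in> \<aa> \<Longrightarrow> br H x = 0"
  shows "x \<in> \<aa>"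
proof -
  have "br H (\<theta> x) = 0" if "H \<in> \<aa>" for H
    using theta_br_a[OF that, of x] assms[OF that] linear_0[OF theta_linear] by simp
  then have "x + \<theta> x \<in> {x \<in> k_part \<theta>. \<forall>H\<in>\<aa>. br H x = 0}"
    using assms by (auto simp: k_part_def linear_add[OF theta_linear] br.add_right)
  then have "x + \<theta> x = 0"
    using split_cartan unfolding split_cartan_def by blast
  then have \<theta>x: "\<theta> x = - x" by (simp only: add_eq_0_iff)
  let ?U = "span (insert x \<aa>)"
  have U: "\<exists>k h. y = k *\<^sub>R x + h \<and> h \<in> \<aa>" if "y \<in> ?U" for y
  proof -
    have "y \<in> {y. \<exists>k. y - k *\<^sub>R x \<in> span \<aa>}" using that by (simp only: span_insert)
    then obtain k where "y - k *\<^sub>R x \<in> span \<aa>" by blast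
    moreover have "span \<aa> = \<aa>" by (simp add: subspace_a)
    ultimately show ?thesis
      by (intro exI[of _ k] exI[of _ "y - k *\<^sub>R x"]) simp
  qed
  have p: "?U \<subseteq> p_part \<theta>"
  proof
    fix y assume "y \<in> ?U"
    then obtain k h where "y = k *\<^sub>R x + h" "h \<in> \<aa>" using U by blast
    then show "y \<in> p_part \<theta>"
      by (simp add: p_part_def linear_add[OF theta_linear] linear_scale[OF theta_linear] \<theta>x theta_a)
  qed
  have ab: "abelian_on br ?U"
    unfolding abelian_on_def
  proof (intro ballI)
    fix y z assume "y \<in> ?U" "z \<in> ?U"
    then obtain k h l h' where yz: "y = k *\<^sub>R x + h" "z = l *\<^sub>R x + h'" and h: "h \<in> \<aa>" "h' \<in> \<aa>"
      using U by meson
    have "br h x = 0" "br x h' = 0" "br h h' = 0"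
      using assms[OF h(1)] assms[OF h(2)] br_skew[of x h'] a_abelian[OF h] by simp_all
    then show "br y z = 0"
      by (simp add: yz br.add_left br.add_right br.scaleR_left br.scaleR_right)
  qed
  have "\<aa> \<subseteq> ?U" using span_superset[of "insert x \<aa>"] by blast
  with p ab have "?U = \<aa>"
    using cartan_subspace subspace_span unfolding cartan_subspace_def by blast
  moreover have "x \<in> ?U" by (simp add: span_base)
  ultimately show ?thesis by simp
qed

text \<open>If the joint eigenvectors do not span, their Killing complement \<open>W\<close> is
  nonzero, and it is stable under ad of the Cartan subspace by invariance. These operators commute
  and are symmetric for -B(x, \<theta> y), so \<open>W\<close> contains a joint eigenvector v. Since
  \<theta> v is again a joint eigenvector, B(v, \<theta> v) = 0, against positivity.\<close>

lemma span_joint_eigenvectors: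
  "span {v. \<forall>H\<in>\<aa>. \<exists>c. br H v = c *\<^sub>R v} = UNIV" (is "span ?E = UNIV")
proof (rule ccontr)
  assume "span ?E \<noteq> UNIV"
  then have "dim ?E < DIM('g)"
    using dim_eq_full[of ?E] dim_subset_UNIV[of ?E] by linarith
  then obtain z where z: "z \<noteq> 0" "\<And>y. y \<in> span ?E \<Longrightarrow> orthogonal z y"
    using orthogonal_to_subspace_exists by blast
  have lin: "linear (\<lambda>y. z \<bullet> y)"
    by (simp add: bounded_linear.linear bounded_linear_inner_right)
  obtain d where d: "\<And>y. kill d y = z \<bullet> y"
    using kill_representation[OF lin] by blast
  define W where "W = {x. \<forall>y\<in>?E. kill x y = 0}"
  have "subspace W"
    by (auto simp: subspace_def W_def kill.zero_left kill.add_left kill.scaleR_left)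
  moreover have "d \<in> W" using z(2) by (auto simp: W_def d orthogonal_def span_base)
  moreover have "d \<noteq> 0"
  proof
    assume "d = 0"
    then have "z \<bullet> z = 0" using d[of z] by (simp add: kill.zero_left)
    with z(1) show False by simp
  qed
  moreover have "br H x \<in> W" if "H \<in> \<aa>" "x \<in> W" for H x
  proof -
    have "kill (br H x) y = 0" if y: "y \<in> ?E" for y
    proof -
      obtain c where "br H y = c *\<^sub>R y" using y \<open>H \<in> \<aa>\<close> by blast
      then show ?thesis
        using kill_br_right[of x H y] \<open>x \<in> W\<close> y by (simp add: W_def kill.scaleR_right)
    qed
    then show ?thesis by (simp add: W_def)
  qed
  ultimately have W: "subspace W" "W \<noteq> {0}" "\<And>H x. H \<in> \<aa> \<Longrightarrow> x \<in> W \<Longrightarrow> br H x \<in> W"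
    by blast+
  define q where "q x y = - kill x (\<theta> y)" for x y
  have "\<exists>v\<in>W. v \<noteq> 0 \<and> (\<forall>A\<in>br ` \<aa>. \<exists>c. A v = c *\<^sub>R v)"
  proof (rule commuting_symmetric_eigenvector[where q = q])
    show "bilinear q"
      unfolding bilinear_def q_def
      by (intro conjI allI linearI)
        (simp_all add: kill.add_left kill.add_right kill.scaleR_left kill.scaleR_right
          linear_add[OF theta_linear] linear_scale[OF theta_linear])
    show "q x y = q y x" for x y
      using kill_theta[of x "\<theta> y"] kill_commute[of "\<theta> x" y] by (simp add: q_def)
    show "q (A x) y = q x (A y)" if A: "A \<in> br ` \<aa>" for A x y
    proof -
      obtain H where "H \<in> \<aa>" "A = br H" using A by blast
      then show ?thesis
        using kill_br_right[of x H "\<theta> y"] by (simp add: q_def theta_br_a kill.minus_right)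
    qed
    show "A (B x) = B (A x)" if AB: "A \<in> br ` \<aa>" "B \<in> br ` \<aa>" for A B x
    proof -
      obtain H H' where "H \<in> \<aa>" "H' \<in> \<aa>" "A = br H" "B = br H'" using AB by blast
      then show ?thesis using jacobi[of H H' x] a_abelian[of H H'] by (simp add: br.zero_left)
    qed
    show "q x x > 0" if "x \<noteq> 0" for x using kill_theta_pos[OF that] by (simp add: q_def)
    show "linear A" if "A \<in> br ` \<aa>" for A using that linear_br by auto
    show "A x \<in> W" if "A \<in> br ` \<aa>" "x \<in> W" for A x using that W(3) by auto
  qed (rule W)+
  then obtain v where v: "v \<in> W" "v \<noteq> 0" "\<forall>H\<in>\<aa>. \<exists>c. br H v = c *\<^sub>R v" by blast
  have "\<forall>H\<in>\<aa>. \<exists>c. br H (\<theta> v) = c *\<^sub>R \<theta> v"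
  proof
    fix H assume H: "H \<in> \<aa>"
    then obtain c where "br H v = c *\<^sub>R v" using v by blast
    then have "c *\<^sub>R \<theta> v = - br H (\<theta> v)"
      using theta_br_a[OF H, of v] by (simp add: linear_scale[OF theta_linear])
    then have "br H (\<theta> v) = (- c) *\<^sub>R \<theta> v"
      by (metis add.inverse_inverse scaleR_minus_left)
    then show "\<exists>c. br H (\<theta> v) = c *\<^sub>R \<theta> v" by blast
  qed
  then have "kill v (\<theta> v) = 0" using v(1) by (simp add: W_def)
  then show False using kill_theta_pos[OF v(2)] by simp
qed

end

lemma fun_uminus_uminus [simp]: "- (- f) = (f :: 'a \<Rightarrow> real)"
  by (simp add: fun_eq_iff)

lemma fun_uminus_eq_iff [simp]: "- f = - g \<longleftrightarrow> f = (g :: 'a \<Rightarrow> real)"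
  by (metis fun_uminus_uminus)

context split_pair
begin

lemma root_spaceD: "x \<in> root_space br \<aa> \<alpha> \<Longrightarrow> H \<in> \<aa> \<Longrightarrow> br H x = \<alpha> H *\<^sub>R x"
  by (simp add: root_space_def)

lemma subspace_root_space: "subspace (root_space br \<aa> \<alpha>)"
  by (simp add: subspace_def root_space_def br.zero_right br.add_right br.scaleR_right algebra_simps)

lemma rootD:
  assumes "\<alpha> \<in> roots br \<aa>"
  shows "H \<notin> \<aa> \<Longrightarrow> \<alpha> H = 0" "\<exists>H\<in>\<aa>. \<alpha> H \<noteq> 0" "\<exists>x\<in>root_space br \<aa> \<alpha>. x \<noteq> 0"
proof -
  show "H \<notin> \<aa> \<Longrightarrow> \<alpha> H = 0" "\<exists>H\<in>\<aa>. \<alpha> H \<noteq> 0"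
    using assms unfolding roots_def by blast+
  have "root_space br \<aa> \<alpha> \<noteq> {0}" using assms by (simp add: roots_def)
  then show "\<exists>x\<in>root_space br \<aa> \<alpha>. x \<noteq> 0"
    using subspace_0[OF subspace_root_space[of \<alpha>]] by blast
qed

lemma root_eqI: "\<alpha> \<in> roots br \<aa> \<Longrightarrow> \<beta> \<in> roots br \<aa> \<Longrightarrow> (\<And>H. H \<in> \<aa> \<Longrightarrow> \<alpha> H = \<beta> H) \<Longrightarrow> \<alpha> = \<beta>"
  using rootD(1) by (metis ext)

lemma root_add: "\<alpha> \<in> roots br \<aa> \<Longrightarrow> H \<in> \<aa> \<Longrightarrow> H' \<in> \<aa> \<Longrightarrow> \<alpha> (H + H') = \<alpha> H + \<alpha> H'"
  and root_scale: "\<alpha> \<in> roots br \<aa> \<Longrightarrow> H \<in> \<aa> \<Longrightarrow> \<alpha> (r *\<^sub>R H) = r * \<alpha> H"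
proof -
  assume \<alpha>: "\<alpha> \<in> roots br \<aa>" and H: "H \<in> \<aa>"
  obtain x where x: "x \<in> root_space br \<aa> \<alpha>" "x \<noteq> 0" using rootD(3)[OF \<alpha>] by blast
  have "\<alpha> (r *\<^sub>R H) *\<^sub>R x = br (r *\<^sub>R H) x"
    using root_spaceD[OF x(1) subspace_scale[OF subspace_a H, of r]] by simp
  also have "\<dots> = (r * \<alpha> H) *\<^sub>R x"
    using root_spaceD[OF x(1) H] by (simp add: br.scaleR_left)
  finally show "\<alpha> (r *\<^sub>R H) = r * \<alpha> H" by (rule scaleR_right_imp_eq[OF x(2)])
  show "\<alpha> (H + H') = \<alpha> H + \<alpha> H'" if "H' \<in> \<aa>"
  proof -
    have "\<alpha> (H + H') *\<^sub>R x = br (H + H') x"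
      using root_spaceD[OF x(1) subspace_add[OF subspace_a H that]] by simp
    also have "\<dots> = (\<alpha> H + \<alpha> H') *\<^sub>R x"
      using root_spaceD[OF x(1) H] root_spaceD[OF x(1) that] by (simp add: br.add_left scaleR_add_left)
    finally show ?thesis by (rule scaleR_right_imp_eq[OF x(2)])
  qed
qed

lemma theta_root_space: "x \<in> root_space br \<aa> \<alpha> \<Longrightarrow> \<theta> x \<in> root_space br \<aa> (- \<alpha>)"
  using theta_br_a linear_scale[OF theta_linear]
  by (simp add: root_space_def) (metis add.inverse_inverse)

lemma uminus_root: assumes "\<alpha> \<in> roots br \<aa>" shows "- \<alpha> \<in> roots br \<aa>"
proof -
  obtain x where x: "x \<in> root_space br \<aa> \<alpha>" "x \<noteq> 0" using rootD(3)[OF assms] by blast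
  have "\<theta> x \<noteq> 0" using x(2) theta_theta[of x] linear_0[OF theta_linear] by metis
  then have "root_space br \<aa> (- \<alpha>) \<noteq> {0}" using theta_root_space[OF x(1)] by blast
  then show ?thesis using rootD(1,2)[OF assms] by (simp add: roots_def)
qed

lemma br_root_space:
  "x \<in> root_space br \<aa> \<alpha> \<Longrightarrow> y \<in> root_space br \<aa> \<beta> \<Longrightarrow> br x y \<in> root_space br \<aa> (\<lambda>H. \<alpha> H + \<beta> H)"
proof -
  assume x: "x \<in> root_space br \<aa> \<alpha>" and y: "y \<in> root_space br \<aa> \<beta>"
  have "br H (br x y) = (\<alpha> H + \<beta> H) *\<^sub>R br x y" if "H \<in> \<aa>" for H
    by (simp add: jacobi[of H x y] root_spaceD[OF x that] root_spaceD[OF y that]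
        br.scaleR_left br.scaleR_right scaleR_add_left)
  then show ?thesis by (simp add: root_space_def)
qed

lemma kill_root_space_eq_0:
  assumes x: "x \<in> root_space br \<aa> \<alpha>" and y: "y \<in> root_space br \<aa> \<beta>"
    and H: "H \<in> \<aa>" "\<alpha> H + \<beta> H \<noteq> 0"
  shows "kill x y = 0"
proof -
  have "\<alpha> H * kill x y = kill (br H x) y"
    by (simp add: root_spaceD[OF x H(1)] kill.scaleR_left)
  also have "\<dots> = - (\<beta> H * kill x y)"
    using kill_br_right[of x H y] by (simp add: root_spaceD[OF y H(1)] kill.scaleR_right)
  finally have "(\<alpha> H + \<beta> H) * kill x y = 0" by (simp add: algebra_simps)
  then show ?thesis using H(2) by simp
qed

lemma root_space_0: "root_space br \<aa> (\<lambda>H. 0) = \<aa>"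
  using centralizer_a a_abelian by (auto simp: root_space_def)

lemma span_root_spaces: "span (\<aa> \<union> (\<Union>\<alpha>\<in>roots br \<aa>. root_space br \<aa> \<alpha>)) = UNIV" (is "span ?S = UNIV")
proof -
  have "v \<in> ?S" if v: "\<forall>H\<in>\<aa>. \<exists>c. br H v = c *\<^sub>R v" for v
  proof (cases "\<forall>H\<in>\<aa>. br H v = 0")
    case True
    then show ?thesis using centralizer_a by blast
  next
    case False
    obtain c where c: "br H v = c H *\<^sub>R v" if "H \<in> \<aa>" for H using bchoice[OF v] by blast
    \<comment> \<open>The weight is extended by 0 outside the Cartan subspace, the convention built
      into \<open>roots\<close>.\<close>
    define \<alpha> where "\<alpha> H = (if H \<in> \<aa> then c H else 0)" for H
    have v: "v \<in> root_space br \<aa> \<alpha>" by (simp add: root_space_def \<alpha>_def c)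
    obtain H where H: "H \<in> \<aa>" "br H v \<noteq> 0" using False by blast
    then have "v \<noteq> 0" "\<alpha> H \<noteq> 0" using c[OF H(1)] by (auto simp: \<alpha>_def)
    then have "\<alpha> \<in> roots br \<aa>" using v H(1) by (auto simp: roots_def \<alpha>_def)
    then show ?thesis using v by blast
  qed
  then have "{v. \<forall>H\<in>\<aa>. \<exists>c. br H v = c *\<^sub>R v} \<subseteq> ?S" by blast
  from span_mono[OF this] show ?thesis by (simp add: span_joint_eigenvectors top.extremum_unique)
qed

end

section \<open>Normalized root vectors, the Cartan component and the vectors dual to roots\<close>

locale root_data = split_pair br \<theta> \<aa>
  for br :: "'g::euclidean_space \<Rightarrow> 'g \<Rightarrow> 'g" and \<theta> :: "'g \<Rightarrow> 'g" and \<aa> :: "'g set" +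
  fixes X :: "('g \<Rightarrow> real) \<Rightarrow> 'g"
  assumes root_vectors: "root_vectors br \<aa> X"
begin

abbreviation R where "R \<equiv> roots br \<aa>"

lemma X_root_space: "\<alpha> \<in> R \<Longrightarrow> X \<alpha> \<in> root_space br \<aa> \<alpha>"
  and kill_X_uminus [simp]: "\<alpha> \<in> R \<Longrightarrow> kill (X \<alpha>) (X (- \<alpha>)) = 1"
  using root_vectors by (simp_all add: root_vectors_def)

lemma X_nonzero: "\<alpha> \<in> R \<Longrightarrow> X \<alpha> \<noteq> 0"
  using kill_X_uminus kill.zero_left by (metis zero_neq_one)

lemma br_a_X: "H \<in> \<aa> \<Longrightarrow> \<alpha> \<in> R \<Longrightarrow> br H (X \<alpha>) = \<alpha> H *\<^sub>R X \<alpha>"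
  using X_root_space root_spaceD by blast

lemma root_space_eq: assumes "\<alpha> \<in> R" shows "root_space br \<aa> \<alpha> = span {X \<alpha>}"
proof -
  have "dim (root_space br \<aa> \<alpha>) = 1"
    using split_cartan assms by (simp add: split_cartan_def)
  moreover have "span {X \<alpha>} \<subseteq> root_space br \<aa> \<alpha>"
    using X_root_space[OF assms] subspace_root_space by (simp add: span_minimal)
  moreover have "dim (span {X \<alpha>}) = 1"
    using X_nonzero[OF assms] by (simp add: dim_insert)
  ultimately show ?thesis
    using subspace_dim_equal[OF subspace_span subspace_root_space] by (metis order_refl)
qed

lemma kill_X: assumes "\<alpha> \<in> R" "\<beta> \<in> R" shows "kill (X \<alpha>) (X \<beta>) = (if \<beta> = - \<alpha> then 1 else 0)"
proof (cases "\<beta> = - \<alpha>")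
  case False
  then obtain H where "H \<in> \<aa>" "\<beta> H \<noteq> (- \<alpha>) H"
    using root_eqI[OF assms(2) uminus_root[OF assms(1)]] by blast
  then show ?thesis
    using False kill_root_space_eq_0[OF X_root_space X_root_space, OF assms, of H] by simp
qed (use assms in simp)

lemma kill_a_X: assumes "H \<in> \<aa>" "\<alpha> \<in> R" shows "kill H (X \<alpha>) = 0" "kill (X \<alpha>) H = 0"
proof -
  obtain H' where "H' \<in> \<aa>" "\<alpha> H' \<noteq> 0" using rootD(2)[OF assms(2)] by blast
  then show "kill H (X \<alpha>) = 0"
    using kill_root_space_eq_0[of H "\<lambda>_. 0" "X \<alpha>" \<alpha> H'] assms X_root_space root_space_0 by simp
  then show "kill (X \<alpha>) H = 0" by (simp add: kill_commute)
qed

text \<open>Pairing with X_-\<alpha> isolates the coefficient of X_\<alpha>, so the root vectors are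
  distinct and linearly independent.\<close>

lemma finite_roots: "finite R"
proof -
  have inj: "inj_on X R"
  proof (rule inj_onI)
    fix \<alpha> \<beta> assume ab: "\<alpha> \<in> R" "\<beta> \<in> R" "X \<alpha> = X \<beta>"
    then have "kill (X \<beta>) (X (- \<alpha>)) = 1" using kill_X_uminus[OF ab(1)] by simp
    then show "\<alpha> = \<beta>"
      using kill_X[OF ab(2) uminus_root[OF ab(1)]] by (simp split: if_splits)
  qed
  have "independent (X ` R)"
    unfolding independent_explicit_finite_subsets
  proof (intro allI impI ballI)
    fix S u v
    assume S: "S \<subseteq> X ` R" "finite S" "(\<Sum>v\<in>S. u v *\<^sub>R v) = 0" "v \<in> S"
    then obtain \<alpha> where \<alpha>: "\<alpha> \<in> R" "v = X \<alpha>" by blast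
    have "kill w (X (- \<alpha>)) = (if w = v then 1 else 0)" if w: "w \<in> S" for w
    proof -
      obtain \<beta> where \<beta>: "\<beta> \<in> R" "w = X \<beta>" using S(1) w by blast
      then show ?thesis
        using kill_X[OF \<beta>(1) uminus_root[OF \<alpha>(1)]] \<alpha> inj by (auto simp: inj_on_eq_iff)
    qed
    then have "(\<Sum>w\<in>S. u w * kill w (X (- \<alpha>))) = (\<Sum>w\<in>S. if w = v then u w else 0)"
      by (intro sum.cong) auto
    moreover have "kill (\<Sum>v\<in>S. u v *\<^sub>R v) (X (- \<alpha>)) = 0" by (simp add: S(3) kill.zero_left)
    ultimately show "u v = 0"
      using S(2,4) by (simp add: kill.sum_left kill.scaleR_left)
  qed
  then show ?thesis
    using independent_imp_finite finite_imageD inj by blast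
qed

text \<open>The projection along the root spaces, defined as a remainder: the decomposition then
  holds by construction, and what has to be proved is that the remainder lies in the Cartan
  subspace.\<close>

definition a_part :: "'g \<Rightarrow> 'g" where
  "a_part v = v - (\<Sum>\<alpha>\<in>R. kill v (X (- \<alpha>)) *\<^sub>R X \<alpha>)"

lemma root_decomposition: "v = a_part v + (\<Sum>\<alpha>\<in>R. kill v (X (- \<alpha>)) *\<^sub>R X \<alpha>)"
  by (simp add: a_part_def)

lemma linear_a_part: "linear a_part"
  unfolding a_part_def
  by (rule linearI)
    (simp_all add: kill.add_left kill.scaleR_left scaleR_add_left sum.distrib scaleR_sum_right
      scaleR_diff_right)

lemma a_part_a: "H \<in> \<aa> \<Longrightarrow> a_part H = H"
  by (simp add: a_part_def kill_a_X uminus_root)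

lemma a_part_X: assumes "\<alpha> \<in> R" shows "a_part (X \<alpha>) = 0"
proof -
  have "(\<Sum>\<beta>\<in>R. kill (X \<alpha>) (X (- \<beta>)) *\<^sub>R X \<beta>) = (\<Sum>\<beta>\<in>R. if \<beta> = \<alpha> then X \<beta> else 0)"
    using assms by (intro sum.cong) (auto simp: kill_X uminus_root)
  then show ?thesis using assms finite_roots by (simp add: a_part_def)
qed

lemma a_part_in_a: "a_part v \<in> \<aa>"
proof -
  let ?S = "\<aa> \<union> (\<Union>\<alpha>\<in>R. root_space br \<aa> \<alpha>)"
  have "subspace {v. a_part v \<in> \<aa>}"
    using subspace_a
    by (simp add: subspace_def linear_add[OF linear_a_part] linear_scale[OF linear_a_part]
        linear_0[OF linear_a_part])
  moreover have "?S \<subseteq> {v. a_part v \<in> \<aa>}"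
  proof
    fix v assume "v \<in> ?S"
    then consider "v \<in> \<aa>" | \<alpha> where "\<alpha> \<in> R" "v \<in> span {X \<alpha>}" using root_space_eq by blast
    then show "v \<in> {v. a_part v \<in> \<aa>}"
    proof cases
      case 1
      then show ?thesis by (simp add: a_part_a)
    next
      case (2 \<alpha>)
      then obtain k where "v = k *\<^sub>R X \<alpha>" by (auto simp: span_singleton)
      then show ?thesis
        using a_part_X[OF 2(1)] subspace_0[OF subspace_a] by (simp add: linear_scale[OF linear_a_part])
    qed
  qed
  ultimately have "span ?S \<subseteq> {v. a_part v \<in> \<aa>}" by (simp add: span_minimal)
  then show ?thesis unfolding span_root_spaces by blast
qed

lemma kill_a_part: "H \<in> \<aa> \<Longrightarrow> kill H (a_part v) = kill H v"
  by (simp add: a_part_def kill.diff_right kill.sum_right kill.scaleR_right kill_a_X)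

lemma subspace_eq_UNIV:
  assumes "subspace S" "\<aa> \<subseteq> S" "\<And>\<alpha>. \<alpha> \<in> R \<Longrightarrow> X \<alpha> \<in> S"
  shows "v \<in> S"
proof -
  have "a_part v + (\<Sum>\<alpha>\<in>R. kill v (X (- \<alpha>)) *\<^sub>R X \<alpha>) \<in> S"
    using assms a_part_in_a by (intro subspace_add subspace_sum subspace_scale) auto
  then show ?thesis using root_decomposition[of v] by simp
qed

lemma linear_eq_on_root_data:
  assumes "linear f" "linear h" "\<And>H. H \<in> \<aa> \<Longrightarrow> f H = h H" "\<And>\<alpha>. \<alpha> \<in> R \<Longrightarrow> f (X \<alpha>) = h (X \<alpha>)"
  shows "f v = h v"
proof -
  have "v \<in> {v. f v = h v}"
  proof (rule subspace_eq_UNIV)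
    show "subspace {v. f v = h v}"
      using assms(1,2) by (simp add: subspace_def linear_0 linear_add linear_scale)
  qed (use assms in auto)
  then show ?thesis by simp
qed

text \<open>This is H_\<alpha>: invariance and B(X_\<alpha>, X_-\<alpha>) = 1 give B(H,
  [X_\<alpha>, X_-\<alpha>]) = \<alpha>(H). The bracket is an explicit witness for the definite
  description \<open>coroot_vec\<close>.\<close>

definition Hvec :: "('g \<Rightarrow> real) \<Rightarrow> 'g" where
  "Hvec \<alpha> = br (X \<alpha>) (X (- \<alpha>))"

lemma Hvec_in_a: assumes "\<alpha> \<in> R" shows "Hvec \<alpha> \<in> \<aa>"
proof -
  have "Hvec \<alpha> \<in> root_space br \<aa> (\<lambda>H. \<alpha> H + (- \<alpha>) H)"
    unfolding Hvec_def by (intro br_root_space X_root_space assms uminus_root)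
  then show ?thesis using root_space_0 by simp
qed

lemma kill_Hvec: "\<alpha> \<in> R \<Longrightarrow> H \<in> \<aa> \<Longrightarrow> kill H (Hvec \<alpha>) = \<alpha> H"
  unfolding Hvec_def kill_br_left[symmetric] by (simp add: br_a_X kill.scaleR_left)

lemma coroot_vec_eq: assumes "\<alpha> \<in> R" shows "coroot_vec br \<aa> \<alpha> = Hvec \<alpha>"
  unfolding coroot_vec_def
proof (rule the_equality)
  fix K assume K: "K \<in> \<aa> \<and> (\<forall>H\<in>\<aa>. \<alpha> H = kill H K)"
  then have "kill (K - Hvec \<alpha>) (K - Hvec \<alpha>) = 0" "K - Hvec \<alpha> \<in> \<aa>"
    using kill_Hvec[OF assms] Hvec_in_a[OF assms] subspace_diff[OF subspace_a]
    by (auto simp: kill.diff_right)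
  then show "K = Hvec \<alpha>" using kill_a_pos[of "K - Hvec \<alpha>"] by force
qed (use assms Hvec_in_a kill_Hvec in auto)

lemma root_inner_eq: "\<alpha> \<in> R \<Longrightarrow> \<beta> \<in> R \<Longrightarrow> root_inner br \<aa> \<alpha> \<beta> = \<beta> (Hvec \<alpha>)"
  by (simp add: root_inner_def coroot_vec_eq kill_Hvec Hvec_in_a)

lemma root_Hvec_pos: assumes "\<alpha> \<in> R" shows "\<alpha> (Hvec \<alpha>) > 0"
proof -
  have "Hvec \<alpha> \<noteq> 0"
    using kill_Hvec[OF assms] rootD(2)[OF assms] by (metis kill.zero_right)
  then show ?thesis
    using kill_a_pos[of "Hvec \<alpha>"] Hvec_in_a[OF assms] kill_Hvec[OF assms] by force
qed

text \<open>An element on which all roots vanish commutes with the Cartan subspace and all root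
  vectors, so it is central and therefore 0.\<close>

lemma a_eqI:
  assumes "H \<in> \<aa>" "H' \<in> \<aa>" "\<And>\<alpha>. \<alpha> \<in> R \<Longrightarrow> \<alpha> H = \<alpha> H'"
  shows "H = H'"
proof -
  have "br (H - H') v = 0" for v
    by (rule linear_eq_on_root_data[OF linear_br linear_zero])
      (use assms in \<open>auto simp: br.diff_left a_abelian br_a_X\<close>)
  then show ?thesis using center_trivial[of "H - H'"] by simp
qed

end

section \<open>Gradings by the eigenvalues of an element\<close>

context lie_alg
begin

definition eigsp :: "'g \<Rightarrow> real \<Rightarrow> 'g set" where
  "eigsp K c = {v. br K v = c *\<^sub>R v}"

text \<open>Degrees form an arbitrary set of reals, so that one notion covers the eigenspaces, both
  nilpotent subalgebras, the parabolic part, and the filtration by \<open>{c<..}\<close> used for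
  error terms.\<close>

definition Gr :: "'g \<Rightarrow> real set \<Rightarrow> 'g set" where
  "Gr K D = span (\<Union>d\<in>D. eigsp K d)"

lemma subspace_eigsp: "subspace (eigsp K c)"
  by (simp add: subspace_def eigsp_def br.zero_right br.add_right br.scaleR_right algebra_simps)

lemma subspace_Gr: "subspace (Gr K D)"
  by (simp add: Gr_def)

lemma Gr_mono: "D \<subseteq> D' \<Longrightarrow> v \<in> Gr K D \<Longrightarrow> v \<in> Gr K D'"
  unfolding Gr_def by (meson UN_mono order_refl span_mono subsetD)

lemma eigsp_Gr: "v \<in> eigsp K d \<Longrightarrow> d \<in> D \<Longrightarrow> v \<in> Gr K D"
  unfolding Gr_def by (meson UN_I span_base)

lemma Gr_subsetI: "subspace S \<Longrightarrow> (\<And>d v. d \<in> D \<Longrightarrow> v \<in> eigsp K d \<Longrightarrow> v \<in> S) \<Longrightarrow> v \<in> Gr K D \<Longrightarrow> v \<in> S"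
  unfolding Gr_def using span_minimal[of "\<Union>d\<in>D. eigsp K d" S] by blast

lemma Gr_singleton: "Gr K {c} = eigsp K c"
  by (simp add: Gr_def subspace_eigsp)

lemma self_in_eigsp: "K \<in> eigsp K 0"
  by (simp add: eigsp_def)

lemma br_eigsp: "x \<in> eigsp K c \<Longrightarrow> y \<in> eigsp K d \<Longrightarrow> br x y \<in> eigsp K (c + d)"
  by (simp add: eigsp_def jacobi[of K x y] br.scaleR_left br.scaleR_right scaleR_add_left)

lemma kill_eigsp: assumes "x \<in> eigsp K c" "y \<in> eigsp K d" "c + d \<noteq> 0" shows "kill x y = 0"
proof -
  have "(c + d) * kill x y = 0"
    using assms(1,2) kill_br_right[of x K y]
    by (simp add: eigsp_def kill.scaleR_left kill.scaleR_right algebra_simps)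
  then show ?thesis using assms(3) by simp
qed

lemma br_Gr:
  assumes "x \<in> Gr K D" "y \<in> Gr K D'" "\<And>d d'. d \<in> D \<Longrightarrow> d' \<in> D' \<Longrightarrow> d + d' \<in> D''"
  shows "br x y \<in> Gr K D''"
proof -
  have gen: "br x' y \<in> Gr K D''" if x': "d \<in> D" "x' \<in> eigsp K d" for d x'
  proof -
    have "subspace {y. br x' y \<in> Gr K D''}"
      using subspace_Gr[of K D''] by (simp add: subspace_def br.zero_right br.add_right br.scaleR_right)
    moreover have "y' \<in> {y. br x' y \<in> Gr K D''}" if "d' \<in> D'" "y' \<in> eigsp K d'" for d' y'
      using br_eigsp[OF x'(2) that(2)] assms(3)[OF x'(1) that(1)] by (simp add: eigsp_Gr)
    ultimately have "y \<in> {y. br x' y \<in> Gr K D''}"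
      using assms(2) by (rule Gr_subsetI)
    then show ?thesis by simp
  qed
  have "subspace {x. br x y \<in> Gr K D''}"
    using subspace_Gr[of K D''] by (simp add: subspace_def br.zero_left br.add_left br.scaleR_left)
  then have "x \<in> {x. br x y \<in> Gr K D''}"
    by (rule Gr_subsetI[OF _ _ assms(1)]) (simp add: gen)
  then show ?thesis by simp
qed

lemma Exp_Gr:
  assumes "x \<in> Gr K P" "v \<in> Gr K D" "\<And>p d. p \<in> P \<Longrightarrow> d \<in> D \<Longrightarrow> p + d \<in> D"
  shows "Exp br x v \<in> Gr K D"
proof (rule sums_in_subspace[OF subspace_Gr _ Exp_sums])
  have "(br x ^^ k) v \<in> Gr K D" for k
    using assms by (induction k) (auto intro: br_Gr)
  then show "(br x ^^ k) v /\<^sub>R fact k \<in> Gr K D" for k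
    by (simp add: subspace_scale subspace_Gr)
qed

text \<open>The set \<open>D'\<close> absorbs P + D and P + D', so every term of the exponential
  series except the one with k = 0 lies in \<open>Gr K D'\<close>.\<close>

lemma Exp_minus_id_Gr:
  assumes "x \<in> Gr K P" "v \<in> Gr K D" "\<And>p d. p \<in> P \<Longrightarrow> d \<in> D \<Longrightarrow> p + d \<in> D'"
    "\<And>p d. p \<in> P \<Longrightarrow> d \<in> D' \<Longrightarrow> p + d \<in> D'"
  shows "Exp br x v - v \<in> Gr K D'"
proof (rule sums_in_subspace[OF subspace_Gr])
  have pow: "(br x ^^ Suc k) v \<in> Gr K D'" for k
    using assms by (induction k) (auto intro: br_Gr)
  show "(\<lambda>k. (br x ^^ k) v /\<^sub>R fact k - (if k = 0 then v else 0)) sums (Exp br x v - v)"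
    using sums_diff[OF Exp_sums sums_single[of 0 "\<lambda>_. v"]] by simp
  show "(br x ^^ k) v /\<^sub>R fact k - (if k = 0 then v else 0) \<in> Gr K D'" for k
    using pow[of "k - 1"] subspace_0[OF subspace_Gr]
    by (cases k) (auto intro!: subspace_scale subspace_Gr)
qed

end

text \<open>The assumptions say that ad K is diagonalizable with finite spectrum. The locale is used
  for H0 and for -H0, which treats both nilpotent subalgebras at once.\<close>

locale grading_element = killing_nondegenerate br
  for br :: "'g::euclidean_space \<Rightarrow> 'g \<Rightarrow> 'g" +
  fixes K :: 'g
  assumes Gr_UNIV: "Gr K UNIV = UNIV"
    and finite_eigenvalues: "finite {c. eigsp K c \<noteq> {0}}"
begin

text \<open>The Killing form pairs degree d only with degree -d, and nondegeneracy makes this a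
  characterization. Membership becomes a conjunction of orthogonality conditions, from which
  directness of the sum of eigenspaces can be read off as \<open>Gr_Int\<close>.\<close>

lemma Gr_iff: "v \<in> Gr K D \<longleftrightarrow> (\<forall>d. - d \<notin> D \<longrightarrow> (\<forall>u\<in>eigsp K d. kill v u = 0))" (is "_ \<longleftrightarrow> ?R v D")
proof
  have sub: "subspace {v. ?R v D}" for D
    by (auto simp: subspace_def kill.zero_left kill.add_left kill.scaleR_left)
  have eig: "v \<in> {v. ?R v D}" if v: "d \<in> D" "v \<in> eigsp K d" for d v D
  proof (intro CollectI allI impI ballI)
    fix e u assume e: "- e \<notin> D" "u \<in> eigsp K e"
    have "d + e \<noteq> 0" using v(1) e(1) by (auto simp flip: eq_neg_iff_add_eq_0)
    then show "kill v u = 0" by (rule kill_eigsp[OF v(2) e(2)])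
  qed
  show "?R v D" if "v \<in> Gr K D" for v D
    using Gr_subsetI[OF sub eig that] by simp
  then have ann: "?R v D" if "v \<in> Gr K D" for v D using that by blast
  assume R: "?R v D"
  have "v \<in> span ((\<Union>d\<in>D. eigsp K d) \<union> (\<Union>d\<in>- D. eigsp K d))"
    using Gr_UNIV unfolding UN_Un[symmetric] Compl_partition Gr_def by simp
  then obtain v1 v2 where v: "v = v1 + v2" "v1 \<in> Gr K D" "v2 \<in> Gr K (- D)"
    unfolding span_Un Gr_def by auto
  have "kill v2 u = 0" if u: "u \<in> eigsp K d" for d u
  proof (cases "- d \<in> D")
    case True
    then show ?thesis using ann[OF v(3)] u by simp
  next
    case False
    then have "kill v u = 0" "kill v1 u = 0" using R ann[OF v(2)] u by blast+
    then show ?thesis by (simp add: v(1) kill.add_left)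
  qed
  note v2 = this
  have "subspace {u. kill v2 u = 0}"
    by (auto simp: subspace_def kill.zero_right kill.add_right kill.scaleR_right)
  then have "u \<in> {u. kill v2 u = 0}" for u
    by (rule Gr_subsetI[of _ UNIV K]) (simp_all add: Gr_UNIV v2)
  then have "v2 = 0" by (intro kill_nondegenerate) simp
  then show "v \<in> Gr K D" using v by simp
qed

lemma Gr_Int: "v \<in> Gr K D \<Longrightarrow> v \<in> Gr K D' \<Longrightarrow> v \<in> Gr K (D \<inter> D')"
  unfolding Gr_iff by blast

lemma Gr_disjoint: "v \<in> Gr K D \<Longrightarrow> v \<in> Gr K D' \<Longrightarrow> D \<inter> D' = {} \<Longrightarrow> v = 0"
  using Gr_Int[of v D D'] by (simp add: Gr_def)

lemma Gr_eigenvalues: "v \<in> Gr K D \<Longrightarrow> v \<in> Gr K (D \<inter> {c. eigsp K c \<noteq> {0}})"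
proof (rule Gr_subsetI[OF subspace_Gr])
  fix d v assume d: "d \<in> D" "v \<in> eigsp K d"
  show "v \<in> Gr K (D \<inter> {c. eigsp K c \<noteq> {0}})"
  proof (cases "v = 0")
    case True
    then show ?thesis by (simp add: subspace_0 subspace_Gr)
  next
    case False
    then show ?thesis using d by (intro eigsp_Gr) auto
  qed
qed

lemma Gr_Un: "v \<in> Gr K (D \<union> D') \<Longrightarrow> \<exists>v1 v2. v = v1 + v2 \<and> v1 \<in> Gr K D \<and> v2 \<in> Gr K D'"
  unfolding Gr_def UN_Un span_Un by blast

abbreviation pos :: "'g set" where "pos \<equiv> Gr K {0<..}"

text \<open>First-order perturbation: a term of the series that contains y and at least one more
  factor x or y has degree above c, because those factors have positive degree. What remains is the
  term [y, K] of order one.\<close>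

lemma Exp_add_eigenvector:
  assumes x: "x \<in> pos" and y: "y \<in> eigsp K c" "c > 0"
  shows "Exp br (x + y) K - Exp br x K - br y K \<in> Gr K {c<..}"
proof (rule sums_in_subspace[OF subspace_Gr])
  let ?f = "\<lambda>k. (br (x + y) ^^ k) K /\<^sub>R fact k - (br x ^^ k) K /\<^sub>R fact k - (if k = 1 then br y K else 0)"
  show "?f sums (Exp br (x + y) K - Exp br x K - br y K)"
    by (intro sums_diff Exp_sums sums_single[of 1 "\<lambda>_. br y K"])
  have yc: "y \<in> Gr K {c}" using y by (simp add: Gr_singleton)
  then have "y \<in> pos" by (rule Gr_mono[rotated]) (use y in auto)
  then have xy: "x + y \<in> pos" using x by (simp add: subspace_add subspace_Gr)
  have px: "(br x ^^ Suc k) K \<in> pos" for k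
  proof (induction k)
    case 0
    have "K \<in> Gr K {0}" by (simp add: Gr_singleton self_in_eigsp)
    with x show ?case by (simp, elim br_Gr) auto
  next
    case (Suc k)
    with x show ?case unfolding funpow.simps(2)[of "Suc k"] comp_apply by (elim br_Gr) auto
  qed
  \<comment> \<open>Telescoping. One pass shows that the differences have degree at least c
    (\<open>d\<close>); from the second power on, a further positive factor makes the inequality
    strict (\<open>dd\<close>).\<close>
  have step: "(br (x + y) ^^ Suc k) K - (br x ^^ Suc k) K =
      br (x + y) ((br (x + y) ^^ k) K - (br x ^^ k) K) + br y ((br x ^^ k) K)" for k
    by (simp add: br.diff_right br.add_left)
  have d: "(br (x + y) ^^ Suc k) K - (br x ^^ Suc k) K \<in> Gr K {c..}" for k
  proof (induction k)
    case 0
    have "br y K \<in> Gr K {c}"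
      using br_eigsp[OF y(1) self_in_eigsp] by (simp add: Gr_singleton)
    then have "br y K \<in> Gr K {c..}" by (rule Gr_mono[rotated]) auto
    then show ?case by (simp add: br.add_left)
  next
    case (Suc k)
    show ?case
      unfolding step[of "Suc k"]
      using br_Gr[OF xy Suc, of "{c..}"] br_Gr[OF yc px, of "{c..}"]
      by (intro subspace_add subspace_Gr) auto
  qed
  have dd: "(br (x + y) ^^ Suc (Suc k)) K - (br x ^^ Suc (Suc k)) K \<in> Gr K {c<..}" for k
    unfolding step[of "Suc k"]
    using br_Gr[OF xy d, of "{c<..}"] br_Gr[OF yc px, of "{c<..}"]
    by (intro subspace_add subspace_Gr) auto
  show "?f k \<in> Gr K {c<..}" for k
  proof -
    consider "k = 0" | "k = 1" | j where "k = Suc (Suc j)"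
      by (metis One_nat_def not0_implies_Suc)
    then show ?thesis
    proof cases
      case (3 j)
      then have "?f k = ((br (x + y) ^^ Suc (Suc j)) K - (br x ^^ Suc (Suc j)) K) /\<^sub>R fact k"
        by (simp add: scaleR_diff_right)
      then show ?thesis using subspace_scale[OF subspace_Gr dd] by metis
    qed (use subspace_0[OF subspace_Gr] in \<open>simp_all add: br.add_left\<close>)
  qed
qed

text \<open>
  Successive approximation: an error of lowest degree \<open>c\<close> is removed by adding to \<open>x\<close> an
  eigenvector for \<open>c\<close>.
\<close>

lemma Exp_orbit: assumes "w \<in> pos" shows "\<exists>x\<in>pos. Exp br x K = K + w"
proof -
  let ?E = "{c. eigsp K c \<noteq> {0}}"
  have "\<exists>x\<in>pos. Exp br x K = K + w"
    if "c \<ge> 0" "x \<in> pos" "Exp br x K - K - w \<in> Gr K {c<..}" for c x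
    using that
  proof (induction "card (?E \<inter> {c<..})" arbitrary: c x rule: less_induct)
    case less
    let ?A = "?E \<inter> {c<..}"
    have fin: "finite ?A" using finite_eigenvalues by simp
    have r: "Exp br x K - K - w \<in> Gr K ?A"
      using Gr_eigenvalues[OF less.prems(3)] by (simp add: Int_commute)
    show ?case
    proof (cases "?A = {}")
      case True
      then have "Exp br x K - K - w = 0" using r by (simp add: Gr_def)
      then have "Exp br x K = K + w" by (simp add: algebra_simps)
      then show ?thesis using less.prems(2) by blast
    next
      case False
      \<comment> \<open>The least eigenvalue above c is the lowest degree in which the error can be
        nonzero. Passing from c to b removes it from the finite set that the induction
        counts.\<close>
      define b where "b = Min ?A"
      have b: "b \<in> ?A" and b_min: "\<And>e. e \<in> ?A \<Longrightarrow> b \<le> e"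
        using fin False by (simp_all add: b_def Min_in del: Int_iff)
      have "?A \<subseteq> {b} \<union> {b<..}" using b_min by force
      then have "Exp br x K - K - w \<in> Gr K ({b} \<union> {b<..})" using r Gr_mono by blast
      then obtain u u' where u: "Exp br x K - K - w = u + u'" "u \<in> eigsp K b" "u' \<in> Gr K {b<..}"
        using Gr_Un[of _ "{b}"] unfolding Gr_singleton by blast
      have "b > 0" using b less.prems(1) by auto
      \<comment> \<open>Since [y, K] = -b y = -u, this correction cancels the component of degree
        b.\<close>
      define y where "y = u /\<^sub>R b"
      have y: "y \<in> eigsp K b"
        using u(2) subspace_scale[OF subspace_eigsp] by (simp add: y_def)
      have "br y K = - u"
        using y \<open>b > 0\<close> br_skew[of y K] by (simp add: eigsp_def y_def)
      then have eq: "Exp br (x + y) K - K - w = (Exp br (x + y) K - Exp br x K - br y K) + u'"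
        using u(1) by (simp add: algebra_simps)
      have "Exp br (x + y) K - K - w \<in> Gr K {b<..}"
        unfolding eq
        by (rule subspace_add[OF subspace_Gr Exp_add_eigenvector[OF less.prems(2) y \<open>b > 0\<close>] u(3)])
      moreover have "y \<in> pos" using y \<open>b > 0\<close> by (simp add: eigsp_Gr)
      then have "x + y \<in> pos" using less.prems(2) by (simp add: subspace_add subspace_Gr)
      moreover have "?E \<inter> {b<..} \<subset> ?A" using b by auto
      then have "card (?E \<inter> {b<..}) < card ?A" using fin by (simp add: psubset_card_mono)
      ultimately show ?thesis using less.hyps \<open>b > 0\<close> by simp
    qed
  qed
  \<comment> \<open>The iteration starts with x = 0, where the error is -w.\<close>
  from this[of 0 0] show ?thesis
    using assms subspace_0[OF subspace_Gr] subspace_neg[OF subspace_Gr] by simp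
qed

text \<open>Fixing K, g preserves each eigenspace of ad K; so g v - v has degree c as well as
  degrees above c only, and vanishes.\<close>

lemma aut_unipotent_eq_id:
  assumes g: "aut g" "g K = K"
    and raise: "\<And>c v. v \<in> eigsp K c \<Longrightarrow> g v - v \<in> Gr K {c<..}"
  shows "g = id_blinfun"
proof -
  have "v \<in> {v. g v = v}" for v
  proof (rule Gr_subsetI)
    show "subspace {v. g v = v}"
      by (simp add: subspace_def blinfun.zero_right blinfun.add_right blinfun.scaleR_right)
    show "v \<in> Gr K UNIV" by (simp add: Gr_UNIV)
    fix c v assume v: "v \<in> eigsp K c"
    have "br K (g v) = c *\<^sub>R g v"
      using aut_br[OF g(1), of K v] v by (simp add: g(2) eigsp_def blinfun.scaleR_right)
    then have "g v - v \<in> eigsp K c" using v subspace_diff[OF subspace_eigsp] by (simp add: eigsp_def)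
    then have "g v - v = 0"
      using raise[OF v] by (intro Gr_disjoint[of _ "{c}" "{c<..}"]) (auto simp: Gr_singleton)
    then show "v \<in> {v. g v = v}" by simp
  qed
  then show ?thesis by (intro blinfun_eqI) simp
qed

lemma Exp_pos_raise: "x \<in> pos \<Longrightarrow> v \<in> Gr K {c..} \<Longrightarrow> Exp br x v - v \<in> Gr K {c<..}"
  by (rule Exp_minus_id_Gr) auto

text \<open>The orbit lemma provides x with exp(x) K = g K; then exp(-x) g is unipotent and fixes K,
  hence is the identity.\<close>

lemma aut_unipotent_eq_Exp:
  assumes g: "aut g"
    and raise: "\<And>c v. v \<in> eigsp K c \<Longrightarrow> g v - v \<in> Gr K {c<..}"
  shows "\<exists>x\<in>pos. g = Exp br x"
proof -
  obtain x where x: "x \<in> pos" "Exp br x K = g K"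
    using Exp_orbit[OF raise[OF self_in_eigsp]] by auto
  have mx: "- x \<in> pos" using x(1) subspace_neg[OF subspace_Gr] by blast
  have "Exp br (- x) o\<^sub>L g = id_blinfun"
  proof (rule aut_unipotent_eq_id)
    show "(Exp br (- x) o\<^sub>L g) K = K" by (simp flip: x(2))
    fix c v assume v: "v \<in> eigsp K c"
    have "Exp br (- x) (g v - v) \<in> Gr K {c<..}" using Exp_Gr[OF mx raise[OF v]] by auto
    moreover have "Exp br (- x) v - v \<in> Gr K {c<..}"
      using v by (intro Exp_pos_raise[OF mx]) (simp add: eigsp_Gr)
    ultimately have "Exp br (- x) (g v - v) + (Exp br (- x) v - v) \<in> Gr K {c<..}"
      by (rule subspace_add[OF subspace_Gr])
    then show "(Exp br (- x) o\<^sub>L g) v - v \<in> Gr K {c<..}" by (simp add: blinfun.diff_right)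
  qed (simp add: aut_compose g)
  then have "g v = Exp br x v" for v
    by (metis Exp_inverse_apply(1) blinfun_apply_blinfun_compose blinfun_apply_id_blinfun id_apply)
  then show ?thesis using x(1) blinfun_eqI by blast
qed

text \<open>A product of unipotent automorphisms is unipotent, hence a single exponential. This is
  what closes N under multiplication.\<close>

lemma Exp_pos_compose:
  assumes "x \<in> pos" "y \<in> pos"
  shows "\<exists>z\<in>pos. Exp br x o\<^sub>L Exp br y = Exp br z"
proof (rule aut_unipotent_eq_Exp)
  fix c v assume v: "v \<in> eigsp K c"
  have 1: "Exp br y v - v \<in> Gr K {c<..}"
    using v by (intro Exp_pos_raise[OF assms(2)]) (simp add: eigsp_Gr)
  have "Exp br x (Exp br y v - v) \<in> Gr K {c<..}"
    using Exp_Gr[OF assms(1) 1] by auto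
  moreover have "Exp br x v - v \<in> Gr K {c<..}"
    using v by (intro Exp_pos_raise[OF assms(1)]) (simp add: eigsp_Gr)
  ultimately have "Exp br x (Exp br y v - v) + (Exp br x v - v) \<in> Gr K {c<..}"
    by (rule subspace_add[OF subspace_Gr])
  then show "(Exp br x o\<^sub>L Exp br y) v - v \<in> Gr K {c<..}" by (simp add: blinfun.diff_right)
qed (simp add: aut_compose)

end

section \<open>The groups \<open>N\<close> and \<open>P\<close>\<close>

context root_data
begin

lemma linear_eq_on_root_data':
  assumes "linear f" "linear h" "\<And>x. x \<in> \<aa> \<union> X ` R \<Longrightarrow> f x = h x"
  shows "f v = h v"
  using assms by (intro linear_eq_on_root_data[of f h v]) auto

lemma a_eigsp: "K \<in> \<aa> \<Longrightarrow> H \<in> \<aa> \<Longrightarrow> H \<in> eigsp K 0"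
  by (simp add: eigsp_def a_abelian)

lemma X_eigsp: "K \<in> \<aa> \<Longrightarrow> \<alpha> \<in> R \<Longrightarrow> X \<alpha> \<in> eigsp K (\<alpha> K)"
  by (simp add: eigsp_def br_a_X)

text \<open>For any other c, v would be Killing-orthogonal to the Cartan subspace and to all root
  vectors.\<close>

lemma eigsp_nonzero:
  assumes K: "K \<in> \<aa>" and v: "v \<in> eigsp K c" "v \<noteq> 0"
  shows "c = 0 \<or> (\<exists>\<alpha>\<in>R. c = \<alpha> K)"
proof (rule ccontr)
  assume c: "\<not> (c = 0 \<or> (\<exists>\<alpha>\<in>R. c = \<alpha> K))"
  have "u \<in> {u. kill v u = 0}" for u
  proof (rule subspace_eq_UNIV)
    show "subspace {u. kill v u = 0}"
      by (auto simp: subspace_def kill.zero_right kill.add_right kill.scaleR_right)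
    show "\<aa> \<subseteq> {u. kill v u = 0}"
      using kill_eigsp[OF v(1) a_eigsp[OF K]] c by auto
    fix \<alpha> assume \<alpha>: "\<alpha> \<in> R"
    then have "c + \<alpha> K \<noteq> 0" using c uminus_root[OF \<alpha>] by (auto simp flip: eq_neg_iff_add_eq_0)
    then show "X \<alpha> \<in> {u. kill v u = 0}" using kill_eigsp[OF v(1) X_eigsp[OF K \<alpha>]] by simp
  qed
  then show False using kill_nondegenerate[of v] v(2) by simp
qed

lemma grading_element_a: assumes K: "K \<in> \<aa>" shows "grading_element br K"
proof
  have "v \<in> Gr K UNIV" for v
  proof (rule subspace_eq_UNIV[OF subspace_Gr])
    show "\<aa> \<subseteq> Gr K UNIV" using eigsp_Gr[OF a_eigsp[OF K]] by blast
    show "X \<alpha> \<in> Gr K UNIV" if "\<alpha> \<in> R" for \<alpha> using eigsp_Gr[OF X_eigsp[OF K that]] by blast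
  qed
  then show "Gr K UNIV = UNIV" by blast
  have "{c. eigsp K c \<noteq> {0}} \<subseteq> insert 0 ((\<lambda>\<alpha>. \<alpha> K) ` R)"
  proof
    fix c assume "c \<in> {c. eigsp K c \<noteq> {0}}"
    then obtain v where "v \<in> eigsp K c" "v \<noteq> 0" using subspace_0[OF subspace_eigsp] by blast
    then show "c \<in> insert 0 ((\<lambda>\<alpha>. \<alpha> K) ` R)" using eigsp_nonzero[OF K] by blast
  qed
  then show "finite {c. eigsp K c \<noteq> {0}}"
    using finite_roots finite_subset by blast
qed

lemma Gr_uminus: "Gr (- K) D = Gr K (uminus ` D)"
proof -
  have "eigsp (- K) c = eigsp K (- c)" for c
    by (auto simp: eigsp_def br.minus_left minus_equation_iff)
  then show ?thesis by (simp add: Gr_def)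
qed

lemma Exp_a: "H \<in> \<aa> \<Longrightarrow> H' \<in> \<aa> \<Longrightarrow> Exp br H H' = H'"
  using Exp_eigenvector[of H H' 0] by (simp add: a_abelian)

lemma aut_fix_eigsp:
  assumes "aut g" "g K = K" "v \<in> eigsp K c"
  shows "g v \<in> eigsp K c"
  using aut_br[OF assms(1), of K v] assms(2,3) by (simp add: eigsp_def blinfun.scaleR_right)

lemma aut_fix_Gr:
  assumes "aut g" "g K = K" "v \<in> Gr K D"
  shows "g v \<in> Gr K D"
proof -
  have "subspace {v. g v \<in> Gr K D}"
    using subspace_Gr[of K D] by (simp add: subspace_def blinfun.zero_right blinfun.add_right blinfun.scaleR_right)
  then have "v \<in> {v. g v \<in> Gr K D}"
    by (rule Gr_subsetI[OF _ _ assms(3)])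
      (use aut_fix_eigsp[OF assms(1,2)] eigsp_Gr in blast)
  then show ?thesis by simp
qed

text \<open>
  The logarithm of an automorphism that is diagonal with positive entries is a derivation, hence
  inner.
\<close>

lemma diagonal_aut_eq_Exp:
  assumes g: "aut g" and ga: "\<And>H. H \<in> \<aa> \<Longrightarrow> g H = H"
    and gX: "\<And>\<alpha>. \<alpha> \<in> R \<Longrightarrow> g (X \<alpha>) = c \<alpha> *\<^sub>R X \<alpha>" "\<And>\<alpha>. \<alpha> \<in> R \<Longrightarrow> c \<alpha> > 0"
  obtains d where "d \<in> \<aa>" "g = Exp br d"
proof -
  have ling: "linear g" by (simp add: bounded_linear.linear blinfun.bounded_linear_right)
  define D where "D v = (\<Sum>\<alpha>\<in>R. (ln (c \<alpha>) * kill v (X (- \<alpha>))) *\<^sub>R X \<alpha>)" for v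
  have linD: "linear D"
    unfolding D_def
    by (rule linearI)
      (simp_all add: kill.add_left kill.scaleR_left sum.distrib algebra_simps scaleR_sum_right)
  \<comment> \<open>\<open>D\<close> is the logarithm of g on every eigenvector of g, not only on
    the chosen basis. This generality is needed for brackets of basis vectors, which are
    eigenvectors of g without being basis vectors.\<close>
  have D_eig: "D v = ln r *\<^sub>R v" if v: "g v = r *\<^sub>R v" for r v
  proof -
    have comp: "c \<alpha> = r \<or> kill v (X (- \<alpha>)) = 0" if \<alpha>: "\<alpha> \<in> R" for \<alpha>
    proof -
      have lin: "linear (\<lambda>v. kill v (X (- \<alpha>)))"
        by (simp add: bounded_linear.linear kill.bounded_linear_left)
      have "kill (g v) (X (- \<alpha>)) = c \<alpha> * kill v (X (- \<alpha>))"
      proof (rule linear_eq_on_root_data[of "\<lambda>v. kill (g v) (X (- \<alpha>))" "\<lambda>v. c \<alpha> * kill v (X (- \<alpha>))"])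
        show "linear (\<lambda>v. kill (g v) (X (- \<alpha>)))" using linear_compose[OF ling lin] by (simp add: o_def)
        show "linear (\<lambda>v. c \<alpha> * kill v (X (- \<alpha>)))" using linear_compose_scale_right[OF lin, of "c \<alpha>"] by simp
      qed (use \<alpha> in \<open>simp_all add: ga gX kill_a_X uminus_root kill.scaleR_left kill_X\<close>)
      then show ?thesis by (auto simp: v kill.scaleR_left)
    qed
    have "a_part (g v) = a_part v"
    proof (rule linear_eq_on_root_data[of "\<lambda>v. a_part (g v)"])
      show "linear (\<lambda>v. a_part (g v))" using linear_compose[OF ling linear_a_part] by (simp add: o_def)
    qed (simp_all add: linear_a_part ga gX linear_scale[OF linear_a_part] a_part_X)
    then have "r *\<^sub>R a_part v = 1 *\<^sub>R a_part v" by (simp add: v linear_scale[OF linear_a_part])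
    \<comment> \<open>Either r = 1, and the logarithm vanishes, or the Cartan component of v
      vanishes.\<close>
    then have "ln r *\<^sub>R a_part v = 0" unfolding scaleR_cancel_right by auto
    moreover have "D v = (\<Sum>\<alpha>\<in>R. ln r *\<^sub>R (kill v (X (- \<alpha>)) *\<^sub>R X \<alpha>))"
      unfolding D_def using comp by (intro sum.cong) auto
    then have "D v = ln r *\<^sub>R (v - a_part v)"
      by (simp add: a_part_def scaleR_sum_right)
    ultimately show ?thesis by (simp add: scaleR_diff_right)
  qed
  have eig: "\<exists>r>0. g x = r *\<^sub>R x" if "x \<in> \<aa> \<union> X ` R" for x
  proof (cases "x \<in> \<aa>")
    case True
    then show ?thesis using ga by (intro exI[of _ 1]) simp
  qed (use that gX in blast)
  have der: "D (br x y) = br (D x) y + br x (D y)"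
    if x: "x \<in> \<aa> \<union> X ` R" and y: "y \<in> \<aa> \<union> X ` R" for x y
  proof -
    obtain r s where rs: "r > 0" "g x = r *\<^sub>R x" "s > 0" "g y = s *\<^sub>R y"
      using eig[OF x] eig[OF y] by blast
    \<comment> \<open>Eigenvalues multiply under the bracket, so their logarithms add: this is the
      Leibniz rule. Positivity of r and s enters through \<open>ln_mult\<close>.\<close>
    have gxy: "g (br x y) = (r * s) *\<^sub>R br x y"
      by (simp add: aut_br[OF g] rs br.scaleR_left br.scaleR_right)
    show ?thesis
      using D_eig[OF rs(2)] D_eig[OF rs(4)] D_eig[OF gxy] rs(1,3)
      by (simp add: ln_mult br.scaleR_left br.scaleR_right scaleR_add_left)
  qed
  have "D (br x y) = br (D x) y + br x (D y)" for x y
  proof -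
    have lr: "linear (\<lambda>y. D (br x y))" "linear (\<lambda>y. br (D x) y + br x (D y))" for x
      using linear_compose[OF linear_br linD] linear_compose[OF linD linear_br]
      by (simp_all add: o_def linear_compose_add linear_br)
    have ll: "linear (\<lambda>x. D (br x y))" "linear (\<lambda>x. br (D x) y + br x (D y))" for y
      by (rule linearI; simp add: br.add_left br.scaleR_left linear_add[OF linD] linear_scale[OF linD] algebra_simps)+
    have "D (br x y) = br (D x) y + br x (D y)" if "x \<in> \<aa> \<union> X ` R" for x y
      using linear_eq_on_root_data'[OF lr] der[OF that] by blast
    then show ?thesis using linear_eq_on_root_data'[OF ll] by blast
  qed
  then obtain d where d: "\<And>x. D x = br d x" using derivation_inner[OF linD] by blast
  have Da: "br d H = 0" if "H \<in> \<aa>" for H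
    using D_eig[of H 1] ga[OF that] by (simp add: d)
  then have "d \<in> \<aa>" by (intro centralizer_a) (metis br_skew neg_0_equal_iff_equal)
  moreover have "g v = Exp br d v" for v
  proof (rule linear_eq_on_root_data[OF ling])
    show "linear (Exp br d)" by (simp add: bounded_linear.linear blinfun.bounded_linear_right)
    show "g H = Exp br d H" if "H \<in> \<aa>" for H
      using Exp_a[OF \<open>d \<in> \<aa>\<close> that] ga[OF that] by simp
    show "g (X \<alpha>) = Exp br d (X \<alpha>)" if "\<alpha> \<in> R" for \<alpha>
      using Exp_eigenvector[of d "X \<alpha>" "ln (c \<alpha>)"] D_eig[OF gX(1)[OF that]] gX[OF that] by (simp add: d)
  qed
  ultimately show ?thesis using that blinfun_eqI by blast
qed

end

text \<open>\<open>H0_inj\<close> makes every nonzero eigenspace of ad H0 for a nonzero eigenvalue a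
  single root line, so that an automorphism fixing \<open>H0\<close> preserves each root
  line.\<close>

locale regular_data = root_data br \<theta> \<aa> X
  for br :: "'g::euclidean_space \<Rightarrow> 'g \<Rightarrow> 'g" and \<theta> :: "'g \<Rightarrow> 'g" and \<aa> :: "'g set"
    and X :: "('g \<Rightarrow> real) \<Rightarrow> 'g" +
  fixes \<Sigma>p :: "('g \<Rightarrow> real) set" and H0 :: 'g
  assumes H0_a: "H0 \<in> \<aa>"
    and H0_nonzero: "\<alpha> \<in> R \<Longrightarrow> \<alpha> H0 \<noteq> 0"
    and H0_inj: "\<alpha> \<in> R \<Longrightarrow> \<beta> \<in> R \<Longrightarrow> \<alpha> H0 = \<beta> H0 \<Longrightarrow> \<alpha> = \<beta>"
    and pos_eq: "\<Sigma>p = {\<alpha> \<in> R. \<alpha> H0 > 0}"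
begin

sublocale grading_element br H0
  by (rule grading_element_a[OF H0_a])

sublocale neg: grading_element br "- H0"
  by (rule grading_element_a) (simp add: subspace_neg[OF subspace_a] H0_a)

lemma pos_root: "\<alpha> \<in> \<Sigma>p \<Longrightarrow> \<alpha> \<in> R"
  by (simp add: pos_eq)

lemma eigsp_0: "eigsp H0 0 = \<aa>"
proof
  show "eigsp H0 0 \<subseteq> \<aa>"
  proof
    fix v assume v: "v \<in> eigsp H0 0"
    have "kill v (X (- \<alpha>)) = 0" if "\<alpha> \<in> R" for \<alpha>
      using kill_eigsp[OF v X_eigsp[OF H0_a uminus_root[OF that]]] H0_nonzero[OF that] by simp
    then have "v = a_part v" by (simp add: a_part_def)
    then show "v \<in> \<aa>" using a_part_in_a by metis
  qed
qed (use a_eigsp[OF H0_a] in blast)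

lemma eigsp_root: assumes "\<alpha> \<in> R" shows "eigsp H0 (\<alpha> H0) = span {X \<alpha>}"
proof
  show "eigsp H0 (\<alpha> H0) \<subseteq> span {X \<alpha>}"
  proof
    fix v assume v: "v \<in> eigsp H0 (\<alpha> H0)"
    have "kill v (X (- \<beta>)) = 0" if "\<beta> \<in> R" "\<beta> \<noteq> \<alpha>" for \<beta>
      using kill_eigsp[OF v X_eigsp[OF H0_a uminus_root[OF that(1)]]] H0_inj[OF assms that(1)] that(2)
      by auto
    then have "(\<Sum>\<beta>\<in>R. kill v (X (- \<beta>)) *\<^sub>R X \<beta>) =
        (\<Sum>\<beta>\<in>R. if \<beta> = \<alpha> then kill v (X (- \<beta>)) *\<^sub>R X \<beta> else 0)"
      by (intro sum.cong) auto
    moreover have "a_part v = 0"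
    proof -
      have "kill (a_part v) (a_part v) = 0"
        using kill_eigsp[OF v a_eigsp[OF H0_a a_part_in_a]] H0_nonzero[OF assms]
          kill_a_part[OF a_part_in_a, of v v] by (simp add: kill_commute)
      then show ?thesis using kill_a_pos[OF a_part_in_a] by (metis less_irrefl)
    qed
    ultimately have "v = kill v (X (- \<alpha>)) *\<^sub>R X \<alpha>"
      using root_decomposition[of v] finite_roots assms by simp
    then show "v \<in> span {X \<alpha>}" by (metis span_base span_scale singletonI)
  qed
  show "span {X \<alpha>} \<subseteq> eigsp H0 (\<alpha> H0)"
    using X_eigsp[OF H0_a assms] subspace_eigsp by (simp add: span_minimal)
qed

lemma n_alg_eq: "n_alg br \<aa> \<Sigma>p = Gr H0 {0<..}"
proof
  have "root_space br \<aa> \<alpha> \<subseteq> Gr H0 {0<..}" if "\<alpha> \<in> \<Sigma>p" for \<alpha>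
    using that eigsp_Gr[of _ H0 "\<alpha> H0" "{0<..}"] eigsp_root root_space_eq by (auto simp: pos_eq)
  then show "n_alg br \<aa> \<Sigma>p \<subseteq> Gr H0 {0<..}"
    unfolding n_alg_def by (intro span_minimal subspace_Gr) blast
  show "Gr H0 {0<..} \<subseteq> n_alg br \<aa> \<Sigma>p"
  proof
    have eig: "v \<in> n_alg br \<aa> \<Sigma>p" if d: "d \<in> {0<..}" "v \<in> eigsp H0 d" for d v
    proof (cases "v = 0")
      case False
      then obtain \<alpha> where \<alpha>: "\<alpha> \<in> R" "d = \<alpha> H0" using eigsp_nonzero[OF H0_a d(2)] d(1) by auto
      then have "\<alpha> \<in> \<Sigma>p" "v \<in> root_space br \<aa> \<alpha>" using d eigsp_root root_space_eq by (auto simp: pos_eq)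
      then show ?thesis unfolding n_alg_def by (blast intro: span_base)
    qed (simp add: n_alg_def span_zero)
    show "v \<in> n_alg br \<aa> \<Sigma>p" if "v \<in> Gr H0 {0<..}" for v
      by (rule Gr_subsetI[OF _ eig that]) (simp_all add: n_alg_def)
  qed
qed

lemma nbar_alg_eq: "nbar_alg br \<aa> \<Sigma>p = Gr H0 {..<0}"
proof
  have "root_space br \<aa> (- \<alpha>) \<subseteq> Gr H0 {..<0}" if "\<alpha> \<in> \<Sigma>p" for \<alpha>
    using that eigsp_Gr[of _ H0 "(- \<alpha>) H0" "{..<0}"] eigsp_root[of "- \<alpha>"] root_space_eq[of "- \<alpha>"]
      uminus_root by (auto simp: pos_eq)
  then show "nbar_alg br \<aa> \<Sigma>p \<subseteq> Gr H0 {..<0}"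
    unfolding nbar_alg_def by (intro span_minimal subspace_Gr) blast
  show "Gr H0 {..<0} \<subseteq> nbar_alg br \<aa> \<Sigma>p"
  proof
    have eig: "v \<in> nbar_alg br \<aa> \<Sigma>p" if d: "d \<in> {..<0}" "v \<in> eigsp H0 d" for d v
    proof (cases "v = 0")
      case False
      then obtain \<alpha> where \<alpha>: "\<alpha> \<in> R" "d = \<alpha> H0" using eigsp_nonzero[OF H0_a d(2)] d(1) by auto
      then have "- \<alpha> \<in> \<Sigma>p" "v \<in> root_space br \<aa> (- (- \<alpha>))"
        using d eigsp_root root_space_eq uminus_root by (auto simp: pos_eq)
      then show ?thesis unfolding nbar_alg_def by (blast intro: span_base)
    qed (simp add: nbar_alg_def span_zero)
    show "v \<in> nbar_alg br \<aa> \<Sigma>p" if "v \<in> Gr H0 {..<0}" for v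
      by (rule Gr_subsetI[OF _ eig that]) (simp_all add: nbar_alg_def)
  qed
qed

lemma Gr_neg_pos: "Gr (- H0) {0<..} = Gr H0 {..<0}"
  by (simp add: Gr_uminus)

lemma N_group_eq: "N_group br \<aa> \<Sigma>p = Exp br ` Gr H0 {0<..}"
  by (simp add: N_group_def n_alg_eq)

lemma N_group_aut: "n \<in> N_group br \<aa> \<Sigma>p \<Longrightarrow> aut n"
  by (auto simp: N_group_eq)

lemma N_group_compose:
  "n \<in> N_group br \<aa> \<Sigma>p \<Longrightarrow> n' \<in> N_group br \<aa> \<Sigma>p \<Longrightarrow> n o\<^sub>L n' \<in> N_group br \<aa> \<Sigma>p"
  unfolding N_group_eq using Exp_pos_compose by fastforce

lemma Exp_in_P_group:
  assumes "H \<in> \<aa>" "V \<in> Gr H0 {..<0}"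
  shows "Exp br H o\<^sub>L Exp br V \<in> P_group br \<theta> \<aa> \<Sigma>p"
proof -
  have "id_blinfun \<in> M_group br \<theta> \<aa>"
    by (simp add: M_group_def K_group_def Int_group.one)
  moreover have "id_blinfun o\<^sub>L Exp br H o\<^sub>L Exp br V = Exp br H o\<^sub>L Exp br V"
    by (rule blinfun_eqI) simp
  ultimately show ?thesis
    using assms unfolding P_group_def nbar_alg_eq mem_Collect_eq
    by (intro exI[of _ id_blinfun] exI[of _ H] exI[of _ V]) simp
qed

text \<open>
  By the orbit lemma for \<open>- H\<^sub>0\<close>, \<open>g = exp(v) g'\<close> with \<open>v \<in> \<nn>\<^sup>-\<close> and \<open>g'\<close> fixing \<open>H\<^sub>0\<close>.  Since \<open>H\<^sub>0\<close>
  separates the roots, \<open>g'\<close> is diagonal, and its entries are those of \<open>g\<close>.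
\<close>

lemma in_P_groupI:
  assumes g: "aut g" and gH0: "g H0 - H0 \<in> Gr H0 {..<0}"
    and gpos: "\<And>\<alpha>. \<alpha> \<in> R \<Longrightarrow> kill (g (X \<alpha>)) (X (- \<alpha>)) > 0"
  shows "g \<in> P_group br \<theta> \<aa> \<Sigma>p"
proof -
  have "- (g H0 - H0) \<in> Gr (- H0) {0<..}"
    using gH0 unfolding Gr_neg_pos by (rule subspace_neg[OF subspace_Gr])
  then obtain v where v: "v \<in> Gr (- H0) {0<..}" "Exp br v (- H0) = - H0 + - (g H0 - H0)"
    using neg.Exp_orbit by blast
  then have vH0: "Exp br v H0 = g H0" by (simp add: blinfun.minus_right)
  have v_neg: "v \<in> Gr H0 {..<0}" using v(1) by (simp add: Gr_neg_pos)
  define g' where "g' = Exp br (- v) o\<^sub>L g"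
  have g': "aut g'" "g' H0 = H0" by (simp_all add: g'_def aut_compose g flip: vH0)
  have gg': "g x = Exp br v (g' x)" for x by (simp add: g'_def)
  \<comment> \<open>Applying g' to [H, X_\<alpha>] = \<alpha>(H) X_\<alpha> yields \<alpha>(g' H) =
    \<alpha>(H), because g' preserves the line of X_\<alpha>; and the roots separate the points of
    the Cartan subspace.\<close>
  have a: "g' H = H" if H: "H \<in> \<aa>" for H
  proof (rule a_eqI)
    show g'a: "g' H \<in> \<aa>" using aut_fix_eigsp[OF g'] H eigsp_0 by blast
    fix \<alpha> assume \<alpha>: "\<alpha> \<in> R"
    obtain h :: "'g \<Rightarrow>\<^sub>L 'g" where h: "\<And>x. h (g' x) = x" using aut_inverse[OF g'(1)] by blast
    have nz: "g' (X \<alpha>) \<noteq> 0"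
    proof
      assume "g' (X \<alpha>) = 0"
      then show False using h[of "X \<alpha>"] X_nonzero[OF \<alpha>] by (simp add: blinfun.zero_right)
    qed
    have "g' (X \<alpha>) \<in> root_space br \<aa> \<alpha>"
      using aut_fix_eigsp[OF g' X_eigsp[OF H0_a \<alpha>]] eigsp_root[OF \<alpha>] root_space_eq[OF \<alpha>] by simp
    then have "\<alpha> (g' H) *\<^sub>R g' (X \<alpha>) = br (g' H) (g' (X \<alpha>))"
      using root_spaceD[OF _ g'a] by simp
    also have "\<dots> = g' (br H (X \<alpha>))" by (simp only: aut_br[OF g'(1)])
    also have "\<dots> = \<alpha> H *\<^sub>R g' (X \<alpha>)" by (simp add: br_a_X[OF H \<alpha>] blinfun.scaleR_right)
    finally show "\<alpha> (g' H) = \<alpha> H" by (rule scaleR_right_imp_eq[OF nz])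
  qed (rule H)
  define c where "c \<alpha> = kill (g (X \<alpha>)) (X (- \<alpha>))" for \<alpha>
  have X: "g' (X \<alpha>) = c \<alpha> *\<^sub>R X \<alpha>" if \<alpha>: "\<alpha> \<in> R" for \<alpha>
  proof -
    have "g' (X \<alpha>) \<in> span {X \<alpha>}"
      using aut_fix_eigsp[OF g' X_eigsp[OF H0_a \<alpha>]] eigsp_root[OF \<alpha>] by simp
    then obtain k where k: "g' (X \<alpha>) = k *\<^sub>R X \<alpha>" by (auto simp: span_singleton)
    have "X \<alpha> \<in> Gr H0 {\<alpha> H0}" using X_eigsp[OF H0_a \<alpha>] by (simp add: Gr_singleton)
    \<comment> \<open>exp(v) changes X_\<alpha> only in degrees below \<alpha>(H0), which pair to 0
      with X_-\<alpha>; so the diagonal entries of g and g' agree.\<close>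
    then have "Exp br v (X \<alpha>) - X \<alpha> \<in> Gr H0 {..<\<alpha> H0}"
      by (rule Exp_minus_id_Gr[OF v_neg]) auto
    then have "\<forall>u\<in>eigsp H0 (- \<alpha> H0). kill (Exp br v (X \<alpha>) - X \<alpha>) u = 0"
      unfolding Gr_iff by (elim allE[of _ "- \<alpha> H0"]) simp
    then have "kill (Exp br v (X \<alpha>) - X \<alpha>) (X (- \<alpha>)) = 0"
      using X_eigsp[OF H0_a uminus_root[OF \<alpha>]] by simp
    then have "c \<alpha> = k"
      using kill_X_uminus[OF \<alpha>] by (simp add: c_def gg' k blinfun.scaleR_right kill.scaleR_left kill.diff_left)
    with k show ?thesis by simp
  qed
  have cpos: "c \<alpha> > 0" if "\<alpha> \<in> R" for \<alpha> using gpos[OF that] by (simp add: c_def)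
  obtain d where d: "d \<in> \<aa>" "g' = Exp br d"
    using diagonal_aut_eq_Exp[OF g'(1) a X cpos] by blast
  have "- d \<in> \<aa>" using d(1) subspace_neg[OF subspace_a] by blast
  then have "- d \<in> Gr H0 {0}" using eigsp_0 Gr_singleton by simp
  then have "Exp br (- d) v \<in> Gr H0 {..<0}" by (rule Exp_Gr[OF _ v_neg]) auto
  \<comment> \<open>Conjugation by exp(d) swaps the two factors into the order prescribed by
    \<open>P_group\<close>, with the identity as component in M.\<close>
  moreover have "g = Exp br d o\<^sub>L Exp br (Exp br (- d) v)"
    by (rule blinfun_eqI) (simp add: gg' d(2) aut_Exp_conj[OF aut_Exp, of d "Exp br (- d) v"])
  ultimately show ?thesis using Exp_in_P_group[OF d(1)] by simp
qed

text \<open>What uniqueness uses of an element of P. The last conjunct is there to make the property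
  stable under composition, so it can be checked on the factors from M, A and the opposite nilpotent
  group separately.\<close>

definition lowering :: "('g \<Rightarrow>\<^sub>L 'g) \<Rightarrow> bool" where
  "lowering p \<longleftrightarrow> aut p \<and> p H0 - H0 \<in> Gr H0 {..<0} \<and> (\<forall>u\<in>Gr H0 {..<0}. p u \<in> Gr H0 {..<0})"

lemma lowering_compose: "lowering p \<Longrightarrow> lowering q \<Longrightarrow> lowering (p o\<^sub>L q)"
proof -
  assume p: "lowering p" and q: "lowering q"
  have "(p o\<^sub>L q) H0 - H0 = p (q H0 - H0) + (p H0 - H0)" by (simp add: blinfun.diff_right)
  also have "\<dots> \<in> Gr H0 {..<0}" using p q by (intro subspace_add[OF subspace_Gr]) (auto simp: lowering_def)
  finally show ?thesis using p q by (simp add: lowering_def aut_compose)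
qed

lemma lowering_fix: "aut g \<Longrightarrow> g H0 = H0 \<Longrightarrow> lowering g"
  using aut_fix_Gr[of g H0] by (simp add: lowering_def subspace_0 subspace_Gr)

lemma lowering_Exp: assumes "V \<in> Gr H0 {..<0}" shows "lowering (Exp br V)"
proof -
  have "H0 \<in> Gr H0 {0}" by (simp add: Gr_singleton self_in_eigsp)
  then have "Exp br V H0 - H0 \<in> Gr H0 {..<0}" by (rule Exp_minus_id_Gr[OF assms]) auto
  moreover have "Exp br V u \<in> Gr H0 {..<0}" if "u \<in> Gr H0 {..<0}" for u
    using Exp_Gr[OF assms that] by auto
  ultimately show ?thesis by (simp add: lowering_def)
qed

lemma P_group_lowering:
  assumes "p \<in> P_group br \<theta> \<aa> \<Sigma>p"
  shows "lowering p" "\<exists>h. lowering h \<and> (\<forall>x. p (h x) = x)"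
proof -
  obtain m H V where p: "p = m o\<^sub>L Exp br H o\<^sub>L Exp br V"
    and m: "m \<in> M_group br \<theta> \<aa>" and H: "H \<in> \<aa>" and V: "V \<in> Gr H0 {..<0}"
    using assms unfolding P_group_def nbar_alg_eq by blast
  have maut: "aut m" "m H0 = H0"
    using m H0_a by (auto simp: M_group_def K_group_def Int_group_aut)
  obtain m' where m': "aut m'" "\<And>x. m (m' x) = x" "\<And>x. m' (m x) = x"
    using aut_inverse[OF maut(1)] by blast
  have "m' H0 = H0" using m'(3)[of H0] maut(2) by simp
  moreover have "- H \<in> \<aa>" "- V \<in> Gr H0 {..<0}"
    using H V subspace_neg[OF subspace_a] subspace_neg[OF subspace_Gr] by blast+
  ultimately have "lowering (Exp br (- V) o\<^sub>L (Exp br (- H) o\<^sub>L m'))"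
    using m'(1) H0_a by (intro lowering_compose lowering_Exp lowering_fix) (simp_all add: Exp_a)
  moreover have "p ((Exp br (- V) o\<^sub>L (Exp br (- H) o\<^sub>L m')) x) = x" for x
    by (simp add: p m'(2))
  ultimately show "\<exists>h. lowering h \<and> (\<forall>x. p (h x) = x)" by blast
  show "lowering p"
    unfolding p using maut H V H0_a
    by (intro lowering_compose lowering_Exp lowering_fix) (simp_all add: Exp_a)
qed

text \<open>From n p = n' p' one gets an exponential of n equal to a lowering map: it moves H0 by
  positive degrees and by negative degrees, so it fixes H0, and a unipotent automorphism fixing H0
  is the identity.\<close>

lemma NP_unique:
  assumes n: "n \<in> N_group br \<aa> \<Sigma>p" "n' \<in> N_group br \<aa> \<Sigma>p"
    and p: "p \<in> P_group br \<theta> \<aa> \<Sigma>p" "p' \<in> P_group br \<theta> \<aa> \<Sigma>p"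
    and eq: "n o\<^sub>L p = n' o\<^sub>L p'"
  shows "n = n'"
proof -
  obtain x y where x: "x \<in> Gr H0 {0<..}" "n = Exp br x" and y: "y \<in> Gr H0 {0<..}" "n' = Exp br y"
    using n unfolding N_group_eq by blast
  have "- y \<in> Gr H0 {0<..}" using y subspace_neg[OF subspace_Gr] by blast
  then obtain z where z: "z \<in> Gr H0 {0<..}" "Exp br (- y) o\<^sub>L Exp br x = Exp br z"
    using Exp_pos_compose[OF _ x(1)] by blast
  obtain h where h: "lowering h" "\<And>u. p (h u) = u"
    using P_group_lowering(2)[OF p(1)] by blast
  have "Exp br z u = (p' o\<^sub>L h) u" for u
  proof -
    have "Exp br x (p (h u)) = Exp br y (p' (h u))"
      using arg_cong[OF eq, of "\<lambda>f. blinfun_apply f (h u)"] by (simp add: x(2) y(2))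
    then show ?thesis by (simp add: h(2) flip: z(2))
  qed
  then have "Exp br z H0 - H0 \<in> Gr H0 {..<0}"
    using lowering_compose[OF P_group_lowering(1)[OF p(2)] h(1)] by (simp add: lowering_def)
  moreover have "Exp br z H0 - H0 \<in> Gr H0 {0<..}"
    using Exp_pos_raise[OF z(1), of H0 0] eigsp_Gr[OF self_in_eigsp[of H0], of "{0..}"] by simp
  ultimately have "Exp br z H0 - H0 = 0" by (rule Gr_disjoint) auto
  then have "Exp br z = id_blinfun"
    using Exp_pos_raise[OF z(1)] by (intro aut_unipotent_eq_id) (simp_all add: eigsp_Gr)
  then have "Exp br (- y) (Exp br x u) = u" for u
    using arg_cong[OF z(2), of "\<lambda>f. blinfun_apply f u"] by simp
  then have "Exp br x u = Exp br y u" for u by (metis Exp_inverse_apply(1))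
  then show ?thesis using x y blinfun_eqI by blast
qed

lemma N_comp_eq:
  assumes "n \<in> N_group br \<aa> \<Sigma>p" "p \<in> P_group br \<theta> \<aa> \<Sigma>p"
  shows "N_comp br \<theta> \<aa> \<Sigma>p (n o\<^sub>L p) = n"
  unfolding N_comp_def using assms NP_unique by (intro the_equality) blast+

end

section \<open>The local action on \<open>N\<close>\<close>

text \<open>
  The right inverse picks preimages of minimal norm; this makes it continuous at \<open>f 0\<close>.
\<close>

lemma local_right_inverse:
  fixes f :: "'a::euclidean_space \<Rightarrow> 'a"
  assumes cont: "continuous_on UNIV f" and der: "(f has_derivative M) (at 0)"
    and G: "linear G" "\<And>x. M (G x) = x" "\<And>x. G (M x) = x"
  obtains g T where "open T" "f 0 \<in> T" "g (f 0) = 0" "\<And>y. y \<in> T \<Longrightarrow> f (g y) = y"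
    "(g has_derivative G) (at (f 0))"
proof -
  have blG: "bounded_linear G" using G(1) by (simp add: linear_conv_bounded_linear)
  have MG: "M \<circ> G = id" and GM: "G \<circ> M = id" using G by (auto simp: fun_eq_iff)
  \<comment> \<open>Continuity together with differentiability at the single point 0, with
    invertible derivative, already makes images of balls neighbourhoods of
    \<open>f 0\<close>.\<close>
  have nbhd: "f 0 \<in> interior (f ` ball 0 e)" if "e > 0" for e
    using sussmann_open_mapping[OF open_UNIV cont UNIV_I der blG MG, of "ball 0 e"] that
    by (simp add: interior_open)
  define T where "T = interior (f ` ball 0 1)"
  have ex: "\<exists>u. f u = y \<and> (\<forall>u'. f u' = y \<longrightarrow> norm u \<le> norm u')" if y: "y \<in> T" for y
  proof -
    let ?S = "{u. f u = y}"
    have "closed ?S"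
      using continuous_closed_preimage_constant[OF cont closed_UNIV, of y] by simp
    have "y \<in> f ` ball 0 1" using subsetD[OF interior_subset y[unfolded T_def]] .
    then obtain u0 where u0: "u0 \<in> ?S" by auto
    obtain u where "u \<in> ?S" "\<And>u'. u' \<in> ?S \<Longrightarrow> dist 0 u \<le> dist 0 u'"
      using distance_attains_inf[OF \<open>closed ?S\<close>, of 0] u0 by blast
    then show ?thesis by (intro exI[of _ u]) simp
  qed
  define g where "g y = (SOME u. f u = y \<and> (\<forall>u'. f u' = y \<longrightarrow> norm u \<le> norm u'))" for y
  have g: "f (g y) = y" "\<And>u'. f u' = y \<Longrightarrow> norm (g y) \<le> norm u'" if "y \<in> T" for y
    using someI_ex[OF ex[OF that]] unfolding g_def by blast+
  have T: "open T" "f 0 \<in> T" using nbhd[of 1] by (simp_all add: T_def)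
  have g0: "g (f 0) = 0" using g(2)[OF T(2), of 0] by simp
  have "continuous (at (f 0)) g"
    unfolding continuous_at Lim_at g0
  proof (intro allI impI)
    fix e :: real assume e: "e > 0"
    have "open (T \<inter> interior (f ` ball 0 e))" "f 0 \<in> T \<inter> interior (f ` ball 0 e)"
      using T nbhd[OF e] by auto
    then obtain d where d: "d > 0" "ball (f 0) d \<subseteq> T \<inter> interior (f ` ball 0 e)"
      using open_contains_ball by blast
    have "dist (g y) 0 < e" if "dist y (f 0) < d" for y
    proof -
      have "y \<in> ball (f 0) d" using that by (simp add: dist_commute)
      then have "y \<in> T" "y \<in> f ` ball 0 e" using d(2) interior_subset by blast+
      then obtain u where "y = f u" "norm u < e" by auto
      then show ?thesis using g(2)[OF \<open>y \<in> T\<close>, of u] by (simp add: dist_norm)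
    qed
    then show "\<exists>d>0. \<forall>x. 0 < dist x (f 0) \<and> dist x (f 0) < d \<longrightarrow> dist (g x) 0 < e"
      using d(1) by blast
  qed
  then have "(g has_derivative G) (at (f 0))"
    by (rule has_derivative_inverse_basic_x[OF der blG GM _ g0 T g(1)])
  then show ?thesis using that T g0 g(1) by blast
qed

section \<open>The chart at H0 and the local factorization of exp(t Y)\<close>

context regular_data
begin

definition n_part :: "'g \<Rightarrow> 'g" where
  "n_part v = (\<Sum>\<alpha>\<in>\<Sigma>p. kill v (X (- \<alpha>)) *\<^sub>R X \<alpha>)"

lemma finite_pos: "finite \<Sigma>p"
  using finite_roots by (simp add: pos_eq)

lemma linear_n_part: "linear n_part"
  unfolding n_part_def
  by (rule linearI) (simp_all add: kill.add_left kill.scaleR_left scaleR_add_left sum.distrib scaleR_sum_right)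

lemma n_part_pos: "n_part v \<in> Gr H0 {0<..}"
  unfolding n_part_def
  by (intro subspace_sum subspace_scale subspace_Gr eigsp_Gr[OF X_eigsp[OF H0_a]]) (auto simp: pos_eq)

lemma minus_n_part: "v - n_part v = a_part v + (\<Sum>\<alpha>\<in>R - \<Sigma>p. kill v (X (- \<alpha>)) *\<^sub>R X \<alpha>)"
proof -
  have "(\<Sum>\<alpha>\<in>R. kill v (X (- \<alpha>)) *\<^sub>R X \<alpha>) =
      (\<Sum>\<alpha>\<in>R - \<Sigma>p. kill v (X (- \<alpha>)) *\<^sub>R X \<alpha>) + n_part v"
    unfolding n_part_def by (rule sum.subset_diff) (use finite_roots in \<open>auto simp: pos_eq\<close>)
  then show ?thesis using root_decomposition[of v] by (simp add: algebra_simps)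
qed

lemma nbar_part: "(\<Sum>\<alpha>\<in>R - \<Sigma>p. kill v (X (- \<alpha>)) *\<^sub>R X \<alpha>) \<in> Gr H0 {..<0}"
proof (intro subspace_sum subspace_scale subspace_Gr)
  fix \<alpha> assume "\<alpha> \<in> R - \<Sigma>p"
  then have "\<alpha> \<in> R" "\<alpha> H0 < 0" using H0_nonzero[of \<alpha>] by (auto simp: pos_eq)
  then show "X \<alpha> \<in> Gr H0 {..<0}" by (intro eigsp_Gr[OF X_eigsp[OF H0_a]]) auto
qed

lemma minus_n_part_nonpos: "v - n_part v \<in> Gr H0 {..0}"
proof -
  have "a_part v \<in> Gr H0 {..0}" using eigsp_Gr[OF a_eigsp[OF H0_a a_part_in_a], of "{..0}"] by simp
  moreover have "(\<Sum>\<alpha>\<in>R - \<Sigma>p. kill v (X (- \<alpha>)) *\<^sub>R X \<alpha>) \<in> Gr H0 {..0}"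
    by (rule Gr_mono[OF _ nbar_part]) auto
  ultimately show ?thesis unfolding minus_n_part by (rule subspace_add[OF subspace_Gr])
qed

lemma pos_centralizer: assumes "v \<in> Gr H0 {0<..}" "br v H0 = 0" shows "v = 0"
proof -
  have "v \<in> eigsp H0 0" using assms(2) br_skew[of H0 v] by (simp add: eigsp_def)
  then show ?thesis using assms(1) by (intro Gr_disjoint[of v "{0}" "{0<..}"]) (auto simp: Gr_singleton)
qed

lemma br_H0_Gr: "v \<in> Gr H0 D \<Longrightarrow> br v H0 \<in> Gr H0 D"
proof -
  have "H0 \<in> Gr H0 {0}" by (simp add: Gr_singleton self_in_eigsp)
  then show "br v H0 \<in> Gr H0 D" if "v \<in> Gr H0 D" by (rule br_Gr[OF that]) auto
qed

text \<open>One vector u carries both arguments of (x, y) -> exp(x) (H0 + y): x is its positive part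
  and y the rest. Domain and range are then the same space, as \<open>local_right_inverse\<close>
  requires.\<close>

definition chart :: "'g \<Rightarrow> 'g" where
  "chart u = Exp br (n_part u) (H0 + (u - n_part u))"

text \<open>The differential of \<open>chart\<close> at 0: the identity on the nonpositive degrees
  and -ad H0 on the positive ones.\<close>

definition chart' :: "'g \<Rightarrow> 'g" where
  "chart' u = u - n_part u + br (n_part u) H0"

lemma chart_0: "chart 0 = H0"
  by (simp add: chart_def linear_0[OF linear_n_part])

lemma bounded_linear_n_part: "bounded_linear n_part"
  using linear_n_part by (simp add: linear_conv_bounded_linear)

lemma continuous_chart: "continuous_on UNIV chart"
  unfolding chart_def
  by (intro blinfun.continuous_on continuous_on_compose2[OF continuous_on_Exp] continuous_on_add
      continuous_on_diff continuous_on_const continuous_on_id linear_continuous_on[OF bounded_linear_n_part])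
    simp

lemma has_derivative_chart: "(chart has_derivative chart') (at 0)"
proof -
  have "(n_part has_derivative n_part) (at 0)"
    by (rule bounded_linear_imp_has_derivative[OF bounded_linear_n_part])
  moreover have "(Exp br has_derivative ad br) (at (n_part 0))"
    using has_derivative_Exp_0 by (simp add: linear_0[OF linear_n_part])
  ultimately have "((\<lambda>u. Exp br (n_part u)) has_derivative (\<lambda>u. ad br (n_part u))) (at 0)"
    by (rule has_derivative_compose)
  moreover have "((\<lambda>u. H0 + (u - n_part u)) has_derivative (\<lambda>u. u - n_part u)) (at 0)"
    using has_derivative_add[OF has_derivative_const
        has_derivative_diff[OF has_derivative_ident bounded_linear_imp_has_derivative[OF bounded_linear_n_part]]]
    by simp
  ultimately have "((\<lambda>u. Exp br (n_part u) (H0 + (u - n_part u))) has_derivative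
      (\<lambda>u. Exp br (n_part 0) (u - n_part u) + ad br (n_part u) (H0 + (0 - n_part 0)))) (at 0)"
    by (rule blinfun.FDERIV)
  then show ?thesis
    unfolding chart_def[abs_def] chart'_def[abs_def]
    by (simp add: linear_0[OF linear_n_part])
qed

lemma linear_chart': "linear chart'"
  unfolding chart'_def
  by (rule linearI)
    (simp_all add: linear_add[OF linear_n_part] linear_scale[OF linear_n_part] br.add_left br.scaleR_left
      algebra_simps)

text \<open>Compares positive degrees, on which ad H0 is injective. With Y = 0 it gives injectivity
  of the differential; for general Y it identifies the positive part of the velocity of exp(t Y) H0
  in the chart.\<close>

lemma chart'_eqD:
  assumes "chart' z = br Y H0"
  shows "n_part z = n_part Y"
proof -
  have "br (n_part z - n_part Y) H0 = br (Y - n_part Y) H0 - (z - n_part z)"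
    using assms unfolding chart'_def br.diff_left by (simp add: algebra_simps)
  moreover have "br (Y - n_part Y) H0 - (z - n_part z) \<in> Gr H0 {..0}"
    by (intro subspace_diff[OF subspace_Gr] br_H0_Gr minus_n_part_nonpos)
  moreover have np: "n_part z - n_part Y \<in> Gr H0 {0<..}"
    by (intro subspace_diff[OF subspace_Gr] n_part_pos)
  then have "br (n_part z - n_part Y) H0 \<in> Gr H0 {0<..}" by (rule br_H0_Gr)
  ultimately have "br (n_part z - n_part Y) H0 = 0"
    by (intro Gr_disjoint[of _ "{0<..}" "{..0}"]) auto
  then show ?thesis using pos_centralizer[OF np] by simp
qed

lemma chart'_inverse:
  obtains G where "linear G" "\<And>x. chart' (G x) = x" "\<And>x. G (chart' x) = x"
proof -
  have "u = 0" if u: "chart' u = 0" for u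
  proof -
    have "n_part u = 0"
      using chart'_eqD[of u 0] u by (simp add: br.zero_left linear_0[OF linear_n_part])
    then show ?thesis using u by (simp add: chart'_def br.zero_left)
  qed
  then have "inj chart'" using linear_chart' by (simp add: linear_injective_0)
  then show ?thesis using linear_injective_isomorphism[OF linear_chart'] that by blast
qed

text \<open>
  The lowest component of the functional \<open>B(u, \<cdot>)\<close>, where \<open>u = g X\<^sub>\<alpha>\<close>, exhibits \<open>\<alpha> H\<^sub>0\<close> as
  a diagonal entry of the triangular operator \<open>ad (H\<^sub>0 + h + z)\<close>.
\<close>

lemma triangular_eigenvalue:
  assumes g: "aut g" "g H0 = H0 + h + z" and h: "h \<in> \<aa>" and z: "z \<in> Gr H0 {..<0}"
    and \<alpha>: "\<alpha> \<in> R"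
  shows "\<exists>\<gamma>\<in>R. \<gamma> (H0 + h) = \<alpha> H0"
proof -
  define u where "u = g (X \<alpha>)"
  obtain g' :: "'g \<Rightarrow>\<^sub>L 'g" where g': "\<And>x. g' (g x) = x" using aut_inverse[OF g(1)] by blast
  have "u \<noteq> 0"
  proof
    assume "u = 0"
    then show False using g'[of "X \<alpha>"] X_nonzero[OF \<alpha>] by (simp add: u_def blinfun.zero_right)
  qed
  have bru: "br (H0 + h + z) u = \<alpha> H0 *\<^sub>R u"
    unfolding u_def g(2)[symmetric] aut_br[OF g(1), symmetric] br_a_X[OF H0_a \<alpha>]
    by (rule blinfun.scaleR_right)
  define A where "A = {d. \<exists>y\<in>eigsp H0 d. kill u y \<noteq> 0}"
  have "A \<subseteq> {c. eigsp H0 c \<noteq> {0}}"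
  proof
    fix e assume "e \<in> A"
    then obtain y where y: "y \<in> eigsp H0 e" "kill u y \<noteq> 0" by (auto simp: A_def)
    then have "y \<noteq> 0" using kill.zero_right by metis
    then show "e \<in> {c. eigsp H0 c \<noteq> {0}}" using y(1) by blast
  qed
  then have finA: "finite A" using finite_eigenvalues finite_subset by blast
  have "A \<noteq> {}"
  proof
    assume "A = {}"
    then have "u \<in> Gr H0 {}" unfolding Gr_iff by (auto simp: A_def)
    with \<open>u \<noteq> 0\<close> show False by (simp add: Gr_def)
  qed
  \<comment> \<open>In the lowest degree in which B(u, .) is nonzero, the part z drops out: [z, y]
    has smaller degree and is annihilated.\<close>
  define d where "d = Min A"
  have "d \<in> A" and dmin: "\<And>e. e \<in> A \<Longrightarrow> d \<le> e"
    using finA \<open>A \<noteq> {}\<close> by (simp_all add: d_def)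
  then obtain y where y: "y \<in> eigsp H0 d" "kill u y \<noteq> 0" by (auto simp: A_def)
  have "y \<in> Gr H0 {d}" using y(1) by (simp add: Gr_singleton)
  then have zy: "br z y \<in> Gr H0 {..<d}" by (rule br_Gr[OF z]) auto
  have "br z y \<in> {v. kill u v = 0}"
  proof (rule Gr_subsetI[OF _ _ zy])
    show "subspace {v. kill u v = 0}"
      by (auto simp: subspace_def kill.zero_right kill.add_right kill.scaleR_right)
    show "v \<in> {v. kill u v = 0}" if "e \<in> {..<d}" "v \<in> eigsp H0 e" for e v
      using dmin[of e] that by (auto simp: A_def)
  qed
  then have uzy: "kill u (br z y) = 0" by simp
  have eq: "\<alpha> H0 * kill u y = - kill u (br (H0 + h) y)"
  proof -
    have "\<alpha> H0 * kill u y = kill (br (H0 + h + z) u) y"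
      by (simp add: bru kill.scaleR_left)
    also have "\<dots> = - kill u (br (H0 + h + z) y)"
      using kill_br_right[of u "H0 + h + z" y] by simp
    also have "\<dots> = - kill u (br (H0 + h) y)"
      using uzy by (simp add: br.add_left[of "H0 + h" z] kill.add_right)
    finally show ?thesis .
  qed
  have H0h: "H0 + h \<in> \<aa>" using H0_a h subspace_add[OF subspace_a] by blast
  have "y \<noteq> 0" using y(2) by (auto simp: kill.zero_right)
  then consider "d = 0" | \<gamma> where "\<gamma> \<in> R" "d = \<gamma> H0"
    using eigsp_nonzero[OF H0_a y(1)] by blast
  then show ?thesis
  proof cases
    case 1
    then have "br (H0 + h) y = 0" using y(1) eigsp_0 a_abelian[OF H0h] by blast
    then show ?thesis using eq y(2) H0_nonzero[OF \<alpha>] by (simp add: kill.zero_right)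
  next
    case (2 \<gamma>)
    then have "y \<in> span {X \<gamma>}" using y(1) eigsp_root by simp
    then have "br (H0 + h) y = \<gamma> (H0 + h) *\<^sub>R y"
      using root_space_eq[OF 2(1)] root_spaceD[OF _ H0h] by blast
    then have "\<alpha> H0 * kill u y = (- \<gamma>) (H0 + h) * kill u y" using eq by (simp add: kill.scaleR_right)
    then have "(- \<gamma>) (H0 + h) = \<alpha> H0" by (simp only: mult_right_cancel[OF y(2)])
    then show ?thesis using uminus_root[OF 2(1)] by blast
  qed
qed

text \<open>For small h the values \<gamma>(H0 + h) stay away from \<alpha>(H0) unless \<gamma> =
  \<alpha>. So the root found by \<open>triangular_eigenvalue\<close> is \<alpha> itself, which says
  \<alpha>(h) = 0 for every root. The quantifiers over g and z stand inside the filter because g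
  will depend on the parameter t.\<close>

lemma eventually_fix_H0:
  assumes tend: "(h \<longlongrightarrow> 0) F" and h: "\<And>t. h t \<in> \<aa>"
  shows "\<forall>\<^sub>F t in F. \<forall>g z. aut g \<and> g H0 = H0 + h t + z \<and> z \<in> Gr H0 {..<0} \<longrightarrow> h t = 0"
proof -
  have "\<forall>\<^sub>F t in F. \<gamma> (h t) \<noteq> \<alpha> H0 - \<gamma> H0" if "\<alpha> \<in> R" "\<gamma> \<in> R" "\<gamma> \<noteq> \<alpha>" for \<alpha> \<gamma>
  proof -
    have "\<gamma> (h t) = kill (h t) (Hvec \<gamma>)" for t using kill_Hvec[OF that(2) h] by simp
    moreover have "((\<lambda>t. kill (h t) (Hvec \<gamma>)) \<longlongrightarrow> kill 0 (Hvec \<gamma>)) F"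
      by (rule kill.tendsto[OF tend tendsto_const])
    ultimately have "((\<lambda>t. \<gamma> (h t)) \<longlongrightarrow> 0) F" by (simp add: kill.zero_left)
    moreover have "\<alpha> H0 - \<gamma> H0 \<noteq> 0" using H0_inj[OF that(1,2)] that(3) by auto
    ultimately show ?thesis by (intro tendsto_imp_eventually_ne) auto
  qed
  then have "\<forall>\<^sub>F t in F. \<forall>\<alpha>\<in>R. \<forall>\<gamma>\<in>R. \<gamma> \<noteq> \<alpha> \<longrightarrow> \<gamma> (h t) \<noteq> \<alpha> H0 - \<gamma> H0"
    using finite_roots by (intro eventually_ball_finite ballI) (auto simp: eventually_conj_iff)
  then show ?thesis
  proof eventually_elim
    case (elim t)
    show ?case
    proof (intro allI impI, elim conjE)
      fix g z assume g: "aut g" "g H0 = H0 + h t + z" "z \<in> Gr H0 {..<0}"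
      show "h t = 0"
      proof (rule a_eqI[OF h subspace_0[OF subspace_a]])
        fix \<alpha> assume \<alpha>: "\<alpha> \<in> R"
        obtain \<gamma> where \<gamma>: "\<gamma> \<in> R" "\<gamma> (H0 + h t) = \<alpha> H0"
          using triangular_eigenvalue[OF g(1,2) h g(3) \<alpha>] by blast
        then have "\<gamma> (h t) = \<alpha> H0 - \<gamma> H0" using root_add[OF \<gamma>(1) H0_a h] by simp
        then have "\<gamma> = \<alpha>" using elim \<alpha> \<gamma>(1) by blast
        then have "\<alpha> (h t) = 0" using \<open>\<gamma> (h t) = \<alpha> H0 - \<gamma> H0\<close> by simp
        moreover have "\<alpha> 0 = 0" using root_scale[OF \<alpha> H0_a, of 0] by simp
        ultimately show "\<alpha> (h t) = \<alpha> 0" by simp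
      qed
    qed
  qed
qed


text \<open>x is the positive part of the chart coordinate of exp(t Y) H0. The other factor exp(-x)
  exp(t Y) sends H0 to H0 + h + z; the spectrum forces h = 0, and convergence to the identity makes
  the diagonal entries positive, so \<open>in_P_groupI\<close> applies.\<close>

lemma Exp_factorization:
  obtains x where "(x has_vector_derivative n_part Y) (at 0)" "x 0 = 0" "\<And>t. x t \<in> Gr H0 {0<..}"
    "\<forall>\<^sub>F t in nhds 0. Exp br (- x t) o\<^sub>L Exp br (t *\<^sub>R Y) \<in> P_group br \<theta> \<aa> \<Sigma>p"
proof -
  obtain G where G: "linear G" "\<And>x. chart' (G x) = x" "\<And>x. G (chart' x) = x"
    using chart'_inverse by blast
  obtain g T where T: "open T" "H0 \<in> T" and g0: "g H0 = 0" and g: "\<And>y. y \<in> T \<Longrightarrow> chart (g y) = y"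
    and dg: "(g has_derivative G) (at H0)"
    by (rule local_right_inverse[OF continuous_chart has_derivative_chart G, unfolded chart_0]) blast
  define w where "w t = Exp br (t *\<^sub>R Y) H0" for t
  have w0: "w 0 = H0" by (simp add: w_def)
  have dExp: "((\<lambda>t. Exp br (t *\<^sub>R Y)) has_vector_derivative ad br Y) (at 0)"
  proof -
    have "ad br Y o\<^sub>L id_blinfun = ad br Y" by (rule blinfun_eqI) simp
    then show ?thesis using Exp_scaleR_has_vector_derivative[of Y 0] by simp
  qed
  have dw: "(w has_vector_derivative br Y H0) (at 0)"
    unfolding w_def using bounded_linear.has_vector_derivative[OF blinfun.bounded_linear_left dExp, of H0]
    by simp
  define u where "u t = g (w t)" for t
  have du: "(u has_vector_derivative G (br Y H0)) (at 0)"
  proof -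
    have "((\<lambda>t. g (w t)) has_derivative (\<lambda>t. G (t *\<^sub>R br Y H0))) (at 0)"
      using has_derivative_compose[of w "\<lambda>t. t *\<^sub>R br Y H0" 0 UNIV g G] dw dg
      by (simp add: has_vector_derivative_def w0)
    then show ?thesis
      by (simp add: has_vector_derivative_def u_def[abs_def] linear_scale[OF G(1)])
  qed
  have u0: "u 0 = 0" by (simp add: u_def w0 g0)
  define x where "x t = n_part (u t)" for t
  have "n_part (G (br Y H0)) = n_part Y" by (rule chart'_eqD) (rule G(2))
  then have dx: "(x has_vector_derivative n_part Y) (at 0)"
    using bounded_linear.has_vector_derivative[OF bounded_linear_n_part du] by (simp add: x_def[abs_def])
  have x0: "x 0 = 0" by (simp add: x_def u0 linear_0[OF linear_n_part])
  \<comment> \<open>Limits are taken along \<open>nhds 0\<close>, which includes t = 0: derivatives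
    at 0 are later transferred between functions that must agree there as well.\<close>
  have tend: "(f \<longlongrightarrow> f 0) (nhds 0)" if "(f has_vector_derivative f') (at 0)" for f :: "real \<Rightarrow> 'b::real_normed_vector" and f'
    using has_vector_derivative_continuous[OF that] tendsto_nhds_iff by (auto simp: continuous_at)
  have w_ev: "\<forall>\<^sub>F t in nhds 0. w t \<in> T"
    using topological_tendstoD[OF tend[OF dw] T(1)] w0 T(2) by simp
  define L where "L t = Exp br (- x t) o\<^sub>L Exp br (t *\<^sub>R Y)" for t
  have L_aut: "aut (L t)" for t by (simp add: L_def aut_compose)
  define z where "z t = (\<Sum>\<alpha>\<in>R - \<Sigma>p. kill (u t) (X (- \<alpha>)) *\<^sub>R X \<alpha>)" for t
  have LH0: "L t H0 = H0 + a_part (u t) + z t" if "w t \<in> T" for t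
  proof -
    have "w t = Exp br (x t) (H0 + (u t - n_part (u t)))"
      using g[OF that] by (simp add: u_def x_def chart_def)
    then show ?thesis by (simp add: L_def minus_n_part z_def add.assoc flip: w_def)
  qed
  have "((\<lambda>t. a_part (u t)) \<longlongrightarrow> a_part 0) (nhds 0)"
    using bounded_linear.tendsto[of a_part u 0 "nhds 0"] tend[OF du] linear_a_part
    by (simp add: linear_conv_bounded_linear u0)
  then have "((\<lambda>t. a_part (u t)) \<longlongrightarrow> 0) (nhds 0)" by (simp add: linear_0[OF linear_a_part])
  then have ev1: "\<forall>\<^sub>F t in nhds 0. \<forall>g z. aut g \<and> g H0 = H0 + a_part (u t) + z \<and> z \<in> Gr H0 {..<0} \<longrightarrow> a_part (u t) = 0"
    by (rule eventually_fix_H0) (rule a_part_in_a)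
  have tendL: "((\<lambda>t. L t v) \<longlongrightarrow> v) (nhds 0)" for v
  proof -
    have "((\<lambda>t. Exp br (- x t)) \<longlongrightarrow> Exp br (- 0)) (nhds 0)"
      using tendsto_minus[OF tend[OF dx]] x0
      by (intro continuous_on_tendsto_compose[OF continuous_on_Exp]) auto
    moreover have "((\<lambda>t. Exp br (t *\<^sub>R Y)) \<longlongrightarrow> id_blinfun) (nhds 0)"
      using tend[OF dExp] by simp
    ultimately have "((\<lambda>t. Exp br (- x t) (Exp br (t *\<^sub>R Y) v)) \<longlongrightarrow> Exp br (- 0) (id_blinfun v)) (nhds 0)"
      by (intro blinfun.tendsto tendsto_const)
    then show ?thesis by (simp add: L_def)
  qed
  have "\<forall>\<^sub>F t in nhds 0. kill (L t (X \<alpha>)) (X (- \<alpha>)) > 0" if "\<alpha> \<in> R" for \<alpha>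
  proof -
    have "((\<lambda>t. kill (L t (X \<alpha>)) (X (- \<alpha>))) \<longlongrightarrow> kill (X \<alpha>) (X (- \<alpha>))) (nhds 0)"
      by (intro kill.tendsto tendL tendsto_const)
    then show ?thesis by (rule order_tendstoD(1)) (simp add: that)
  qed
  then have ev2: "\<forall>\<^sub>F t in nhds 0. \<forall>\<alpha>\<in>R. kill (L t (X \<alpha>)) (X (- \<alpha>)) > 0"
    using finite_roots by (intro eventually_ball_finite ballI)
  have "\<forall>\<^sub>F t in nhds 0. L t \<in> P_group br \<theta> \<aa> \<Sigma>p"
    using w_ev ev1 ev2
  proof eventually_elim
    case (elim t)
    have zt: "z t \<in> Gr H0 {..<0}" unfolding z_def by (rule nbar_part)
    then have "a_part (u t) = 0" using elim(2) LH0[OF elim(1)] L_aut by blast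
    then have "L t H0 - H0 \<in> Gr H0 {..<0}" using zt LH0[OF elim(1)] by simp
    then show ?case using elim(3) by (intro in_P_groupI L_aut) auto
  qed
  then show ?thesis
    using that[of x] dx x0 n_part_pos by (simp add: L_def x_def)
qed

end

section \<open>The vector fields in the left-invariant frame\<close>

text \<open>The constant k makes the class closed under directional derivatives, which for a linear
  function are constants; so it can serve as coinduction invariant.\<close>

lemma smooth_fun_affine:
  fixes l :: "'v::real_normed_vector \<Rightarrow> real"
  assumes "bounded_linear l"
  shows "smooth_fun (\<lambda>x. l x + k)"
proof (rule smooth_fun.coinduct[of "\<lambda>f. \<exists>l k. bounded_linear l \<and> f = (\<lambda>x. l x + k)"])
  show "\<exists>l' k'. bounded_linear l' \<and> (\<lambda>x. l x + k) = (\<lambda>x. l' x + k')"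
    by (intro exI[of _ l] exI[of _ k]) (simp add: assms)
  fix f :: "'v \<Rightarrow> real"
  assume "\<exists>l k. bounded_linear l \<and> f = (\<lambda>x. l x + k)"
  then obtain l k where l: "bounded_linear l" and f: "f = (\<lambda>x. l x + k)" by blast
  have "(f has_derivative l) (at x)" for x
    unfolding f using has_derivative_add[OF bounded_linear_imp_has_derivative[OF l] has_derivative_const] by simp
  moreover have "\<exists>l' k'. bounded_linear l' \<and> (\<lambda>x. l v) = (\<lambda>x. l' x + k')" for v
    by (intro exI[of _ "\<lambda>_. 0"] exI[of _ "l v"]) (simp add: bounded_linear_zero)
  ultimately show "\<exists>g f'. f = g \<and> (\<forall>x. (g has_derivative f' x) (at x)) \<and>
      (\<forall>v. (\<exists>l k. bounded_linear l \<and> (\<lambda>x. f' x v) = (\<lambda>x. l x + k)) \<or> smooth_fun (\<lambda>x. f' x v))"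
    by (intro exI[of _ f] exI[of _ "\<lambda>_. l"]) blast
qed

context regular_data
begin

lemma deriv_along_curve:
  assumes F: "(F has_derivative F') (at n)" and x: "(x has_vector_derivative v) (at 0)" "x 0 = 0"
    and ev: "\<forall>\<^sub>F t in nhds 0. c t = F (n o\<^sub>L Exp br (x t))"
  shows "deriv c 0 = F' (n o\<^sub>L ad br v)"
proof -
  have "((\<lambda>t. Exp br (x t)) has_derivative (\<lambda>t. ad br (t *\<^sub>R v))) (at 0)"
    using has_derivative_compose[of x "\<lambda>t. t *\<^sub>R v" 0 UNIV "Exp br" "ad br"] x has_derivative_Exp_0
    by (simp add: has_vector_derivative_def)
  then have "((\<lambda>t. n o\<^sub>L Exp br (x t)) has_derivative (\<lambda>t. n o\<^sub>L ad br (t *\<^sub>R v))) (at 0)"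
    by (rule bounded_linear.has_derivative[OF bounded_bilinear.bounded_linear_right[OF bounded_bilinear_blinfun_compose]])
  moreover have "n o\<^sub>L Exp br (x 0) = n" by (rule blinfun_eqI) (simp add: x(2))
  ultimately have "((\<lambda>t. F (n o\<^sub>L Exp br (x t))) has_derivative (\<lambda>t. F' (n o\<^sub>L ad br (t *\<^sub>R v)))) (at 0)"
    using has_derivative_compose[of "\<lambda>t. n o\<^sub>L Exp br (x t)" _ 0 UNIV F F'] F by simp
  moreover have "F' (n o\<^sub>L ad br (t *\<^sub>R v)) = F' (n o\<^sub>L ad br v) * t" for t
    by (simp add: ad_scaleR linear_scale[OF has_derivative_linear[OF F]]
        bounded_bilinear.scaleR_right[OF bounded_bilinear_blinfun_compose])
  ultimately have "((\<lambda>t. F (n o\<^sub>L Exp br (x t))) has_field_derivative F' (n o\<^sub>L ad br v)) (at 0)"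
    by (simp add: has_field_derivative_def)
  then have "(c has_field_derivative F' (n o\<^sub>L ad br v)) (at 0)"
    using DERIV_cong_ev[OF refl ev refl] by blast
  then show ?thesis by (rule DERIV_imp_deriv)
qed

text \<open>\<open>f\<close> agrees with the differentiable extension \<open>F\<close> only on N, so
  the factorization must supply a curve that stays in N.\<close>

lemma tau_eq:
  assumes n: "n \<in> N_group br \<aa> \<Sigma>p" and h: "\<And>x. n (h x) = x"
    and F: "(F has_derivative F') (at n)" and f: "\<And>n. n \<in> N_group br \<aa> \<Sigma>p \<Longrightarrow> f n = F n"
  shows "tau br \<theta> \<aa> \<Sigma>p U f n = F' (n o\<^sub>L ad br (n_part (h U)))"
proof -
  obtain x where x: "(x has_vector_derivative n_part (h U)) (at 0)" "x 0 = 0" "\<And>t. x t \<in> Gr H0 {0<..}"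
    and ev: "\<forall>\<^sub>F t in nhds 0. Exp br (- x t) o\<^sub>L Exp br (t *\<^sub>R h U) \<in> P_group br \<theta> \<aa> \<Sigma>p"
    using Exp_factorization[of "h U"] by blast
  have N: "n o\<^sub>L Exp br (x t) \<in> N_group br \<aa> \<Sigma>p" for t
    using N_group_compose[OF n] x(3) by (simp add: N_group_eq)
  have "\<forall>\<^sub>F t in nhds 0. f (N_comp br \<theta> \<aa> \<Sigma>p (Exp br (t *\<^sub>R U) o\<^sub>L n)) = F (n o\<^sub>L Exp br (x t))"
    using ev
  proof eventually_elim
    case (elim t)
    have "Exp br (t *\<^sub>R U) o\<^sub>L n = (n o\<^sub>L Exp br (x t)) o\<^sub>L (Exp br (- x t) o\<^sub>L Exp br (t *\<^sub>R h U))"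
      by (rule blinfun_eqI)
        (simp add: aut_Exp_conj[OF N_group_aut[OF n]] blinfun.scaleR_right h)
    then show ?case using N_comp_eq[OF N elim] f[OF N] by simp
  qed
  then show ?thesis unfolding tau_def by (rule deriv_along_curve[OF F x(1,2)])
qed

lemma left_inv_eq:
  assumes n: "n \<in> N_group br \<aa> \<Sigma>p" and V: "V \<in> Gr H0 {0<..}"
    and F: "(F has_derivative F') (at n)" and f: "\<And>n. n \<in> N_group br \<aa> \<Sigma>p \<Longrightarrow> f n = F n"
  shows "left_inv br V f n = F' (n o\<^sub>L ad br V)"
  unfolding left_inv_def
proof (rule deriv_along_curve[OF F])
  show "((\<lambda>t. t *\<^sub>R V) has_vector_derivative V) (at 0)"
    by (auto intro!: derivative_eq_intros simp: has_vector_derivative_def)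
  have "n o\<^sub>L Exp br (t *\<^sub>R V) \<in> N_group br \<aa> \<Sigma>p" for t
    using N_group_compose[OF n] subspace_scale[OF subspace_Gr V] by (simp add: N_group_eq)
  then show "\<forall>\<^sub>F t in nhds 0. f (n o\<^sub>L Exp br (t *\<^sub>R V)) = F (n o\<^sub>L Exp br (t *\<^sub>R V))"
    using f by simp
qed simp

lemma X_pos: "\<beta> \<in> \<Sigma>p \<Longrightarrow> X \<beta> \<in> Gr H0 {0<..}"
  by (rule eigsp_Gr[OF X_eigsp[OF H0_a]]) (auto simp: pos_eq)

lemma linear_compose_ad: "linear (\<lambda>v. n o\<^sub>L ad br v)"
  by (intro bounded_linear.linear bounded_linear_compose[OF _ bounded_linear_ad]
      bounded_bilinear.bounded_linear_right[OF bounded_bilinear_blinfun_compose])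

text \<open>For uniqueness the fields are tested on matrix coefficients, which are restrictions of
  linear functions. They recover n (ad s), hence ad s, hence s since the centre is trivial; pairing
  s with X_-\<gamma> then gives each coefficient.\<close>

lemma frame_coeffs_eq:
  assumes n: "n \<in> N_group br \<aa> \<Sigma>p" and h: "\<And>x. n (h x) = x" "\<And>x. h (n x) = x"
  shows "frame_coeffs br \<theta> \<aa> \<Sigma>p X U n = (\<lambda>\<beta>. if \<beta> \<in> \<Sigma>p then kill (h U) (X (- \<beta>)) else 0)"
    (is "_ = ?c")
  unfolding frame_coeffs_def
proof (rule the_equality)
  have "tau br \<theta> \<aa> \<Sigma>p U f n = (\<Sum>\<beta>\<in>\<Sigma>p. ?c \<beta> * left_inv br (X \<beta>) f n)" if "smooth_on_N br \<aa> \<Sigma>p f" for f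
  proof -
    obtain F where F: "smooth_fun F" "\<And>n. n \<in> N_group br \<aa> \<Sigma>p \<Longrightarrow> f n = F n"
      using \<open>smooth_on_N br \<aa> \<Sigma>p f\<close> by (auto simp: smooth_on_N_def)
    obtain F' where F': "(F has_derivative F') (at n)"
      using F(1) by (cases rule: smooth_fun.cases) blast
    have linF': "linear (\<lambda>v. F' (n o\<^sub>L ad br v))"
      using linear_compose[OF linear_compose_ad has_derivative_linear[OF F']] by (simp add: o_def)
    have "tau br \<theta> \<aa> \<Sigma>p U f n = F' (n o\<^sub>L ad br (n_part (h U)))"
      by (rule tau_eq[OF n h(1) F' F(2)])
    also have "\<dots> = (\<Sum>\<beta>\<in>\<Sigma>p. kill (h U) (X (- \<beta>)) * F' (n o\<^sub>L ad br (X \<beta>)))"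
      unfolding n_part_def by (simp add: linear_sum[OF linF'] linear_scale[OF linF'])
    also have "\<dots> = (\<Sum>\<beta>\<in>\<Sigma>p. ?c \<beta> * left_inv br (X \<beta>) f n)"
      using left_inv_eq[OF n X_pos F' F(2)] by (intro sum.cong) auto
    finally show ?thesis .
  qed
  then show "(\<forall>\<beta>. \<beta> \<notin> \<Sigma>p \<longrightarrow> ?c \<beta> = 0) \<and> (\<forall>f. smooth_on_N br \<aa> \<Sigma>p f \<longrightarrow>
      tau br \<theta> \<aa> \<Sigma>p U f n = (\<Sum>\<beta>\<in>\<Sigma>p. ?c \<beta> * left_inv br (X \<beta>) f n))"
    by auto
  fix c
  assume c: "(\<forall>\<beta>. \<beta> \<notin> \<Sigma>p \<longrightarrow> c \<beta> = 0) \<and> (\<forall>f. smooth_on_N br \<aa> \<Sigma>p f \<longrightarrow>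
      tau br \<theta> \<aa> \<Sigma>p U f n = (\<Sum>\<beta>\<in>\<Sigma>p. c \<beta> * left_inv br (X \<beta>) f n))"
  define s where "s = (\<Sum>\<beta>\<in>\<Sigma>p. c \<beta> *\<^sub>R X \<beta>)"
  have "br s y = br (n_part (h U)) y" for y
  proof -
    have "n (br (n_part (h U)) y) \<bullet> b = n (br s y) \<bullet> b" for b
    proof -
      define F where "F T = blinfun_apply T y \<bullet> b" for T :: "'g \<Rightarrow>\<^sub>L 'g"
      have bl: "bounded_linear F"
        unfolding F_def
        by (rule bounded_linear_compose[OF bounded_linear_inner_left blinfun.bounded_linear_left])
      then have "smooth_fun F" using smooth_fun_affine[of F 0] by simp
      then have sm: "smooth_on_N br \<aa> \<Sigma>p F" by (auto simp: smooth_on_N_def)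
      have dF: "(F has_derivative F) (at n)" by (rule bounded_linear_imp_has_derivative[OF bl])
      have "F (n o\<^sub>L ad br (n_part (h U))) = tau br \<theta> \<aa> \<Sigma>p U F n"
        by (rule tau_eq[OF n h(1) dF refl, symmetric])
      also have "\<dots> = (\<Sum>\<beta>\<in>\<Sigma>p. c \<beta> * left_inv br (X \<beta>) F n)" using c sm by blast
      also have "\<dots> = (\<Sum>\<beta>\<in>\<Sigma>p. c \<beta> * F (n o\<^sub>L ad br (X \<beta>)))"
        by (intro sum.cong refl arg_cong2[of _ _ _ _ "(*)"] left_inv_eq[OF n X_pos dF])
      also have "\<dots> = F (n o\<^sub>L ad br s)"
        unfolding s_def linear_sum[OF linear_compose_ad] linear_scale[OF linear_compose_ad]
        by (simp add: bounded_linear.linear[OF bl] linear_sum linear_scale)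
      finally show ?thesis by (simp add: F_def)
    qed
    then have "n (br (n_part (h U)) y) = n (br s y)" by (rule euclidean_eqI)
    then have "h (n (br (n_part (h U)) y)) = h (n (br s y))" by (rule arg_cong)
    then show ?thesis by (simp only: h(2))
  qed
  then have "br (s - n_part (h U)) y = 0" for y by (simp add: br.diff_left)
  then have s: "s = n_part (h U)" using center_trivial[of "s - n_part (h U)"] by simp
  have pick: "kill (\<Sum>\<beta>\<in>\<Sigma>p. c \<beta> *\<^sub>R X \<beta>) (X (- \<gamma>)) = c \<gamma>" if "\<gamma> \<in> \<Sigma>p" for c \<gamma>
  proof -
    have "kill (\<Sum>\<beta>\<in>\<Sigma>p. c \<beta> *\<^sub>R X \<beta>) (X (- \<gamma>)) = (\<Sum>\<beta>\<in>\<Sigma>p. c \<beta> * kill (X \<beta>) (X (- \<gamma>)))"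
      by (simp add: kill.sum_left kill.scaleR_left)
    also have "\<dots> = (\<Sum>\<beta>\<in>\<Sigma>p. if \<beta> = \<gamma> then c \<beta> else 0)"
      using that by (intro sum.cong refl) (auto simp: kill_X pos_root uminus_root)
    finally show ?thesis using that finite_pos by simp
  qed
  show "c = ?c"
  proof
    fix \<gamma>
    show "c \<gamma> = ?c \<gamma>"
    proof (cases "\<gamma> \<in> \<Sigma>p")
      case True
      then show ?thesis
        using pick[OF True, of c] pick[OF True, of "\<lambda>\<beta>. kill (h U) (X (- \<beta>))"] s
        by (simp add: s_def n_part_def)
    next
      case False
      then show ?thesis using c by simp
    qed
  qed
qed

lemma Z_coeff_eq:
  assumes n: "n \<in> N_group br \<aa> \<Sigma>p" and \<omega>: "\<omega> \<in> \<Sigma>p"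
  shows "Z_coeff br \<theta> \<aa> \<Sigma>p \<omega> X U n = kill U (n (X (- \<omega>)))"
proof -
  obtain h where h: "aut h" "\<And>x. n (h x) = x" "\<And>x. h (n x) = x"
    using aut_inverse[OF N_group_aut[OF n]] by blast
  have "kill (h U) (X (- \<omega>)) = kill (n (h U)) (n (X (- \<omega>)))"
    by (simp add: kill_aut_apply[OF N_group_aut[OF n]])
  then show ?thesis
    unfolding Z_coeff_def frame_coeffs_eq[OF n h(2,3)] using \<omega> h(2) by simp
qed

end

section \<open>Regular elements separating the roots\<close>

lemma eventually_affine_nonzero:
  fixes p q :: real
  assumes "p \<noteq> 0 \<or> q \<noteq> 0"
  shows "\<forall>\<^sub>F s in at_right 0. p + s * q \<noteq> 0"
proof (cases "p = 0")
  case True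
  then show ?thesis using assms eventually_at_right_less[of 0] by (auto elim: eventually_mono)
next
  case False
  have "((\<lambda>s. p + s * q) \<longlongrightarrow> p + 0 * q) (at_right 0)" by (intro tendsto_intros)
  then show ?thesis using False by (intro tendsto_imp_eventually_ne[of _ p]) simp_all
qed

context root_data
begin

text \<open>Adding a small positive multiple s of an E that separates the new pair works: each
  difference is affine in s, with nonzero constant term for the old pairs and nonzero slope for the
  new one.\<close>

lemma exists_separating:
  assumes "finite Q" "Q \<subseteq> {(\<alpha>, \<beta>). \<alpha> \<in> R \<and> \<beta> \<in> R \<and> \<alpha> \<noteq> \<beta>}"
  shows "\<exists>D\<in>\<aa>. \<forall>(\<alpha>, \<beta>)\<in>Q. \<alpha> D \<noteq> \<beta> D"
  using assms
proof (induction Q)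
  case empty
  then show ?case using subspace_0[OF subspace_a] by blast
next
  case (insert q Q)
  obtain D where D: "D \<in> \<aa>" "\<forall>(\<alpha>, \<beta>)\<in>Q. \<alpha> D \<noteq> \<beta> D" using insert by auto
  obtain \<alpha>0 \<beta>0 where q: "q = (\<alpha>0, \<beta>0)" "\<alpha>0 \<in> R" "\<beta>0 \<in> R" "\<alpha>0 \<noteq> \<beta>0" using insert.prems by auto
  obtain E where E: "E \<in> \<aa>" "\<alpha>0 E \<noteq> \<beta>0 E" using root_eqI[OF q(2,3)] q(4) by blast
  have "\<forall>\<^sub>F s in at_right 0. fst r D - snd r D + s * (fst r E - snd r E) \<noteq> 0" if "r \<in> insert q Q" for r
    using that D(2) E(2) q(1) by (intro eventually_affine_nonzero) (auto simp: case_prod_beta)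
  then have "\<forall>\<^sub>F s in at_right (0 :: real). \<forall>r\<in>insert q Q. fst r D - snd r D + s * (fst r E - snd r E) \<noteq> 0"
    using insert.hyps(1) by (intro eventually_ball_finite) auto
  from eventually_happens'[OF trivial_limit_at_right_real this]
  obtain s where s: "\<forall>r\<in>insert q Q. fst r D - snd r D + s * (fst r E - snd r E) \<noteq> 0"
    by blast
  have sE: "s *\<^sub>R E \<in> \<aa>" using E(1) by (rule subspace_scale[OF subspace_a])
  have "fst r (D + s *\<^sub>R E) \<noteq> snd r (D + s *\<^sub>R E)" if r: "r \<in> insert q Q" for r
  proof -
    have "fst r \<in> R" "snd r \<in> R" using insert.prems r by auto
    then show ?thesis
      using s[rule_format, OF r] by (simp add: root_add[OF _ D(1) sE] root_scale[OF _ E(1)] algebra_simps)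
  qed
  then show ?case using subspace_add[OF subspace_a D(1) sE] by (auto simp: case_prod_beta intro!: bexI[of _ "D + s *\<^sub>R E"])
qed

text \<open>The element defining the chamber may take equal values on distinct roots. A small
  perturbation separates them while keeping the sign of every root, hence the positive
  system.\<close>

lemma exists_regular_data:
  assumes "positive_system br \<aa> \<Sigma>p"
  shows "\<exists>H0. regular_data br \<theta> \<aa> X \<Sigma>p H0"
proof -
  obtain H1 where H1: "H1 \<in> \<aa>" "\<forall>\<alpha>\<in>R. \<alpha> H1 \<noteq> 0" "\<Sigma>p = {\<alpha> \<in> R. \<alpha> H1 > 0}"
    using assms by (auto simp: positive_system_def)
  let ?Q = "{(\<alpha>, \<beta>). \<alpha> \<in> R \<and> \<beta> \<in> R \<and> \<alpha> \<noteq> \<beta>}"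
  have finQ: "finite ?Q"
    by (rule finite_subset[of _ "R \<times> R"]) (auto simp: finite_roots)
  then obtain D where D: "D \<in> \<aa>" "\<forall>(\<alpha>, \<beta>)\<in>?Q. \<alpha> D \<noteq> \<beta> D" using exists_separating by blast
  have "\<forall>\<^sub>F s in at_right 0. fst r H1 - snd r H1 + s * (fst r D - snd r D) \<noteq> 0" if "r \<in> ?Q" for r
    using that D(2) by (intro eventually_affine_nonzero) (auto simp: case_prod_beta)
  then have ev1: "\<forall>\<^sub>F s in at_right (0 :: real). \<forall>r\<in>?Q. fst r H1 - snd r H1 + s * (fst r D - snd r D) \<noteq> 0"
    using finQ by (intro eventually_ball_finite) auto
  have "\<forall>\<^sub>F s in at_right 0. sgn (\<alpha> H1 + s * \<alpha> D) = sgn (\<alpha> H1)" if "\<alpha> \<in> R" for \<alpha>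
  proof -
    have lim: "((\<lambda>s. \<alpha> H1 + s * \<alpha> D) \<longlongrightarrow> \<alpha> H1 + 0 * \<alpha> D) (at_right 0)" by (intro tendsto_intros)
    have "\<alpha> H1 \<noteq> 0" using H1(2) that by blast
    then consider "\<alpha> H1 > 0" | "\<alpha> H1 < 0" by linarith
    then show ?thesis
    proof cases
      case 1
      then have "\<forall>\<^sub>F s in at_right 0. \<alpha> H1 + s * \<alpha> D > 0" using order_tendstoD(1)[OF lim] by simp
      then show ?thesis using 1 by (auto elim: eventually_mono)
    next
      case 2
      then have "\<forall>\<^sub>F s in at_right 0. \<alpha> H1 + s * \<alpha> D < 0" using order_tendstoD(2)[OF lim] by simp
      then show ?thesis using 2 by (auto elim: eventually_mono)
    qed
  qed
  then have "\<forall>\<^sub>F s in at_right (0 :: real). \<forall>\<alpha>\<in>R. sgn (\<alpha> H1 + s * \<alpha> D) = sgn (\<alpha> H1)"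
    using finite_roots by (intro eventually_ball_finite) auto
  with ev1 have "\<forall>\<^sub>F s in at_right (0 :: real).
      (\<forall>r\<in>?Q. fst r H1 - snd r H1 + s * (fst r D - snd r D) \<noteq> 0) \<and>
      (\<forall>\<alpha>\<in>R. sgn (\<alpha> H1 + s * \<alpha> D) = sgn (\<alpha> H1))"
    by (rule eventually_conj)
  from eventually_happens'[OF trivial_limit_at_right_real this]
  obtain s where sep: "(\<forall>r\<in>?Q. fst r H1 - snd r H1 + s * (fst r D - snd r D) \<noteq> 0) \<and>
      (\<forall>\<alpha>\<in>R. sgn (\<alpha> H1 + s * \<alpha> D) = sgn (\<alpha> H1))"
    by (elim exE)
  note s = bspec[OF conjunct1[OF sep]] bspec[OF conjunct2[OF sep]]
  define H0 where "H0 = H1 + s *\<^sub>R D"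
  have sD: "s *\<^sub>R D \<in> \<aa>" using D(1) by (rule subspace_scale[OF subspace_a])
  have val: "\<alpha> H0 = \<alpha> H1 + s * \<alpha> D" if "\<alpha> \<in> R" for \<alpha>
    unfolding H0_def by (simp add: root_add[OF that H1(1) sD] root_scale[OF that D(1)])
  have "regular_data br \<theta> \<aa> X \<Sigma>p H0"
  proof
    show "H0 \<in> \<aa>" unfolding H0_def by (rule subspace_add[OF subspace_a H1(1) sD])
    show "\<alpha> H0 \<noteq> 0" if "\<alpha> \<in> R" for \<alpha>
      using s(2)[OF that] H1(2) that by (auto simp: val[OF that] sgn_eq_0_iff)
    show "\<alpha> = \<beta>" if "\<alpha> \<in> R" "\<beta> \<in> R" "\<alpha> H0 = \<beta> H0" for \<alpha> \<beta>
      using s(1)[of "(\<alpha>, \<beta>)"] that by (auto simp: val algebra_simps)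
    have "\<alpha> H0 > 0 \<longleftrightarrow> \<alpha> H1 > 0" if "\<alpha> \<in> R" for \<alpha>
      using s(2)[OF that] by (metis val[OF that] sgn_1_pos)
    then show "\<Sigma>p = {\<alpha> \<in> R. \<alpha> H0 > 0}" using H1(3) by blast
  qed
  then show ?thesis by blast
qed

end

section \<open>A quadratic relation on the orbit of the lowest root vector\<close>

locale highest_root_data = regular_data br \<theta> \<aa> X \<Sigma>p H0
  for br :: "'g::euclidean_space \<Rightarrow> 'g \<Rightarrow> 'g" and \<theta> :: "'g \<Rightarrow> 'g" and \<aa> :: "'g set"
    and X :: "('g \<Rightarrow> real) \<Rightarrow> 'g" and \<Sigma>p :: "('g \<Rightarrow> real) set" and H0 :: 'g +
  fixes \<omega> :: "'g \<Rightarrow> real"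
  assumes highest: "highest_root br \<aa> \<Sigma>p \<omega>"
begin

lemma \<omega>_root: "\<omega> \<in> R"
  using highest by (simp add: highest_root_def)

lemma root_le_highest: assumes "\<alpha> \<in> R" shows "\<alpha> H0 \<le> \<omega> H0"
proof -
  obtain m :: "('g \<Rightarrow> real) \<Rightarrow> nat" where "\<omega> H0 - \<alpha> H0 = (\<Sum>\<beta>\<in>\<Sigma>p. real (m \<beta>) * \<beta> H0)"
    using highest assms H0_a unfolding highest_root_def by blast
  also have "\<dots> \<ge> 0" by (intro sum_nonneg mult_nonneg_nonneg) (auto simp: pos_eq)
  finally show ?thesis by simp
qed

lemma root_less_highest: "\<alpha> \<in> R \<Longrightarrow> \<alpha> \<noteq> \<omega> \<Longrightarrow> \<alpha> H0 < \<omega> H0"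
  using root_le_highest[of \<alpha>] H0_inj[of \<alpha> \<omega>] \<omega>_root by force

lemma \<omega>_H0_pos: "\<omega> H0 > 0"
  using root_le_highest[OF uminus_root[OF \<omega>_root]] H0_nonzero[OF \<omega>_root] by simp

lemma \<omega>_pos: "\<omega> \<in> \<Sigma>p"
  by (simp add: pos_eq \<omega>_root \<omega>_H0_pos)

text \<open>The source of all vanishing brackets below: a bracket whose degree would exceed that of
  \<omega> in absolute value is 0.\<close>

lemma eigsp_beyond_highest:
  assumes "v \<in> eigsp H0 c" "\<bar>c\<bar> > \<omega> H0"
  shows "v = 0"
proof (rule ccontr)
  assume "v \<noteq> 0"
  then consider "c = 0" | \<alpha> where "\<alpha> \<in> R" "c = \<alpha> H0" using eigsp_nonzero[OF H0_a assms(1)] by blast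
  then show False
  proof cases
    case (2 \<alpha>)
    then show False
      using assms(2) root_le_highest[OF 2(1)] root_le_highest[OF uminus_root[OF 2(1)]] by (simp add: abs_if split: if_splits)
  qed (use assms(2) \<omega>_H0_pos in simp)
qed

lemma br_X_eq_0: "v \<in> eigsp H0 c \<Longrightarrow> \<beta> \<in> R \<Longrightarrow> \<bar>\<beta> H0 + c\<bar> > \<omega> H0 \<Longrightarrow> br (X \<beta>) v = 0"
  using br_eigsp[OF X_eigsp[OF H0_a]] eigsp_beyond_highest by blast

abbreviation Xp :: 'g where "Xp \<equiv> X \<omega>"
abbreviation Xm :: 'g where "Xm \<equiv> X (- \<omega>)"
abbreviation H\<omega> :: 'g where "H\<omega> \<equiv> Hvec \<omega>"
abbreviation \<omega>sq :: real where "\<omega>sq \<equiv> \<omega> H\<omega>"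
abbreviation half where "half \<equiv> roots_half br \<aa> \<Sigma>p \<omega>"

lemma H\<omega>_a: "H\<omega> \<in> \<aa>"
  by (rule Hvec_in_a[OF \<omega>_root])

lemma Xp_eigsp: "Xp \<in> eigsp H0 (\<omega> H0)" and Xm_eigsp: "Xm \<in> eigsp H0 (- \<omega> H0)"
  using X_eigsp[OF H0_a \<omega>_root] X_eigsp[OF H0_a uminus_root[OF \<omega>_root]] by simp_all

lemma br_Xm_Xp: "br Xm Xp = - H\<omega>"
  unfolding Hvec_def by (rule br_skew)

lemma br_Xm_a: "H \<in> \<aa> \<Longrightarrow> br Xm H = \<omega> H *\<^sub>R Xm"
  using br_skew[of Xm H] br_a_X[OF _ uminus_root[OF \<omega>_root], of H] by simp

lemma half_iff: "\<alpha> \<in> half \<longleftrightarrow> \<alpha> \<in> R \<and> \<alpha> H0 > 0 \<and> \<alpha> H\<omega> = \<omega>sq / 2"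
  by (auto simp: roots_half_def root_inner_eq \<omega>_root pos_eq)

text \<open>Applying ad X_-\<omega> twice lowers degrees by 2 \<omega>(H0), which leaves the
  admissible range except on X_\<omega>. There [X_-\<omega>, [X_-\<omega>, X_\<omega>]] =
  -[X_-\<omega>, H_\<omega>] supplies the constant -(\<omega>, \<omega>).\<close>

lemma br_Xm_br_Xm: "br Xm (br Xm Y) = (- \<omega>sq * kill Xm Y) *\<^sub>R Xm"
proof (rule linear_eq_on_root_data[of "\<lambda>Y. br Xm (br Xm Y)"])
  show "linear (\<lambda>Y. br Xm (br Xm Y))" by (rule linear_br_br)
  show "linear (\<lambda>Y. (- \<omega>sq * kill Xm Y) *\<^sub>R Xm)"
    by (rule linearI) (simp_all add: kill.add_right kill.scaleR_right algebra_simps)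
  show "br Xm (br Xm H) = (- \<omega>sq * kill Xm H) *\<^sub>R Xm" if "H \<in> \<aa>" for H
    using that by (simp add: br_Xm_a br.scaleR_right kill_a_X uminus_root \<omega>_root)
  fix \<beta> assume \<beta>: "\<beta> \<in> R"
  show "br Xm (br Xm (X \<beta>)) = (- \<omega>sq * kill Xm (X \<beta>)) *\<^sub>R Xm"
  proof (cases "\<beta> = \<omega>")
    case True
    have "kill Xm Xp = 1" using kill_X_uminus[OF \<omega>_root] kill_commute[of Xm Xp] by simp
    then show ?thesis by (simp add: True br_Xm_Xp br.minus_right br_Xm_a H\<omega>_a)
  next
    case False
    have "br Xm (X \<beta>) \<in> eigsp H0 (- \<omega> H0 + \<beta> H0)"
      by (rule br_eigsp[OF Xm_eigsp X_eigsp[OF H0_a \<beta>]])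
    then have "br Xm (br Xm (X \<beta>)) = 0"
      using root_less_highest[OF \<beta> False] by (intro br_X_eq_0[OF _ uminus_root[OF \<omega>_root]]) auto
    moreover have "kill Xm (X \<beta>) = 0"
      using False by (simp add: kill_X uminus_root \<omega>_root \<beta>)
    ultimately show ?thesis by simp
  qed
qed

text \<open>For negative \<beta> let V = [X_\<beta>, X_\<omega>]. Jacobi gives [X_-\<omega>, V] =
  \<beta>(H_\<omega>) X_\<beta>, and applying ad X_-\<omega> to [X_\<omega>, V] = 0 gives (2
  \<beta>(H_\<omega>) + (\<omega>, \<omega>)) V = 0. So either V = 0 and \<beta> is orthogonal to
  \<omega>, or -\<beta> is in the half set.\<close>

lemma br_Xm_br_Xp_root:
  assumes \<beta>: "\<beta> \<in> R" "\<beta> \<noteq> - \<omega>"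
  shows "br Xm (br (X \<beta>) Xp) = (if - \<beta> \<in> half then (- \<omega>sq / 2) *\<^sub>R X \<beta> else 0)"
proof (cases "\<beta> H0 > 0")
  case True
  then have "br (X \<beta>) Xp = 0" by (intro br_X_eq_0[OF Xp_eigsp \<beta>(1)]) simp
  moreover have "- \<beta> \<notin> half" using True by (auto simp: half_iff)
  ultimately show ?thesis by (simp add: br.zero_right)
next
  case False
  then have neg: "\<beta> H0 < 0" using H0_nonzero[OF \<beta>(1)] by simp
  have "- \<beta> \<noteq> \<omega>" using \<beta>(2) fun_uminus_uminus by metis
  then have gt: "- \<beta> H0 < \<omega> H0" using root_less_highest[OF uminus_root[OF \<beta>(1)]] by simp
  let ?V = "br (X \<beta>) Xp"
  have "br Xm (X \<beta>) = 0"
    using neg by (intro br_X_eq_0[OF X_eigsp[OF H0_a \<beta>(1)] uminus_root[OF \<omega>_root]]) simp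
  then have T: "br Xm ?V = \<beta> H\<omega> *\<^sub>R X \<beta>"
    using jacobi[of Xm "X \<beta>" Xp] br_skew[of "X \<beta>" H\<omega>] br_a_X[OF H\<omega>_a \<beta>(1)]
    by (simp add: br.zero_left br_Xm_Xp br.minus_right)
  have V: "?V \<in> eigsp H0 (\<beta> H0 + \<omega> H0)" by (rule br_eigsp[OF X_eigsp[OF H0_a \<beta>(1)] Xp_eigsp])
  have VH: "br H\<omega> ?V = (\<beta> H\<omega> + \<omega>sq) *\<^sub>R ?V"
    using root_spaceD[OF br_root_space[OF X_root_space[OF \<beta>(1)] X_root_space[OF \<omega>_root]] H\<omega>_a] .
  have "br Xp ?V = 0"
    using gt \<omega>_H0_pos by (intro br_X_eq_0[OF V \<omega>_root]) simp
  then have "0 = br (- H\<omega>) ?V + br Xp (\<beta> H\<omega> *\<^sub>R X \<beta>)"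
    using jacobi[of Xm Xp ?V] by (simp only: T br_Xm_Xp br.zero_right)
  also have "\<dots> = - ((\<beta> H\<omega> + \<omega>sq) *\<^sub>R ?V) + - (\<beta> H\<omega> *\<^sub>R ?V)"
    using br_skew[of Xp "X \<beta>"] by (simp add: br.minus_left VH br.scaleR_right)
  also have "\<dots> = - ((\<beta> H\<omega> + \<omega>sq + \<beta> H\<omega>) *\<^sub>R ?V)"
    by (simp only: scaleR_add_left minus_add_distrib add.assoc)
  finally have quad: "?V = 0 \<or> \<beta> H\<omega> + \<omega>sq + \<beta> H\<omega> = 0"
    by (metis neg_0_equal_iff_equal scaleR_eq_0_iff)
  show ?thesis
  proof (cases "?V = 0")
    case True
    then have "\<beta> H\<omega> = 0" using T X_nonzero[OF \<beta>(1)] by (simp add: br.zero_right)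
    then have "- \<beta> \<notin> half" using root_Hvec_pos[OF \<omega>_root] by (simp add: half_iff)
    then show ?thesis using True by (simp add: br.zero_right)
  next
    case False
    then have bH: "\<beta> H\<omega> = - \<omega>sq / 2" using quad by simp
    then have "- \<beta> \<in> half" using neg uminus_root[OF \<beta>(1)] by (simp add: half_iff)
    then show ?thesis using T bH by simp
  qed
qed

lemma finite_half: "finite half"
  using finite_pos by (simp add: roots_half_def)

text \<open>Checked on the Cartan subspace and on each root vector. Paired with Y, the right-hand
  side is the quadratic form of the final identity.\<close>

lemma br_Xm_br_Xp:
  "br Xm (br Y Xp) = - (kill Y H\<omega> *\<^sub>R H\<omega>) - (\<omega>sq * kill Y Xp) *\<^sub>R Xm
     - (\<omega>sq / 2) *\<^sub>R (\<Sum>\<alpha>\<in>half. kill Y (X \<alpha>) *\<^sub>R X (- \<alpha>))"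
proof -
  define S where "S Y = - (kill Y H\<omega> *\<^sub>R H\<omega>) - (\<omega>sq * kill Y Xp) *\<^sub>R Xm
     - (\<omega>sq / 2) *\<^sub>R (\<Sum>\<alpha>\<in>half. kill Y (X \<alpha>) *\<^sub>R X (- \<alpha>))" for Y
  have "br Xm (br Y Xp) = S Y"
  proof (rule linear_eq_on_root_data[of "\<lambda>Y. br Xm (br Y Xp)" S])
    show "linear (\<lambda>Y. br Xm (br Y Xp))"
      by (rule linearI) (simp_all add: br.add_left br.add_right br.scaleR_left br.scaleR_right)
    show "linear S"
      unfolding S_def
      by (rule linearI)
        (simp_all add: kill.add_left kill.scaleR_left algebra_simps sum.distrib scaleR_sum_right)
    show "br Xm (br H Xp) = S H" if "H \<in> \<aa>" for H
    proof -
      have "(\<Sum>\<alpha>\<in>half. kill H (X \<alpha>) *\<^sub>R X (- \<alpha>)) = 0"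
        using that by (intro sum.neutral) (simp add: kill_a_X half_iff)
      then show ?thesis
        using that by (simp add: S_def br_a_X \<omega>_root br.scaleR_right br_Xm_Xp kill_Hvec kill_a_X)
    qed
    fix \<beta> assume \<beta>: "\<beta> \<in> R"
    have "(\<Sum>\<alpha>\<in>half. kill (X \<beta>) (X \<alpha>) *\<^sub>R X (- \<alpha>)) = (\<Sum>\<alpha>\<in>half. if \<alpha> = - \<beta> then X (- \<alpha>) else 0)"
      using \<beta> by (intro sum.cong refl) (auto simp: kill_X half_iff)
    then have sum: "(\<Sum>\<alpha>\<in>half. kill (X \<beta>) (X \<alpha>) *\<^sub>R X (- \<alpha>)) = (if - \<beta> \<in> half then X \<beta> else 0)"
      using finite_half by simp
    have kH: "kill (X \<beta>) H\<omega> = 0" by (rule kill_a_X(2)[OF H\<omega>_a \<beta>])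
    show "br Xm (br (X \<beta>) Xp) = S (X \<beta>)"
    proof (cases "\<beta> = - \<omega>")
      case True
      have "\<omega> \<notin> half" using root_Hvec_pos[OF \<omega>_root] by (simp add: half_iff)
      moreover have "kill Xm Xp = 1" using kill_X_uminus[OF \<omega>_root] kill_commute[of Xm Xp] by simp
      ultimately show ?thesis
        using kH sum by (simp add: S_def True br_Xm_Xp br.minus_right br_Xm_a H\<omega>_a)
    next
      case False
      have "kill (X \<beta>) Xp = 0"
        using kill_X[OF \<beta> \<omega>_root] False fun_uminus_uminus[of \<beta>] by (auto split: if_splits)
      then show ?thesis using br_Xm_br_Xp_root[OF \<beta> False] by (simp add: S_def sum kH)
    qed
  qed
  then show ?thesis by (simp only: S_def)
qed

text \<open>[X_-\<alpha>, X_\<omega>] has weight \<omega> - \<alpha>, and it is nonzero because its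
  bracket with X_-\<omega> is a nonzero multiple of X_-\<alpha>.\<close>

lemma half_reflect: assumes \<alpha>: "\<alpha> \<in> half" shows "\<omega> - \<alpha> \<in> half"
proof -
  have R: "\<alpha> \<in> R" "- \<alpha> \<in> R" and aH: "\<alpha> H\<omega> = \<omega>sq / 2"
    using \<alpha> pos_root uminus_root by (auto simp: half_iff)
  have "\<alpha> \<noteq> \<omega>" using aH root_Hvec_pos[OF \<omega>_root] by auto
  then have "br Xm (br (X (- \<alpha>)) Xp) = (- \<omega>sq / 2) *\<^sub>R X (- \<alpha>)"
    using br_Xm_br_Xp_root[OF R(2)] \<alpha> by simp
  then have "br (X (- \<alpha>)) Xp \<noteq> 0"
    using X_nonzero[OF R(2)] root_Hvec_pos[OF \<omega>_root] by (auto simp: br.zero_right)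
  moreover have "br (X (- \<alpha>)) Xp \<in> root_space br \<aa> (\<omega> - \<alpha>)"
  proof -
    have "(\<lambda>H. (- \<alpha>) H + \<omega> H) = \<omega> - \<alpha>" by (simp add: fun_eq_iff)
    then show ?thesis using br_root_space[OF X_root_space[OF R(2)] X_root_space[OF \<omega>_root]] by simp
  qed
  moreover have "(\<omega> - \<alpha>) H\<omega> = \<omega>sq / 2" by (simp add: aH)
  ultimately have root: "\<omega> - \<alpha> \<in> R"
    using rootD(1)[OF \<omega>_root] rootD(1)[OF R(1)] H\<omega>_a root_Hvec_pos[OF \<omega>_root]
    by (auto simp: roots_def intro!: bexI[of _ H\<omega>])
  have "(\<omega> - \<alpha>) H0 > 0" using root_less_highest[OF R(1) \<open>\<alpha> \<noteq> \<omega>\<close>] by simp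
  then show ?thesis using root \<open>(\<omega> - \<alpha>) H\<omega> = \<omega>sq / 2\<close> by (simp add: half_iff)
qed

text \<open>n adds to X_-\<omega> only terms of higher degree, which pair to 0 with X_\<omega>. This
  value 1 makes the orbit relation linear in B(W, X_-\<omega>).\<close>

lemma kill_N_lowest: assumes "n \<in> N_group br \<aa> \<Sigma>p" shows "kill (n Xm) Xp = 1"
proof -
  obtain x where x: "x \<in> Gr H0 {0<..}" "n = Exp br x" using assms by (auto simp: N_group_eq)
  have "n Xm - Xm \<in> Gr H0 {- \<omega> H0<..}"
    unfolding x(2) using Xm_eigsp by (intro Exp_pos_raise[OF x(1)] eigsp_Gr) auto
  then have "\<forall>u\<in>eigsp H0 (\<omega> H0). kill (n Xm - Xm) u = 0"
    unfolding Gr_iff by (elim allE[of _ "\<omega> H0"]) simp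
  then have "kill (n Xm) Xp = kill Xm Xp" using Xp_eigsp by (simp add: kill.diff_left)
  then show ?thesis using kill_X_uminus[OF \<omega>_root] kill_commute[of Xm Xp] by simp
qed

text \<open>
  Conjugating \<open>(ad X\<^bsub>-\<omega>\<^esub>)\<^sup>2 Y = - (\<omega>, \<omega>) B(X\<^bsub>-\<omega>\<^esub>, Y) X\<^bsub>-\<omega>\<^esub>\<close> by \<open>n\<close> gives the same relation for
  \<open>W = n X\<^bsub>-\<omega>\<^esub>\<close>; it is evaluated at \<open>Y = X\<^bsub>-\<omega>\<^esub>\<close> and paired with \<open>X\<^bsub>\<omega>\<^esub>\<close>.
\<close>

lemma orbit_relation:
  assumes n: "n \<in> N_group br \<aa> \<Sigma>p"
  defines "W \<equiv> n Xm"
  shows "kill Xm W = - (kill H\<omega> W)\<^sup>2 / (2 * \<omega>sq) - 1/4 * (\<Sum>\<alpha>\<in>half. kill (X \<alpha>) W * kill (X (- \<alpha>)) W)"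
proof -
  have naut: "aut n" by (rule N_group_aut[OF n])
  obtain h :: "'g \<Rightarrow>\<^sub>L 'g" where h: "\<And>x. n (h x) = x" using aut_inverse[OF naut] by blast
  have "kill Xm (h Xm) = kill W Xm"
    unfolding W_def using kill_aut_apply[OF naut, of Xm "h Xm"] by (simp add: h)
  moreover have "br W (br W Xm) = n (br Xm (br Xm (h Xm)))"
    by (simp add: W_def aut_br[OF naut] h)
  ultimately have WW: "br W (br W Xm) = (- \<omega>sq * kill W Xm) *\<^sub>R W"
    by (simp only: br_Xm_br_Xm blinfun.scaleR_right W_def)
  \<comment> \<open>The same number is evaluated twice: here W is moved across the form and
    \<open>WW\<close> applied, next X_-\<omega> is moved and the operator formula applied.\<close>
  have "kill (br W Xm) (br W Xp) = \<omega>sq * kill W Xm"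
    using kill_br_right[of "br W Xm" W Xp] kill_N_lowest[OF n]
    by (simp add: WW kill.scaleR_left kill.minus_left flip: W_def)
  moreover have "kill (br W Xm) (br W Xp) = kill W (br Xm (br W Xp))" by (rule kill_br_left)
  moreover have "kill W (br Xm (br W Xp)) = - (kill W H\<omega>)\<^sup>2 - \<omega>sq * kill W Xm
      - \<omega>sq / 2 * (\<Sum>\<alpha>\<in>half. kill W (X \<alpha>) * kill W (X (- \<alpha>)))"
    using kill_N_lowest[OF n]
    by (simp add: br_Xm_br_Xp W_def kill.diff_right kill.minus_right kill.scaleR_right kill.sum_right power2_eq_square)
  \<comment> \<open>The term with B(W, X_-\<omega>) comes from both evaluations with opposite signs,
    hence the factor 2.\<close>
  ultimately have "2 * \<omega>sq * kill W Xm = - (kill W H\<omega>)\<^sup>2 - \<omega>sq / 2 * (\<Sum>\<alpha>\<in>half. kill W (X \<alpha>) * kill W (X (- \<alpha>)))"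
    by simp
  then have "kill W Xm = - (kill W H\<omega>)\<^sup>2 / (2 * \<omega>sq) - 1/4 * (\<Sum>\<alpha>\<in>half. kill W (X \<alpha>) * kill W (X (- \<alpha>)))"
    using root_Hvec_pos[OF \<omega>_root] by (simp add: field_simps)
  then show ?thesis by (simp add: kill_commute[of _ W])
qed

text \<open>Reindexing by the involution \<alpha> -> \<omega> - \<alpha> turns the products over
  \<alpha> and -\<alpha> from the orbit relation into those over \<omega> - \<alpha> and \<alpha> -
  \<omega> of the claim.\<close>

lemma sum_half_reflect:
  "(\<Sum>\<alpha>\<in>half. f \<alpha> * f (- \<alpha>)) = (\<Sum>\<alpha>\<in>half. f (\<omega> - \<alpha>) * f (\<alpha> - \<omega>))" for f :: "('g \<Rightarrow> real) \<Rightarrow> real"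
proof (rule sum.reindex_bij_witness[of _ "\<lambda>\<alpha>. \<omega> - \<alpha>" "\<lambda>\<alpha>. \<omega> - \<alpha>"])
  show "\<omega> - (\<omega> - \<alpha>) = \<alpha>" for \<alpha> :: "'g \<Rightarrow> real" by (simp add: fun_eq_iff)
  then show "\<omega> - (\<omega> - \<alpha>) = \<alpha>" for \<alpha> :: "'g \<Rightarrow> real" .
  fix \<alpha> assume "\<alpha> \<in> half"
  then show "\<omega> - \<alpha> \<in> half" by (rule half_reflect)
  have "\<omega> - (\<omega> - \<alpha>) = \<alpha>" "(\<omega> - \<alpha>) - \<omega> = - \<alpha>" by (simp_all add: fun_eq_iff)
  then show "f (\<omega> - (\<omega> - \<alpha>)) * f ((\<omega> - \<alpha>) - \<omega>) = f \<alpha> * f (- \<alpha>)" by simp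
qed (rule half_reflect)

end

theorem proposition6:
  fixes br :: "'g::euclidean_space \<Rightarrow> 'g \<Rightarrow> 'g"
    and \<theta> :: "'g \<Rightarrow> 'g"
    and \<aa> :: "'g set"
    and \<Sigma>p :: "('g \<Rightarrow> real) set"
    and \<omega> :: "'g \<Rightarrow> real"
    and X :: "('g \<Rightarrow> real) \<Rightarrow> 'g"
    and H :: 'g
    and p :: "'g \<Rightarrow> ('g \<Rightarrow>\<^sub>L 'g) \<Rightarrow> real"
    and n :: "'g \<Rightarrow>\<^sub>L 'g"
  assumes "simple_lie_algebra br"
    and "cartan_involution br \<theta>"
    and "cartan_subspace br \<theta> \<aa>"
    and "split_cartan br \<theta> \<aa>"
    and "dim \<aa> > 1"
    and "positive_system br \<aa> \<Sigma>p"
    and "highest_root br \<aa> \<Sigma>p \<omega>"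
    and "root_vectors br \<aa> X"
  defines "H \<equiv> (1 / sqrt (2 * \<omega> (coroot_vec br \<aa> \<omega>))) *\<^sub>R coroot_vec br \<aa> \<omega>"
    and "p \<equiv> Z_coeff br \<theta> \<aa> \<Sigma>p \<omega> X"
  assumes "n \<in> N_group br \<aa> \<Sigma>p"
  shows "p (X (- \<omega>)) n =
    - (p H n)\<^sup>2 - 1/4 * (\<Sum>\<alpha>\<in>roots_half br \<aa> \<Sigma>p \<omega>. p (X (\<omega> - \<alpha>)) n * p (X (\<alpha> - \<omega>)) n)"
proof -
  interpret root_data br \<theta> \<aa> X
    using assms by unfold_locales (simp_all add: simple_lie_algebra_def)
  obtain H0 where "regular_data br \<theta> \<aa> X \<Sigma>p H0"
    using exists_regular_data[OF assms(6)] by blast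
  then interpret regular_data br \<theta> \<aa> X \<Sigma>p H0 .
  interpret highest_root_data br \<theta> \<aa> X \<Sigma>p H0 \<omega>
    by unfold_locales (rule assms(7))
  have n: "n \<in> N_group br \<aa> \<Sigma>p" by fact
  have p: "p U n = kill U (n Xm)" for U
    unfolding p_def by (rule Z_coeff_eq[OF n \<omega>_pos])
  have H: "H = (1 / sqrt (2 * \<omega>sq)) *\<^sub>R H\<omega>"
    unfolding H_def by (simp add: coroot_vec_eq \<omega>_root)
  \<comment> \<open>The normalization of \<open>H\<close> absorbs exactly the denominator 2
    (\<omega>, \<omega>) of the orbit relation; positivity of (\<omega>, \<omega>) gives the square
    of the root.\<close>
  have "(p H n)\<^sup>2 = (kill H\<omega> (n Xm))\<^sup>2 / (2 * \<omega>sq)"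
    using root_Hvec_pos[OF \<omega>_root] by (simp add: p H kill.scaleR_left power_mult_distrib power_divide)
  then show ?thesis
    using orbit_relation[OF n] sum_half_reflect[of "\<lambda>\<alpha>. kill (X \<alpha>) (n Xm)"] by (simp add: p)
qed

end
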